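(* Let $m\ge1$, let $Z\in\mathbb{R}^{m\times d}$, $Z^\top=[z_1,\dots,z_m]$, have i.i.d. rows $z_1,\dots,z_m\sim\mathcal N(0,I_d)$, with law $\mathcal D$. Let $x^*\in\mathbb{S}^{d-1}$, $t\in\mathbb{R}$ and $y=\operatorname{sign}(\max_{i\in[m]}x^*\cdot z_i+t)$. Let $\mathcal H_+$ be the class of functions $h:\mathbb{R}\to\mathbb{R}$ that are locally Lipschitz, satisfy $h'(s)+h'(-s)>0$ for a.e. $s>0$, and satisfy, for every $a\in\mathbb{R}$, $\mathbb{E}_{s\sim\mathcal N(0,1)}[|h'(a+s)|+|h'(-a-s)|]<\infty$. Then for any $h\in\mathcal H_+$, the loss $$f_h(x)=\mathbb{E}_{Z\sim\mathcal D}\Big[h\Big(-y\big(\max_{i\in[m]}x\cdot z_i+t\big)\Big)\Big]$$ is $1$-RGA at $(x,x^* )$ for every $x\in\mathbb{S}^{d-1}$ with $\theta(x,x^* )\in(0,\pi/2)$.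
   Context: $\mathbb{S}^{d-1}$ is the unit sphere of $\mathbb{R}^d$; $\theta(x,y)=\arccos(x\cdot y)$ for unit vectors; $[m]=\{1,\dots,m\}$. For a locally Lipschitz $f$, $\partial^Cf(x)$ is the Clarke subdifferential (convex hull of limits of gradients at differentiability points $y_k\to x$) and the Riemannian Clarke subdifferential is $\partial^{C,R}f(x)=\{(I-xx^\top)\xi:\xi\in\partial^Cf(x)\}$ (equal to $\{\nabla^Rf(x)\}$, the Riemannian gradient, when $f$ is continuously differentiable). $f$ is $\mu$-RGA at $(x,x^* )$ if every $g(x)\in\partial^{C,R}f(x)$ satisfies: $g(x)\neq0$ whenever $x\ne x^*$, and $g(x)\cdot x^*\le-\mu\,\sin(\theta(x,x^* ))\,\|g(x)\|_2$. *)

theory Defs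
  imports "HOL-Probability.Probability"
begin

definition angle_between :: "'a::euclidean_space \<Rightarrow> 'a \<Rightarrow> real" where
  "angle_between x y = arccos (x \<bullet> y)"

text \<open>
  A real-valued function is given by a total function \<open>f\<close> together with the set \<open>S\<close> on which
  it is really defined; the values of \<open>f\<close> outside \<open>S\<close> are irrelevant. A differentiability point
  is a point with a neighbourhood inside \<open>S\<close> at which \<open>f\<close> is differentiable. The set \<open>S\<close> matters
  for the expected loss below: its expectation exists on the closed unit ball, but for
  some admissible \<open>h\<close> it diverges at every point of norm larger than 1, where the Bochner integral
  is 0 by convention and would contribute spurious zero gradients.
\<close>

definition clarke_subdiff ::
    "'a::euclidean_space set \<Rightarrow> ('a \<Rightarrow> real) \<Rightarrow> 'a \<Rightarrow> 'a set" where
  "clarke_subdiff S f x = convex hull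
     {\<xi>. \<exists>u g. (\<forall>k::nat. u k \<in> interior S \<and> GDERIV f (u k) :> g k) \<and>
            u \<longlonglongrightarrow> x \<and> g \<longlonglongrightarrow> \<xi>}"

text \<open>\<open>(I - x x\<^sup>T) \<xi> = \<xi> - (x \<bullet> \<xi>) x\<close>.\<close>

definition riemannian_clarke_subdiff ::
    "'a::euclidean_space set \<Rightarrow> ('a \<Rightarrow> real) \<Rightarrow> 'a \<Rightarrow> 'a set" where
  "riemannian_clarke_subdiff S f x = (\<lambda>\<xi>. \<xi> - (x \<bullet> \<xi>) *\<^sub>R x) ` clarke_subdiff S f x"

text \<open>
  The last conjunct is the defining property. The first two only rule out that it holds vacuously
  because \<open>f\<close> is undefined at \<open>x\<close> or has no subgradients there; for a function that is locally
  Lipschitz around \<open>x\<close> they always hold.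
\<close>

definition is_RGA ::
    "real \<Rightarrow> 'a::euclidean_space set \<Rightarrow> ('a \<Rightarrow> real) \<Rightarrow> 'a \<Rightarrow> 'a \<Rightarrow> bool" where
  "is_RGA \<mu> S f x xs \<longleftrightarrow>
     x \<in> S \<and> riemannian_clarke_subdiff S f x \<noteq> {} \<and>
     (\<forall>g \<in> riemannian_clarke_subdiff S f x.
        (x \<noteq> xs \<longrightarrow> g \<noteq> 0) \<and> g \<bullet> xs \<le> - \<mu> * sin (angle_between x xs) * norm g)"

definition std_gaussian :: "(real ^ 'd::finite) measure" where
  "std_gaussian = density lborel (\<lambda>z. ennreal (\<Prod>j\<in>UNIV. std_normal_density (z $ j)))"

text \<open>The law of a matrix with \<open>m\<close> i.i.d. rows, presented as the family of its rows.\<close>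

definition gaussian_rows :: "nat \<Rightarrow> (nat \<Rightarrow> real ^ 'd::finite) measure" where
  "gaussian_rows m = PiM {1..m} (\<lambda>_. std_gaussian)"

definition max_score :: "nat \<Rightarrow> real \<Rightarrow> real ^ 'd::finite \<Rightarrow> (nat \<Rightarrow> real ^ 'd) \<Rightarrow> real" where
  "max_score m t x Z = (MAX i\<in>{1..m}. x \<bullet> Z i) + t"

definition label :: "nat \<Rightarrow> real \<Rightarrow> real ^ 'd::finite \<Rightarrow> (nat \<Rightarrow> real ^ 'd) \<Rightarrow> real" where
  "label m t xs Z = sgn (max_score m t xs Z)"

definition sample_loss ::
    "nat \<Rightarrow> real \<Rightarrow> real ^ 'd::finite \<Rightarrow> (real \<Rightarrow> real) \<Rightarrow> real ^ 'd \<Rightarrow> (nat \<Rightarrow> real ^ 'd) \<Rightarrow> real" where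
  "sample_loss m t xs h x Z = h (- label m t xs Z * max_score m t x Z)"

definition loss_domain ::
    "nat \<Rightarrow> real \<Rightarrow> real ^ 'd::finite \<Rightarrow> (real \<Rightarrow> real) \<Rightarrow> (real ^ 'd) set" where
  "loss_domain m t xs h = {x. integrable (gaussian_rows m) (sample_loss m t xs h x)}"

definition expected_loss ::
    "nat \<Rightarrow> real \<Rightarrow> real ^ 'd::finite \<Rightarrow> (real \<Rightarrow> real) \<Rightarrow> real ^ 'd \<Rightarrow> real" where
  "expected_loss m t xs h x = (\<integral>Z. sample_loss m t xs h x Z \<partial>gaussian_rows m)"

definition locally_lipschitz :: "(real \<Rightarrow> real) \<Rightarrow> bool" where
  "locally_lipschitz h \<longleftrightarrow> (\<forall>a. \<exists>e>0. \<exists>L. L-lipschitz_on (cball a e) h)"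

text \<open>
  The derivatives occurring here exist almost everywhere because \<open>h\<close> is locally Lipschitz. As
  \<^const>\<open>deriv\<close> is total, the second condition says explicitly that they exist at the points
  where the inequality is required.
\<close>

definition H_plus :: "(real \<Rightarrow> real) set" where
  "H_plus = {h. locally_lipschitz h \<and>
     (AE s in lborel. 0 < s \<longrightarrow>
        h differentiable (at s) \<and> h differentiable (at (- s)) \<and> deriv h s + deriv h (- s) > 0) \<and>
     (\<forall>a. integrable std_normal_distribution (\<lambda>s. \<bar>deriv h (a + s)\<bar> + \<bar>deriv h (- a - s)\<bar>))}"

end

theory Submission
  imports Defs
begin

text \<open>
  Write \<open>M u = max\<^sub>i u \<bullet> z\<^sub>i\<close> for the maximal score of a sample \<open>Z\<close>, \<open>f\<close> for the expected loss,
  \<open>xs\<close> for the target direction, and \<open>k s = h s - h (- s)\<close>. The law of \<open>Z\<close> is invariant under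
  orthogonal maps, so \<open>f u\<close> depends only on \<open>norm u\<close> and \<open>u \<bullet> xs\<close>. Hence the gradient of \<open>f\<close> at a
  differentiability point \<open>u\<close> lies in the span of \<open>u\<close> and \<open>xs\<close>, and its component orthogonal to \<open>u\<close>
  is a multiple of the component \<open>p\<close> of \<open>xs\<close> orthogonal to \<open>u\<close>
  (\<open>expected_loss_gradient_span\<close>). If the factor is negative, and bounded away from 0 near \<open>x\<close>, then
  every element of the Riemannian Clarke subdifferential at \<open>x\<close> is a negative multiple of \<open>p\<close>, and
  the inequality of the theorem holds with equality.

  For the sign of the factor, let \<open>u'\<close> arise from \<open>u\<close> by a small rotation away from \<open>xs\<close>, and let
  \<open>T\<close> be the reflection that exchanges \<open>u\<close> and \<open>u'\<close>. Reflecting the sample moves the change from the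
  score to the label:
  \<open>f u' - f u = E [(1 [M (T xs) \<le> - t] - 1 [M xs \<le> - t]) * k (M u + t)]\<close>.
  Since \<open>k\<close> is strictly increasing (\<open>H_plus_odd_part_strict_mono\<close>), a layer cake argument
  (\<open>layer_cake_gain\<close>) reduces the sign of this expectation to that of
  \<open>P (M xs \<le> - t, M u \<le> b) - P (M (T xs) \<le> - t, M u \<le> b)\<close> for all \<open>b\<close>. By independence of the rows this
  is a difference of \<open>m\<close>-th powers of probabilities for one Gaussian vector \<open>z\<close>, and these two
  probabilities differ by the mass of the set where \<open>T xs \<bullet> z \<le> - t < xs \<bullet> z\<close> and
  \<open>u' \<bullet> z \<le> b < u \<bullet> z\<close>. That mass is at least a constant times \<open>norm (u - u')\<close> for \<open>b\<close> in a bounded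
  interval (\<open>p_gap\<close>), which gives \<open>expected_loss_gain\<close> and \<open>expected_loss_gradient_bound\<close>. Only the
  integrability of the two losses is used, and not that of \<open>h (M u + t)\<close> itself; so the argument
  also covers points of norm larger than 1 in the domain of the loss.

  It remains to see that the subdifferential is not empty. For \<open>r < 1\<close> the linear map
  \<open>z \<mapsto> z + (w \<bullet> z) q\<close> with \<open>q \<bullet> r x = 1\<close> and \<open>q \<bullet> xs = 0\<close> turns \<open>f (r x + w)\<close> into the expectation of
  the loss at \<open>r x\<close>, weighted by a Gaussian likelihood ratio that is smooth in \<open>w\<close>. So \<open>f\<close> is
  differentiable at \<open>r x\<close> although \<open>h\<close> need not be, and the Gaussian integrability of \<open>h'\<close> bounds the
  gradient uniformly in \<open>r\<close> (\<open>expected_loss_differentiable\<close>); a subsequence of the gradients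
  converges as \<open>r\<close> tends to 1 (\<open>clarke_subdiff_nonempty\<close>).
\<close>


section \<open>Linear changes of variables for Lebesgue measure\<close>

lemma nn_integral_lborel_diagonal:
  fixes c :: "'d::finite \<Rightarrow> real" and g :: "real ^ 'd \<Rightarrow> ennreal"
  assumes [measurable]: "g \<in> borel_measurable borel" and c: "\<And>i. c i \<noteq> 0"
  shows "(\<integral>\<^sup>+x. g (\<chi> i. c i * x $ i) \<partial>lborel) = ennreal (1 / \<bar>\<Prod>i\<in>UNIV. c i\<bar>) * (\<integral>\<^sup>+x. g x \<partial>lborel)"
proof -
  let ?C = "\<lambda>b::real^'d. c (axis_index b)"
  let ?T = "\<lambda>x::real^'d. 0 + (\<Sum>j\<in>Basis. (?C j * (x \<bullet> j)) *\<^sub>R j)"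
  have T: "?T x = (\<chi> i. c i * x $ i)" for x
  proof (rule euclidean_eqI)
    fix b :: "real^'d" assume b: "b \<in> Basis"
    then obtain i where i: "b = axis i 1" by (auto simp: Basis_vec_def)
    have "?T x \<bullet> b = ?C b * (x \<bullet> b)"
      using b by (simp add: inner_sum_left_Basis)
    also have "\<dots> = (\<chi> i. c i * x $ i) \<bullet> b"
      by (simp add: i axis_index_axis cart_eq_inner_axis[symmetric])
    finally show "?T x \<bullet> b = (\<chi> i. c i * x $ i) \<bullet> b" .
  qed
  have P: "(\<Prod>j\<in>Basis. \<bar>?C j\<bar>) = \<bar>\<Prod>i\<in>UNIV. c i\<bar>"
    by (simp add: Basis_vec_def UNION_singleton_eq_range prod.reindex inj_on_def axis_eq_axis
        axis_index_axis abs_prod)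
  have [measurable]: "?T \<in> borel \<rightarrow>\<^sub>M borel" by simp
  have m: "(\<lambda>x::real^'d. \<chi> i. c i * x $ i) \<in> borel \<rightarrow>\<^sub>M borel"
    unfolding T[symmetric] by measurable
  note m [measurable]
  have *: "lborel = density (distr lborel borel ?T) (\<lambda>_. ennreal \<bar>\<Prod>i\<in>UNIV. c i\<bar>)"
    using lborel_affine_euclidean[of ?C 0] c P by simp
  have "(\<integral>\<^sup>+x. g x \<partial>lborel) = ennreal \<bar>\<Prod>i\<in>UNIV. c i\<bar> * (\<integral>\<^sup>+x. g (?T x) \<partial>lborel)"
    by (subst *) (simp add: nn_integral_density nn_integral_distr nn_integral_cmult del: add_0)
  moreover have "ennreal (1 / \<bar>\<Prod>i\<in>UNIV. c i\<bar>) * ennreal \<bar>\<Prod>i\<in>UNIV. c i\<bar> = 1"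
    using c by (simp add: ennreal_mult[symmetric] )
  ultimately show ?thesis
    unfolding T by (simp add: mult.assoc[symmetric])
qed

lemma nn_integral_lborel_swap:
  fixes g :: "real ^ 'd::finite \<Rightarrow> ennreal" and m n :: 'd
  assumes [measurable]: "g \<in> borel_measurable borel"
  shows "(\<integral>\<^sup>+x. g (\<chi> i. x $ Transposition.transpose m n i) \<partial>lborel) = (\<integral>\<^sup>+x. g x \<partial>lborel)"
proof -
  let ?h = "\<lambda>x::real^'d. \<chi> i. x $ Transposition.transpose m n i"
  have lin: "linear ?h"
    by (rule linearI) (simp_all add: plus_vec_def scaleR_vec_def)
  have [measurable]: "?h \<in> borel \<rightarrow>\<^sub>M borel"
    using lin by (intro borel_measurable_continuous_onI linear_continuous_on linear_conv_bounded_linear[THEN iffD1])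
  have "lborel = distr lborel borel ?h"
  proof (rule lborel_eqI)
    fix l u :: "real^'d" assume le: "\<And>b. b \<in> Basis \<Longrightarrow> l \<bullet> b \<le> u \<bullet> b"
    have lei: "l $ i \<le> u $ i" for i
      using le[of "axis i 1"] by (simp add: axis_in_Basis_iff cart_eq_inner_axis[symmetric])
    have pr: "(\<Prod>b\<in>Basis. v \<bullet> b) = (\<Prod>i\<in>UNIV. v $ i)" for v :: "real^'d"
      by (simp add: Basis_vec_def UNION_singleton_eq_range prod.reindex inj_on_def axis_eq_axis
           cart_eq_inner_axis[symmetric])
    have "?h -` box l u = box (?h l) (?h u)"
      by (auto simp: mem_box_cart) (metis transpose_involutory)+
    then have "emeasure (distr lborel borel ?h) (box l u) = emeasure lborel (box (?h l) (?h u))"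
      by (simp add: emeasure_distr)
    also have "\<dots> = (\<Prod>b\<in>Basis. (?h u - ?h l) \<bullet> b)"
      by (rule emeasure_lborel_box)
         (auto simp: Basis_vec_def cart_eq_inner_axis[symmetric] lei)
    also have "(\<Prod>b\<in>Basis. (?h u - ?h l) \<bullet> b) = (\<Prod>i\<in>UNIV. (u - l) $ Transposition.transpose m n i)"
      by (simp add: pr)
    also have "\<dots> = (\<Prod>i\<in>UNIV. (u - l) $ i)"
      using prod.permute[OF permutes_swap_id[of m UNIV n], of "\<lambda>i. (u - l) $ i"] by (simp add: o_def)
    finally show "emeasure (distr lborel borel ?h) (box l u) = (\<Prod>b\<in>Basis. (u - l) \<bullet> b)"
      by (simp add: pr)
  qed simp
  then have "(\<integral>\<^sup>+x. g x \<partial>lborel) = (\<integral>\<^sup>+x. g x \<partial>distr lborel borel ?h)" by simp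
  then show ?thesis by (simp add: nn_integral_distr)
qed

lemma nn_integral_lborel_shear:
  fixes g :: "real ^ 'd::finite \<Rightarrow> ennreal" and m n :: 'd
  assumes [measurable]: "g \<in> borel_measurable borel" and mn: "m \<noteq> n"
  shows "(\<integral>\<^sup>+x. g (\<chi> i. if i = m then x $ m + x $ n else x $ i) \<partial>lborel) = (\<integral>\<^sup>+x. g x \<partial>lborel)"
proof -
  let ?h = "\<lambda>x::real^'d. x + (x $ n) *\<^sub>R axis m 1"
  have h: "(\<chi> i. if i = m then x $ m + x $ n else x $ i) = ?h x" for x
    by (simp add: vec_eq_iff axis_def)
  interpret product_sigma_finite "\<lambda>_::real^'d. lborel :: real measure"
    by standard
  let ?a = "axis m 1 :: real^'d"
  define R :: "(real^'d) set" where "R = Basis - {?a}"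
  let ?S = "\<lambda>f::real^'d \<Rightarrow> real. \<Sum>b\<in>Basis. f b *\<^sub>R b"
  have B: "Basis = insert ?a R" by (auto simp: axis_in_Basis_iff R_def)
  have R: "finite R" "?a \<notin> R" by (auto simp: R_def)
  have I: "(\<integral>\<^sup>+x. k x \<partial>lborel) = (\<integral>\<^sup>+f. (\<integral>\<^sup>+y. k ((\<Sum>b\<in>R. f b *\<^sub>R b) + y *\<^sub>R ?a) \<partial>lborel) \<partial>Pi\<^sub>M R (\<lambda>_. lborel))"
    if [measurable]: "k \<in> borel_measurable borel" for k :: "real^'d \<Rightarrow> ennreal"
  proof -
    have meas: "(\<lambda>f. k (?S f)) \<in> borel_measurable (Pi\<^sub>M (insert ?a R) (\<lambda>_. lborel))"
      unfolding B[symmetric] by measurable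
    have "(\<integral>\<^sup>+x. k x \<partial>lborel) = (\<integral>\<^sup>+f. k (?S f) \<partial>Pi\<^sub>M Basis (\<lambda>_. lborel))"
      by (subst lborel_eq) (simp add: nn_integral_distr)
    also have "\<dots> = (\<integral>\<^sup>+f. k (?S f) \<partial>Pi\<^sub>M (insert ?a R) (\<lambda>_. lborel))"
      using B by simp
    also have "\<dots> = (\<integral>\<^sup>+f. (\<integral>\<^sup>+y. k ((\<lambda>f y. ?S (f(?a := y))) f y) \<partial>lborel) \<partial>Pi\<^sub>M R (\<lambda>_. lborel))"
      using product_nn_integral_insert[OF R meas] by simp
    also have "(\<lambda>f y. ?S (f(?a := y))) = (\<lambda>f y. (\<Sum>b\<in>R. f b *\<^sub>R b) + y *\<^sub>R ?a)"
    proof (intro ext)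
      fix f y
      have "?S (f(?a := y)) = y *\<^sub>R ?a + (\<Sum>b\<in>R. (f(?a := y)) b *\<^sub>R b)"
        unfolding B using R by (subst sum.insert) auto
      also have "(\<Sum>b\<in>R. (f(?a := y)) b *\<^sub>R b) = (\<Sum>b\<in>R. f b *\<^sub>R b)"
        using R(2) by (intro sum.cong) auto
      finally show "?S (f(?a := y)) = (\<Sum>b\<in>R. f b *\<^sub>R b) + y *\<^sub>R ?a" by simp
    qed
    finally show ?thesis .
  qed
  have [measurable]: "?h \<in> borel \<rightarrow>\<^sub>M borel"
    unfolding cart_eq_inner_axis by measurable
  have "(\<integral>\<^sup>+x. g (?h x) \<partial>lborel) = (\<integral>\<^sup>+f. (\<integral>\<^sup>+y. g (?h ((\<Sum>b\<in>R. f b *\<^sub>R b) + y *\<^sub>R ?a)) \<partial>lborel) \<partial>Pi\<^sub>M R (\<lambda>_. lborel))"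
    by (rule I) measurable
  also have "\<dots> = (\<integral>\<^sup>+f. (\<integral>\<^sup>+y. g ((\<Sum>b\<in>R. f b *\<^sub>R b) + y *\<^sub>R ?a) \<partial>lborel) \<partial>Pi\<^sub>M R (\<lambda>_. lborel))"
  proof (rule nn_integral_cong)
    fix f
    let ?Y = "(\<Sum>b\<in>R. f b *\<^sub>R b)"
    \<comment> \<open>Along coordinate \<open>m\<close> the shear is a translation, by an amount that the other coordinates fix.\<close>
    have "(\<integral>\<^sup>+y. g (?Y + y *\<^sub>R ?a) \<partial>lborel) = (\<integral>\<^sup>+y. g (?Y + (?Y $ n + 1 * y) *\<^sub>R ?a) \<partial>lborel)"
      using nn_integral_real_affine[of "\<lambda>y. g (?Y + y *\<^sub>R ?a)" 1 "?Y $ n"] by simp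
    also have "\<dots> = (\<integral>\<^sup>+y. g (?h (?Y + y *\<^sub>R ?a)) \<partial>lborel)"
    proof (rule nn_integral_cong)
      fix y
      have "(y *\<^sub>R ?a) $ n = 0" using mn by (simp add: axis_def)
      then show "g (?Y + (?Y $ n + 1 * y) *\<^sub>R ?a) = g (?h (?Y + y *\<^sub>R ?a))"
        by (simp add: algebra_simps del: vector_scaleR_component)
    qed
    finally show "(\<integral>\<^sup>+y. g (?h (?Y + y *\<^sub>R ?a)) \<partial>lborel) = (\<integral>\<^sup>+y. g (?Y + y *\<^sub>R ?a) \<partial>lborel)" by simp
  qed
  also have "\<dots> = (\<integral>\<^sup>+x. g x \<partial>lborel)" by (rule I[symmetric]) measurable
  finally show ?thesis unfolding h .
qed

lemma measurable_linear:
  fixes f :: "'a::euclidean_space \<Rightarrow> 'b::euclidean_space"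
  assumes "linear f" shows "f \<in> borel \<rightarrow>\<^sub>M borel"
  using assms by (intro borel_measurable_continuous_onI linear_continuous_on linear_conv_bounded_linear[THEN iffD1])

text \<open>
  Every linear map is a product of diagonal maps, coordinate swaps and shears, so the general
  change of variables follows from these three cases.
\<close>

proposition nn_integral_lborel_linear:
  fixes f :: "real ^ 'd::finite \<Rightarrow> real ^ 'd" and g :: "real ^ 'd \<Rightarrow> ennreal"
  assumes "linear f" "inj f" "g \<in> borel_measurable borel"
  shows "(\<integral>\<^sup>+x. g (f x) \<partial>lborel) = ennreal (1 / \<bar>det (matrix f)\<bar>) * (\<integral>\<^sup>+x. g x \<partial>lborel)"
proof -
  define P :: "(real ^ 'd \<Rightarrow> real ^ 'd) \<Rightarrow> bool" where "P = (\<lambda>f. inj f \<longrightarrow> (\<forall>g \<in> borel_measurable borel.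
     (\<integral>\<^sup>+x. g (f x) \<partial>lborel) = ennreal (1 / \<bar>det (matrix f)\<bar>) * (\<integral>\<^sup>+x. g x \<partial>lborel)))"
  have PI: "P f" if "\<And>g. inj f \<Longrightarrow> g \<in> borel_measurable borel \<Longrightarrow>
      (\<integral>\<^sup>+x. g (f x) \<partial>lborel) = ennreal (1 / \<bar>det (matrix f)\<bar>) * (\<integral>\<^sup>+x. g x \<partial>lborel)" for f
    using that unfolding P_def by blast
  have PD: "(\<integral>\<^sup>+x. g (f x) \<partial>lborel) = ennreal (1 / \<bar>det (matrix f)\<bar>) * (\<integral>\<^sup>+x. g x \<partial>lborel)"
    if "P f" "inj f" "g \<in> borel_measurable borel" for f g
    using that unfolding P_def by blast
  have "P f"
  proof (rule induct_linear_elementary[OF \<open>linear f\<close>, where P = P]; rule PI)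
    fix f1 f2 :: "real^'d \<Rightarrow> real^'d" and g :: "real ^ 'd \<Rightarrow> ennreal"
    assume lin: "linear f1" "linear f2"
      and f1: "P f1"
      and f2: "P f2"
      and inj: "inj (f1 \<circ> f2)" and g [measurable]: "g \<in> borel_measurable borel"
    have i2: "inj f2" by (rule inj_on_imageI2[OF inj])
    then have "surj f2" using lin(2) by (simp add: linear_injective_imp_surjective)
    then have i1: "inj f1" using comp_inj_on_iff[OF i2, of f1] inj by simp
    have [measurable]: "f1 \<in> borel \<rightarrow>\<^sub>M borel" "f2 \<in> borel \<rightarrow>\<^sub>M borel"
      using lin by (auto intro: measurable_linear)
    have "(\<integral>\<^sup>+x. g ((f1 \<circ> f2) x) \<partial>lborel) = ennreal (1 / \<bar>det (matrix f2)\<bar>) * (\<integral>\<^sup>+x. g (f1 x) \<partial>lborel)"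
      using PD[OF f2 i2, of "\<lambda>x. g (f1 x)"] by simp
    also have "\<dots> = ennreal (1 / \<bar>det (matrix f2)\<bar>) * (ennreal (1 / \<bar>det (matrix f1)\<bar>) * (\<integral>\<^sup>+x. g x \<partial>lborel))"
      using PD[OF f1 i1 g] by simp
    also have "\<dots> = ennreal (1 / \<bar>det (matrix (f1 \<circ> f2))\<bar>) * (\<integral>\<^sup>+x. g x \<partial>lborel)"
      unfolding matrix_compose[OF lin(2) lin(1)] det_mul abs_mult mult.assoc[symmetric]
      by (subst ennreal_mult[symmetric]) (auto simp: mult.commute)
    finally show "(\<integral>\<^sup>+x. g ((f1 \<circ> f2) x) \<partial>lborel) = ennreal (1 / \<bar>det (matrix (f1 \<circ> f2))\<bar>) * (\<integral>\<^sup>+x. g x \<partial>lborel)" .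
  next
    fix f1 :: "real^'d \<Rightarrow> real^'d" and i and g :: "real ^ 'd \<Rightarrow> ennreal"
    assume "linear f1" and 0: "\<And>x. f1 x $ i = 0" and "inj f1"
    then have False
      by (metis (full_types) linear_injective_imp_surjective one_neq_zero surjE vec_component)
    then show "(\<integral>\<^sup>+x. g (f1 x) \<partial>lborel) = ennreal (1 / \<bar>det (matrix f1)\<bar>) * (\<integral>\<^sup>+x. g x \<partial>lborel)" ..
  next
    fix c :: "'d \<Rightarrow> real" and g :: "real ^ 'd \<Rightarrow> ennreal"
    let ?f = "\<lambda>x::real^'d. \<chi> i. c i * x $ i"
    assume inj: "inj ?f" and g: "g \<in> borel_measurable borel"
    have c: "c i \<noteq> 0" for i
    proof
      assume "c i = 0"
      then have "?f (axis i 1) = ?f 0" by (simp add: vec_eq_iff axis_def)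
      from injD[OF inj this] have "axis i (1::real) $ i = 0" by simp
      then show False by simp
    qed
    have "det (matrix ?f) = (\<Prod>i\<in>UNIV. c i)"
      by (simp add: axis_def matrix_def det_diagonal)
    then show "(\<integral>\<^sup>+x. g (?f x) \<partial>lborel) = ennreal (1 / \<bar>det (matrix ?f)\<bar>) * (\<integral>\<^sup>+x. g x \<partial>lborel)"
      using nn_integral_lborel_diagonal[OF g c] by simp
  next
    fix m n :: 'd and g :: "real ^ 'd \<Rightarrow> ennreal"
    let ?h = "\<lambda>v::(real, 'd) vec. \<chi> i. v $ Transposition.transpose m n i"
    assume g: "g \<in> borel_measurable borel"
    have "(\<chi> i j. if Transposition.transpose m n i = j then 1 else 0) = (\<chi> i j. if j = Transposition.transpose m n i then 1 else (0::real))"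
      by (auto intro!: Cart_lambda_cong)
    then have "matrix ?h = transpose(\<chi> i j. mat 1 $ i $ Transposition.transpose m n j)"
      by (auto simp: matrix_eq transpose_def axis_def mat_def matrix_def)
    then have "\<bar>det (matrix ?h)\<bar> = 1"
      by (simp add: det_permute_columns permutes_swap_id sign_swap_id abs_mult)
    then show "(\<integral>\<^sup>+x. g (?h x) \<partial>lborel) = ennreal (1 / \<bar>det (matrix ?h)\<bar>) * (\<integral>\<^sup>+x. g x \<partial>lborel)"
      using nn_integral_lborel_swap[OF g] by simp
  next
    fix m n :: 'd and g :: "real ^ 'd \<Rightarrow> ennreal"
    let ?h = "\<lambda>v::(real, 'd) vec. \<chi> i. if i = m then v $ m + v $ n else v $ i"
    assume mn: "m \<noteq> n" and g: "g \<in> borel_measurable borel"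
    have "matrix ?h = (\<chi> k. if k = m then row m (mat 1) + 1 *s row n (mat 1) else row k (mat 1))"
      by (simp add: vec_eq_iff matrix_def row_def mat_def) (simp add: axis_def)
    then have "det (matrix ?h) = 1"
      using det_row_operation[OF mn, of "mat 1 :: real^'d^'d" 1] by simp
    then show "(\<integral>\<^sup>+x. g (?h x) \<partial>lborel) = ennreal (1 / \<bar>det (matrix ?h)\<bar>) * (\<integral>\<^sup>+x. g x \<partial>lborel)"
      using nn_integral_lborel_shear[OF g mn] by simp
  qed
  then show ?thesis using PD assms by blast
qed

lemma det_rank_one_axis:
  fixes w :: "real ^ 'd::finite"
  shows "det (matrix (\<lambda>z. z + (w \<bullet> z) *\<^sub>R axis k c)) = 1 + c * w $ k"
proof -
  let ?x = "axis k 1 + c *\<^sub>R w"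
  have r: "sum (\<lambda>i. ?x $ i *s row i (mat 1)) UNIV = ?x"
    unfolding vec_eq_iff
  proof
    fix j
    have "sum (\<lambda>i. ?x $ i *s row i (mat 1)) UNIV $ j = (\<Sum>i\<in>UNIV. if i = j then ?x $ i else 0)"
      by (simp add: row_def mat_def if_distrib cong: if_cong)
    then show "sum (\<lambda>i. ?x $ i *s row i (mat 1)) UNIV $ j = ?x $ j" by simp
  qed
  have "matrix (\<lambda>z. z + (w \<bullet> z) *\<^sub>R axis k c) =
      (\<chi> i. if i = k then ?x else row i (mat 1))"
    by (simp add: vec_eq_iff matrix_def row_def mat_def inner_axis) (simp add: axis_def)
  then have "matrix (\<lambda>z. z + (w \<bullet> z) *\<^sub>R axis k c) =
      (\<chi> i. if i = k then sum (\<lambda>i. ?x $ i *s row i (mat 1)) UNIV else row i (mat 1))"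
    unfolding r .
  then have "det (matrix (\<lambda>z. z + (w \<bullet> z) *\<^sub>R axis k c)) = ?x $ k * det (mat 1 :: real^'d^'d)"
    using cramer_lemma_transpose[of k ?x "mat 1"] by simp
  then show ?thesis by (simp add: axis_def)
qed

text \<open>
  After an orthogonal change of coordinates \<open>q\<close> points along an axis, and the matrix differs from
  the identity in one row only.
\<close>

lemma det_rank_one:
  fixes w q :: "real ^ 'd::finite"
  shows "det (matrix (\<lambda>z. z + (w \<bullet> z) *\<^sub>R q)) = 1 + w \<bullet> q"
proof -
  fix k :: 'd
  let ?A = "\<lambda>z. z + (w \<bullet> z) *\<^sub>R q"
  obtain T where T: "orthogonal_transformation T" and Tq: "T (axis k (norm q)) = q"
    by (rule orthogonal_transformation_exists[of "axis k (norm q)" q])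
      (auto simp: norm_eq_sqrt_inner inner_axis_axis)
  have linT: "linear T" using T by (rule orthogonal_transformation_linear)
  obtain w' where w': "w = T w'"
    using orthogonal_transformation_surj[OF T] by (metis surjE)
  let ?A' = "\<lambda>z. z + (w' \<bullet> z) *\<^sub>R axis k (norm q)"
  have lin: "linear ?A'" "linear ?A"
    by (auto intro!: linearI simp: algebra_simps inner_add_right scaleR_add_left)
  have i: "T x \<bullet> T y = x \<bullet> y" for x y using T by (simp add: orthogonal_transformation_def)
  have "?A \<circ> T = T \<circ> ?A'"
    by (simp add: fun_eq_iff w' i linear_add[OF linT] linear_scale[OF linT] Tq)
  then have "matrix ?A ** matrix T = matrix T ** matrix ?A'"
    using matrix_compose[OF linT lin(2)] matrix_compose[OF lin(1) linT] by simp
  then have "det (matrix ?A) * det (matrix T) = det (matrix T) * det (matrix ?A')"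
    by (simp only: det_mul[symmetric])
  moreover have "det (matrix T) \<noteq> 0" using orthogonal_transformation_det[OF T] by auto
  ultimately have "det (matrix ?A) = det (matrix ?A')" by simp
  also have "\<dots> = 1 + norm q * w' $ k" by (rule det_rank_one_axis)
  also have "norm q * w' $ k = w' \<bullet> axis k (norm q)" by (simp add: inner_axis mult.commute)
  also have "\<dots> = w \<bullet> q" using i[of w' "axis k (norm q)"] by (simp add: w' Tq)
  finally show ?thesis .
qed

section \<open>The standard Gaussian vector\<close>

text \<open>The density of the standard Gaussian law with respect to Lebesgue measure.\<close>

abbreviation (input) "gdens z \<equiv> \<Prod>j\<in>UNIV. std_normal_density (z $ j)"

lemma sets_std_gaussian [measurable_cong, simp]: "sets std_gaussian = sets borel"
  by (simp add: std_gaussian_def)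

lemma space_std_gaussian [simp]: "space std_gaussian = UNIV"
  by (simp add: std_gaussian_def)

lemma std_gaussian_density_eq:
  fixes z :: "real ^ 'd::finite"
  shows "gdens z = (1 / sqrt (2 * pi)) ^ CARD('d) * exp (- (norm z)\<^sup>2 / 2)"
proof -
  have "(norm z)\<^sup>2 = (\<Sum>j\<in>UNIV. (z $ j)\<^sup>2)"
    by (simp only: power2_norm_eq_inner inner_vec_def) (simp add: power2_eq_square)
  then have "- (norm z)\<^sup>2 / 2 = (\<Sum>j\<in>UNIV. - (z $ j)\<^sup>2 / 2)"
    by (simp add: sum_divide_distrib sum_negf)
  then show ?thesis
    unfolding std_normal_density_def prod.distrib prod_constant by (simp only: exp_sum[OF finite])
qed

lemma measurable_gdens [measurable]: "(\<lambda>z::real^'d::finite. gdens z) \<in> borel_measurable borel"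
  unfolding std_gaussian_density_eq by measurable

lemma nn_integral_std_gaussian:
  fixes f :: "real ^ 'd::finite \<Rightarrow> ennreal"
  assumes "f \<in> borel_measurable borel"
  shows "(\<integral>\<^sup>+z. f z \<partial>std_gaussian) = (\<integral>\<^sup>+z. ennreal (gdens z) * f z \<partial>lborel)"
  using assms unfolding std_gaussian_def by (subst nn_integral_density) auto

lemma nn_integral_std_gaussian_prod:
  fixes f :: "'d::finite \<Rightarrow> real \<Rightarrow> ennreal"
  assumes [measurable]: "\<And>j. f j \<in> borel_measurable borel"
  shows "(\<integral>\<^sup>+z. (\<Prod>j\<in>UNIV. f j (z $ j)) \<partial>std_gaussian) = (\<Prod>j\<in>UNIV. \<integral>\<^sup>+s. f j s \<partial>std_normal_distribution)"
proof -
  have pr: "(\<Prod>b\<in>(Basis::(real^'d) set). F (axis_index b) b) = (\<Prod>i\<in>UNIV. F i (axis i 1))" for F :: "'d \<Rightarrow> real^'d \<Rightarrow> ennreal"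
    by (simp add: Basis_vec_def UNION_singleton_eq_range prod.reindex inj_on_def axis_eq_axis axis_index_axis)
  let ?g = "\<lambda>j s. ennreal (std_normal_density s) * f j s"
  have "(\<integral>\<^sup>+z. (\<Prod>j\<in>UNIV. f j (z $ j)) \<partial>std_gaussian)
      = (\<integral>\<^sup>+z. (\<Prod>j\<in>UNIV. ?g j (z $ j)) \<partial>(lborel :: (real^'d) measure))"
  proof (subst nn_integral_std_gaussian)
    show "(\<lambda>z::real^'d. \<Prod>j\<in>UNIV. f j (z $ j)) \<in> borel_measurable borel"
      unfolding cart_eq_inner_axis by measurable
    show "(\<integral>\<^sup>+z. ennreal (gdens z) * (\<Prod>j\<in>UNIV. f j (z $ j)) \<partial>lborel) = (\<integral>\<^sup>+z. (\<Prod>j\<in>UNIV. ?g j (z $ j)) \<partial>(lborel :: (real^'d) measure))"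
      by (simp add: prod.distrib prod_ennreal)
  qed
  also have "\<dots> = (\<integral>\<^sup>+z. (\<Prod>b\<in>Basis. ?g (axis_index b) (z \<bullet> b)) \<partial>(lborel :: (real^'d) measure))"
    unfolding cart_eq_inner_axis by (rule nn_integral_cong) (rule pr[symmetric])
  also have "\<dots> = (\<Prod>b\<in>(Basis::(real^'d) set). \<integral>\<^sup>+s. ?g (axis_index b) s \<partial>lborel)"
    by (rule nn_integral_lborel_prod) auto
  also have "\<dots> = (\<Prod>j\<in>UNIV. \<integral>\<^sup>+s. ?g j s \<partial>lborel)"
    using pr[of "\<lambda>j b. \<integral>\<^sup>+s. ?g j s \<partial>lborel"] by simp
  also have "\<dots> = (\<Prod>j\<in>UNIV. \<integral>\<^sup>+s. f j s \<partial>std_normal_distribution)"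
    by (intro prod.cong refl) (simp add: nn_integral_density)
  finally show ?thesis .
qed

lemma prob_space_std_normal: "prob_space std_normal_distribution"
  by (rule prob_space_normal_density) simp

lemma prob_space_std_gaussian: "prob_space (std_gaussian :: (real ^ 'd::finite) measure)"
proof
  interpret N: prob_space std_normal_distribution by (rule prob_space_std_normal)
  have "(\<integral>\<^sup>+z. (\<Prod>j\<in>UNIV. (\<lambda>_ _. 1) (j::'d) (z $ j)) \<partial>std_gaussian) = (\<Prod>j\<in>UNIV. \<integral>\<^sup>+s. (\<lambda>_ _. 1) (j::'d) s \<partial>std_normal_distribution)"
    by (rule nn_integral_std_gaussian_prod) simp
  then show "emeasure (std_gaussian :: (real^'d) measure) (space std_gaussian) = 1"
    using N.emeasure_space_1 by (simp add: nn_integral_const)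
qed

text \<open>
  The image of the standard Gaussian under an invertible linear map, as a density with respect to
  the standard Gaussian itself. All changes of measure below are instances.
\<close>

lemma distr_std_gaussian_linear:
  fixes A B :: "real ^ 'd::finite \<Rightarrow> real ^ 'd"
  assumes "linear A" "linear B" and AB: "\<And>z. A (B z) = z" and BA: "\<And>z. B (A z) = z"
  shows "distr std_gaussian borel A =
    density std_gaussian (\<lambda>z. ennreal (1 / \<bar>det (matrix A)\<bar> * exp (((norm z)\<^sup>2 - (norm (B z))\<^sup>2) / 2)))"
proof (rule measure_eqI)
  let ?E = "\<lambda>z. exp (((norm z)\<^sup>2 - (norm (B z))\<^sup>2) / 2)"
  let ?c = "1 / \<bar>det (matrix A)\<bar>"
  have [measurable]: "A \<in> borel \<rightarrow>\<^sub>M borel" "B \<in> borel \<rightarrow>\<^sub>M borel"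
    using assms by (auto intro: measurable_linear)
  have inj: "inj A" using BA by (metis injI)
  have dens: "gdens (B z) = gdens z * ?E z" for z
    unfolding std_gaussian_density_eq
    by (simp add: mult.assoc exp_add[symmetric] diff_divide_distrib)
  have dpos: "gdens z \<ge> 0" for z :: "real^'d" by (intro prod_nonneg) simp
  fix X assume "X \<in> sets (distr std_gaussian borel A)"
  then have [measurable]: "X \<in> sets borel" by simp
  have "emeasure (distr std_gaussian borel A) X = (\<integral>\<^sup>+z. indicator X z \<partial>distr std_gaussian borel A)"
    by simp
  also have "\<dots> = (\<integral>\<^sup>+z. indicator X (A z) \<partial>std_gaussian)"
    by (rule nn_integral_distr) auto
  also have "\<dots> = (\<integral>\<^sup>+z. ennreal (gdens z) * indicator X (A z) \<partial>lborel)"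
    by (rule nn_integral_std_gaussian) measurable
  also have "\<dots> = (\<integral>\<^sup>+z. (\<lambda>z. ennreal (gdens (B z)) * indicator X z) (A z) \<partial>lborel)"
    by (simp add: BA)
  also have "\<dots> = ennreal ?c * (\<integral>\<^sup>+z. ennreal (gdens (B z)) * indicator X z \<partial>lborel)"
    by (rule nn_integral_lborel_linear[OF \<open>linear A\<close> inj]) measurable
  also have "\<dots> = (\<integral>\<^sup>+z. ennreal ?c * (ennreal (gdens (B z)) * indicator X z) \<partial>lborel)"
    by (rule nn_integral_cmult[symmetric]) measurable
  also have "\<dots> = (\<integral>\<^sup>+z. ennreal (gdens z) * (ennreal (?c * ?E z) * indicator X z) \<partial>lborel)"
  proof (rule nn_integral_cong)
    fix z :: "real^'d"
    have "ennreal ?c * ennreal (gdens (B z)) = ennreal (gdens z) * ennreal (?c * ?E z)"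
      by (subst (1 2) ennreal_mult[symmetric]) (auto simp: dens dpos)
    then show "ennreal ?c * (ennreal (gdens (B z)) * indicator X z) =
        ennreal (gdens z) * (ennreal (?c * ?E z) * indicator X z)"
      by (simp only: mult.assoc[symmetric])
  qed
  also have "\<dots> = (\<integral>\<^sup>+z. ennreal (?c * ?E z) * indicator X z \<partial>std_gaussian)"
    by (rule nn_integral_std_gaussian[symmetric]) measurable
  also have "\<dots> = emeasure (density std_gaussian (\<lambda>z. ennreal (?c * ?E z))) X"
    by (rule emeasure_density[symmetric]) auto
  finally show "emeasure (distr std_gaussian borel A) X
    = emeasure (density std_gaussian (\<lambda>z. ennreal (?c * ?E z))) X" .
qed simp

lemma distr_std_gaussian_orthogonal:
  fixes T :: "real ^ 'd::finite \<Rightarrow> real ^ 'd"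
  assumes T: "orthogonal_transformation T"
  shows "distr std_gaussian borel T = std_gaussian"
proof -
  have lin: "linear T" using T by (rule orthogonal_transformation_linear)
  have b: "bij T" using T by (rule orthogonal_transformation_bij)
  have T': "orthogonal_transformation (inv T)" using T by (rule orthogonal_transformation_inv)
  have "distr std_gaussian borel T =
    density std_gaussian (\<lambda>z. ennreal (1 / \<bar>det (matrix T)\<bar> * exp (((norm z)\<^sup>2 - (norm (inv T z))\<^sup>2) / 2)))"
    using b by (intro distr_std_gaussian_linear lin orthogonal_transformation_linear[OF T'])
      (auto simp: bij_is_surj surj_f_inv_f bij_is_inj)
  also have "\<dots> = density std_gaussian (\<lambda>_. 1)"
    using T orthogonal_transformation_norm[OF T'] by simp
  finally show ?thesis by (simp add: density_1)
qed

text \<open>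
  The reflection in the hyperplane orthogonal to \<open>a - b\<close>.
\<close>

lemma orthogonal_swap_exists:
  fixes a b :: "'a::euclidean_space"
  assumes "norm a = norm b"
  obtains T where "orthogonal_transformation T" "T a = b" "T b = a"
    "\<And>c. c \<bullet> a = c \<bullet> b \<Longrightarrow> T c = c"
proof (cases "a = b")
  case True
  then show ?thesis by (intro that[of "\<lambda>x. x"]) auto
next
  case False
  define n where "n = (a - b) /\<^sub>R norm (a - b)"
  define T where "T z = z - (2 * (n \<bullet> z)) *\<^sub>R n" for z
  have nn: "n \<bullet> n = 1" using False
    by (simp add: n_def norm_eq_sqrt_inner) (simp add: power2_norm_eq_inner[symmetric] power2_eq_square divide_simps)
  have ab: "a \<bullet> a = b \<bullet> b" using assms by (simp add: norm_eq)
  have orth: "orthogonal_transformation T"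
    unfolding orthogonal_transformation_def
  proof
    show "linear T"
      by (rule linearI) (simp_all add: T_def algebra_simps)
    show "\<forall>v w. T v \<bullet> T w = v \<bullet> w"
      by (simp add: T_def inner_diff_left inner_diff_right nn inner_commute)
  qed
  have n2: "norm (a - b) ^ 2 = 2 * (a \<bullet> (a - b))"
    unfolding power2_norm_eq_inner using ab by (simp add: inner_diff_left inner_diff_right inner_commute)
  have "(2 * (n \<bullet> a)) *\<^sub>R n = (2 * (a \<bullet> (a - b)) / norm (a - b) ^ 2) *\<^sub>R (a - b)"
    by (simp add: n_def inner_commute power2_eq_square divide_simps)
  also have "\<dots> = a - b" unfolding n2[symmetric] using False by simp
  finally have "T a = b" by (simp add: T_def)
  moreover have "T (T z) = z" for z
    by (simp add: T_def inner_diff_right nn)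
  ultimately have "T b = a" by metis
  have "T c = c" if "c \<bullet> a = c \<bullet> b" for c
    using that by (simp add: T_def n_def inner_diff_left inner_diff_right inner_commute)
  with orth \<open>T a = b\<close> \<open>T b = a\<close> show ?thesis by (rule that)
qed

lemma orthogonal_pair_exists:
  fixes a b c d :: "real ^ 'd::finite"
  assumes "norm a = 1" "norm b = 1" "a \<bullet> b = 0" "norm c = 1" "norm d = 1" "c \<bullet> d = 0"
  obtains T where "orthogonal_transformation T" "T a = c" "T b = d"
proof -
  obtain T1 where T1: "orthogonal_transformation T1" "T1 a = c"
    by (rule orthogonal_swap_exists[of a c]) (use assms in auto)
  have i: "T1 b \<bullet> c = 0"
    using T1 assms by (metis inner_commute orthogonal_transformation_def)
  have nb: "norm (T1 b) = norm d"
    using T1 assms by (simp add: orthogonal_transformation_norm)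
  obtain T2 where T2: "orthogonal_transformation T2" "T2 (T1 b) = d" "\<And>e. e \<bullet> T1 b = e \<bullet> d \<Longrightarrow> T2 e = e"
    by (rule orthogonal_swap_exists[OF nb]) auto
  have "T2 c = c" by (rule T2(3)) (use i assms in \<open>simp add: inner_commute\<close>)
  then show ?thesis
    using T1 T2 by (intro that[of "T2 \<circ> T1"] orthogonal_transformation_compose) auto
qed

lemma nn_integral_std_gaussian_orthogonal:
  fixes T :: "real ^ 'd::finite \<Rightarrow> real ^ 'd" and f :: "real ^ 'd \<Rightarrow> ennreal"
  assumes T: "orthogonal_transformation T" and [measurable]: "f \<in> borel_measurable borel"
  shows "(\<integral>\<^sup>+z. f (T z) \<partial>std_gaussian) = (\<integral>\<^sup>+z. f z \<partial>std_gaussian)"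
proof -
  have [measurable]: "T \<in> borel \<rightarrow>\<^sub>M borel"
    using T by (auto intro: measurable_linear orthogonal_transformation_linear)
  have "(\<integral>\<^sup>+z. f z \<partial>distr std_gaussian borel T) = (\<integral>\<^sup>+z. f (T z) \<partial>std_gaussian)"
    by (rule nn_integral_distr) auto
  then show ?thesis unfolding distr_std_gaussian_orthogonal[OF T] by simp
qed

text \<open>
  Along orthonormal directions a standard Gaussian vector has independent standard normal
  coordinates.
\<close>

lemma nn_integral_std_gaussian_inner2:
  fixes w n :: "real ^ 'd::finite" and f g :: "real \<Rightarrow> ennreal"
  assumes "norm w = 1" "norm n = 1" "w \<bullet> n = 0"
    and [measurable]: "f \<in> borel_measurable borel" "g \<in> borel_measurable borel"
  shows "(\<integral>\<^sup>+z. f (w \<bullet> z) * g (n \<bullet> z) \<partial>std_gaussian)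
    = (\<integral>\<^sup>+s. f s \<partial>std_normal_distribution) * (\<integral>\<^sup>+s. g s \<partial>std_normal_distribution)"
proof -
  interpret N: prob_space std_normal_distribution by (rule prob_space_std_normal)
  obtain i j :: 'd where ij: "i \<noteq> j"
  proof (rule ccontr)
    assume "\<not> thesis"
    then have *: "i = j" for i j :: 'd using that by blast
    fix k :: 'd
    have U: "UNIV = {k}" using * by auto
    have "v \<bullet> v' = v $ k * v' $ k" for v v' :: "real^'d" by (simp add: inner_vec_def U)
    then show False using assms(1-3) by (metis inner_eq_zero_iff mult_eq_0_iff norm_zero zero_neq_one)
  qed
  have ax: "axis i (1::real) \<bullet> axis j 1 = 0" using ij by (simp add: inner_axis_axis)
  obtain T where T: "orthogonal_transformation T" "T (axis i (1::real)) = w" "T (axis j 1) = n"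
    by (rule orthogonal_pair_exists[OF _ _ ax assms(1-3)]) simp_all
  have in_T: "T x \<bullet> T y = x \<bullet> y" for x y using T by (simp add: orthogonal_transformation_def)
  have wz: "w \<bullet> T z = z $ i" and nz: "n \<bullet> T z = z $ j" for z
    using in_T[of "axis i 1" z] in_T[of "axis j 1" z] T by (simp_all add: inner_axis')
  let ?f = "\<lambda>k. if k = i then f else if k = j then g else (\<lambda>_. 1)"
  have pr: "(\<Prod>k\<in>UNIV. if k = i then a else if k = j then b else 1) = a * b" for a b :: ennreal
  proof -
    have "(\<Prod>k\<in>UNIV. if k = i then a else if k = j then b else 1)
        = (\<Prod>k\<in>UNIV. (if k = i then a else 1) * (if k = j then b else 1))"
      using ij by (intro prod.cong) auto
    then show ?thesis by (simp add: prod.distrib)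
  qed
  have "(\<integral>\<^sup>+z. f (w \<bullet> z) * g (n \<bullet> z) \<partial>std_gaussian) = (\<integral>\<^sup>+z. f (w \<bullet> T z) * g (n \<bullet> T z) \<partial>std_gaussian)"
    by (rule nn_integral_std_gaussian_orthogonal[OF T(1), symmetric]) measurable
  also have "\<dots> = (\<integral>\<^sup>+z. (\<Prod>k\<in>UNIV. ?f k (z $ k)) \<partial>std_gaussian)"
  proof (rule nn_integral_cong)
    fix z :: "real^'d"
    have "(\<Prod>k\<in>UNIV. ?f k (z $ k)) = (\<Prod>k\<in>UNIV. if k = i then f (z $ i) else if k = j then g (z $ j) else 1)"
      by (intro prod.cong) auto
    then show "f (w \<bullet> T z) * g (n \<bullet> T z) = (\<Prod>k\<in>UNIV. ?f k (z $ k))"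
      unfolding wz nz pr by simp
  qed
  also have "\<dots> = (\<Prod>k\<in>UNIV. \<integral>\<^sup>+s. ?f k s \<partial>std_normal_distribution)"
    by (rule nn_integral_std_gaussian_prod) auto
  also have "\<dots> = (\<Prod>k\<in>UNIV. if k = i then (\<integral>\<^sup>+s. f s \<partial>std_normal_distribution)
      else if k = j then (\<integral>\<^sup>+s. g s \<partial>std_normal_distribution) else 1)"
    using N.emeasure_space_1 by (intro prod.cong) (auto simp: nn_integral_const)
  finally show ?thesis unfolding pr .
qed

lemma distr_std_gaussian_inner:
  fixes x :: "real ^ 'd::finite"
  assumes "norm x = 1"
  shows "distr std_gaussian borel (\<lambda>z. x \<bullet> z) = std_normal_distribution"
proof (rule measure_eqI)
  interpret N: prob_space std_normal_distribution by (rule prob_space_std_normal)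
  fix X assume "X \<in> sets (distr std_gaussian borel (\<lambda>z. x \<bullet> z))"
  then have [measurable]: "X \<in> sets borel" by simp
  fix i :: 'd
  have nx: "norm (axis i (1::real)) = norm x" using assms by simp
  obtain T where T: "orthogonal_transformation T" "T (axis i (1::real)) = x"
    by (rule orthogonal_swap_exists[OF nx]) blast
  have xz: "x \<bullet> T z = z $ i" for z
    using T by (metis orthogonal_transformation_def inner_axis' mult_1 real_inner_1_left)
  let ?f = "\<lambda>k. if k = i then indicator X else (\<lambda>_. 1::ennreal)"
  have "emeasure (distr std_gaussian borel (\<lambda>z. x \<bullet> z)) X = (\<integral>\<^sup>+s. indicator X s \<partial>distr std_gaussian borel (\<lambda>z. x \<bullet> z))"
    by simp
  also have "\<dots> = (\<integral>\<^sup>+z. indicator X (x \<bullet> z) \<partial>std_gaussian)"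
    by (rule nn_integral_distr) auto
  also have "\<dots> = (\<integral>\<^sup>+z. indicator X (x \<bullet> T z) \<partial>std_gaussian)"
    by (rule nn_integral_std_gaussian_orthogonal[OF T(1), symmetric]) measurable
  also have "\<dots> = (\<integral>\<^sup>+z. (\<Prod>k\<in>UNIV. ?f k (z $ k)) \<partial>std_gaussian)"
  proof (rule nn_integral_cong)
    fix z :: "real^'d"
    have "(\<Prod>k\<in>UNIV. ?f k (z $ k)) = (\<Prod>k\<in>UNIV. if k = i then indicator X (z $ i) else 1)"
      by (intro prod.cong) auto
    then show "indicator X (x \<bullet> T z) = (\<Prod>k\<in>UNIV. ?f k (z $ k))" by (simp add: xz)
  qed
  also have "\<dots> = (\<Prod>k\<in>UNIV. \<integral>\<^sup>+s. ?f k s \<partial>std_normal_distribution)"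
    by (rule nn_integral_std_gaussian_prod) auto
  also have "\<dots> = (\<Prod>k\<in>UNIV. if k = i then emeasure std_normal_distribution X else 1)"
    using N.emeasure_space_1 by (intro prod.cong) (auto simp: nn_integral_const)
  finally show "emeasure (distr std_gaussian borel (\<lambda>z. x \<bullet> z)) X = emeasure std_normal_distribution X"
    by simp
qed simp

lemma nn_integral_std_gaussian_inner:
  fixes x :: "real ^ 'd::finite" and f :: "real \<Rightarrow> ennreal"
  assumes "norm x = 1" and [measurable]: "f \<in> borel_measurable borel"
  shows "(\<integral>\<^sup>+z. f (x \<bullet> z) \<partial>std_gaussian) = (\<integral>\<^sup>+s. f s \<partial>std_normal_distribution)"
  unfolding distr_std_gaussian_inner[OF assms(1), symmetric]
  by (rule nn_integral_distr[symmetric]) auto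

section \<open>Independent Gaussian rows\<close>

text \<open>
  The map \<open>A\<close> applied to each of the \<open>m\<close> rows. Outside the index set the result is undefined, as
  required of the elements of the product space.
\<close>

definition rowmap :: "nat \<Rightarrow> ('a \<Rightarrow> 'b) \<Rightarrow> (nat \<Rightarrow> 'a) \<Rightarrow> nat \<Rightarrow> 'b" where
  "rowmap m A Z = (\<lambda>i\<in>{1..m}. A (Z i))"

lemma sets_gaussian_rows [measurable_cong]: "sets (gaussian_rows m) = sets (Pi\<^sub>M {1..m} (\<lambda>_. borel))"
  unfolding gaussian_rows_def by (rule sets_PiM_cong) auto

lemma product_sigma_finite_std_gaussian: "product_sigma_finite (\<lambda>_. std_gaussian :: (real ^ 'd::finite) measure)"
  by (simp add: product_sigma_finite_def prob_space_std_gaussian prob_space_imp_sigma_finite)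

lemma prob_space_gaussian_rows: "prob_space (gaussian_rows m :: (nat \<Rightarrow> real ^ 'd::finite) measure)"
  unfolding gaussian_rows_def by (rule prob_space_PiM) (rule prob_space_std_gaussian)

lemma nn_integral_gaussian_rows_prod:
  fixes f :: "nat \<Rightarrow> real ^ 'd::finite \<Rightarrow> ennreal"
  assumes "\<And>k. f k \<in> borel_measurable borel"
  shows "(\<integral>\<^sup>+Z. (\<Prod>k\<in>{1..m}. f k (Z k)) \<partial>gaussian_rows m) = (\<Prod>k\<in>{1..m}. \<integral>\<^sup>+z. f k z \<partial>std_gaussian)"
proof -
  interpret product_sigma_finite "\<lambda>_. std_gaussian :: (real ^ 'd::finite) measure"
    by (rule product_sigma_finite_std_gaussian)
  show ?thesis unfolding gaussian_rows_def
    by (rule product_nn_integral_prod) (use assms in measurable)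
qed

lemma measure_gaussian_rows_all:
  assumes "X \<in> sets (borel :: (real ^ 'd::finite) measure)"
  shows "measure (gaussian_rows m) {Z \<in> space (gaussian_rows m). \<forall>i\<in>{1..m}. Z i \<in> X} = measure std_gaussian X ^ m"
proof -
  interpret product_sigma_finite "\<lambda>_. std_gaussian :: (real ^ 'd::finite) measure"
    by (rule product_sigma_finite_std_gaussian)
  interpret G: prob_space "std_gaussian :: (real ^ 'd::finite) measure" by (rule prob_space_std_gaussian)
  have "{Z \<in> space (gaussian_rows m). \<forall>i\<in>{1..m}. Z i \<in> X} = Pi\<^sub>E {1..m} (\<lambda>_. X)"
    by (auto simp: gaussian_rows_def space_PiM PiE_iff extensional_def)
  then have "emeasure (gaussian_rows m) {Z \<in> space (gaussian_rows m). \<forall>i\<in>{1..m}. Z i \<in> X}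
    = (\<Prod>i\<in>{1..m}. emeasure std_gaussian X)"
    unfolding gaussian_rows_def using assms by (simp add: emeasure_PiM)
  also have "\<dots> = ennreal (measure std_gaussian X ^ m)"
    by (simp add: G.emeasure_eq_measure ennreal_power)
  finally show ?thesis by (simp add: measure_def)
qed

lemma distr_gaussian_rows_row:
  assumes "i \<in> {1..m}"
  shows "distr (gaussian_rows m) borel (\<lambda>Z. Z i) = (std_gaussian :: (real ^ 'd::finite) measure)"
proof -
  have "distr (gaussian_rows m) std_gaussian (\<lambda>Z. Z i) = (std_gaussian :: (real ^ 'd::finite) measure)"
    unfolding gaussian_rows_def using assms by (intro distr_PiM_component prob_space_std_gaussian) auto
  then show ?thesis by (simp cong: distr_cong)
qed

lemma measurable_rowmap [measurable]:
  assumes [measurable]: "A \<in> borel \<rightarrow>\<^sub>M borel"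
  shows "rowmap m A \<in> gaussian_rows m \<rightarrow>\<^sub>M gaussian_rows m"
  unfolding rowmap_def by measurable

lemma distr_gaussian_rows_density:
  fixes A :: "real ^ 'd::finite \<Rightarrow> real ^ 'd" and \<rho> :: "real ^ 'd \<Rightarrow> ennreal"
  assumes [measurable]: "A \<in> borel \<rightarrow>\<^sub>M borel" "\<rho> \<in> borel_measurable borel"
    and A: "distr std_gaussian borel A = density std_gaussian \<rho>"
  shows "distr (gaussian_rows m) (gaussian_rows m) (rowmap m A)
    = density (gaussian_rows m) (\<lambda>Z. \<Prod>i\<in>{1..m}. \<rho> (Z i))"
proof -
  let ?N = "distr std_gaussian borel A"
  interpret G: product_sigma_finite "\<lambda>_. std_gaussian :: (real ^ 'd::finite) measure"
    by (rule product_sigma_finite_std_gaussian)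
  interpret g: prob_space "std_gaussian :: (real ^ 'd::finite) measure" by (rule prob_space_std_gaussian)
  have pN: "prob_space ?N" by (rule g.prob_space_distr) measurable
  interpret product_sigma_finite "\<lambda>_. ?N"
    by (simp add: product_sigma_finite_def pN prob_space_imp_sigma_finite)
  have sN: "sets (Pi\<^sub>M {1..m} (\<lambda>_. ?N)) = sets (gaussian_rows m)"
    unfolding sets_gaussian_rows by (rule sets_PiM_cong) auto
  have "distr (gaussian_rows m) (gaussian_rows m) (rowmap m A) = Pi\<^sub>M {1..m} (\<lambda>_. ?N)"
  proof (rule PiM_eqI)
    fix X assume X: "\<And>i. i \<in> {1..m} \<Longrightarrow> X i \<in> sets ?N"
    then have X': "\<And>i. i \<in> {1..m} \<Longrightarrow> X i \<in> sets borel" by simp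
    have XP: "Pi\<^sub>E {1..m} X \<in> sets (gaussian_rows m)"
      unfolding sets_gaussian_rows using X' by (intro sets_PiM_I_finite) auto
    have "rowmap m A -` Pi\<^sub>E {1..m} X \<inter> space (gaussian_rows m) = Pi\<^sub>E {1..m} (\<lambda>i. A -` X i)"
      by (auto simp: rowmap_def gaussian_rows_def space_PiM PiE_iff extensional_def)
    then have "emeasure (distr (gaussian_rows m) (gaussian_rows m) (rowmap m A)) (Pi\<^sub>E {1..m} X)
        = emeasure (gaussian_rows m) (Pi\<^sub>E {1..m} (\<lambda>i. A -` X i))"
      using XP by (simp add: emeasure_distr)
    also have "\<dots> = (\<Prod>i\<in>{1..m}. emeasure std_gaussian (A -` X i))"
      unfolding gaussian_rows_def using X' by (intro G.emeasure_PiM) (auto intro: measurable_sets_borel[OF assms(1)])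
    also have "\<dots> = (\<Prod>i\<in>{1..m}. emeasure ?N (X i))"
      using X' by (intro prod.cong) (auto simp: emeasure_distr)
    finally show "emeasure (distr (gaussian_rows m) (gaussian_rows m) (rowmap m A)) (Pi\<^sub>E {1..m} X) = (\<Prod>i\<in>{1..m}. emeasure ?N (X i))" .
  qed (use sN in auto)
  also have "Pi\<^sub>M {1..m} (\<lambda>_. ?N) = density (gaussian_rows m) (\<lambda>Z. \<Prod>i\<in>{1..m}. \<rho> (Z i))"
  proof (rule PiM_eqI[symmetric])
    fix X assume X: "\<And>i. i \<in> {1..m} \<Longrightarrow> X i \<in> sets ?N"
    then have X' [measurable]: "\<And>i. i \<in> {1..m} \<Longrightarrow> X i \<in> sets borel" by simp
    have XP: "Pi\<^sub>E {1..m} X \<in> sets (gaussian_rows m)"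
      unfolding sets_gaussian_rows using X' by (intro sets_PiM_I_finite) auto
    have "emeasure (density (gaussian_rows m) (\<lambda>Z. \<Prod>i\<in>{1..m}. \<rho> (Z i))) (Pi\<^sub>E {1..m} X)
       = (\<integral>\<^sup>+Z. (\<Prod>i\<in>{1..m}. \<rho> (Z i)) * indicator (Pi\<^sub>E {1..m} X) Z \<partial>gaussian_rows m)"
      using XP by (intro emeasure_density) auto
    also have "\<dots> = (\<integral>\<^sup>+Z. (\<Prod>i\<in>{1..m}. \<rho> (Z i) * indicator (X i) (Z i)) \<partial>gaussian_rows m)"
    proof (rule nn_integral_cong)
      fix Z assume "Z \<in> space (gaussian_rows m :: (nat \<Rightarrow> real ^ 'd) measure)"
      then have "indicator (Pi\<^sub>E {1..m} X) Z = (\<Prod>i\<in>{1..m}. indicator (X i) (Z i) :: ennreal)"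
        by (auto simp: indicator_def gaussian_rows_def space_PiM PiE_iff intro!: prod_zero)
      then show "(\<Prod>i\<in>{1..m}. \<rho> (Z i)) * indicator (Pi\<^sub>E {1..m} X) Z = (\<Prod>i\<in>{1..m}. \<rho> (Z i) * indicator (X i) (Z i))"
        by (simp add: prod.distrib)
    qed
    also have "\<dots> = (\<integral>\<^sup>+Z. (\<Prod>i\<in>{1..m}. \<rho> (Z i) * indicator (if i \<in> {1..m} then X i else {}) (Z i)) \<partial>gaussian_rows m)"
      by (intro nn_integral_cong prod.cong) auto
    also have "\<dots> = (\<Prod>i\<in>{1..m}. \<integral>\<^sup>+z. \<rho> z * indicator (if i \<in> {1..m} then X i else {}) z \<partial>std_gaussian)"
      by (rule nn_integral_gaussian_rows_prod) (use X' in auto)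
    also have "\<dots> = (\<Prod>i\<in>{1..m}. emeasure ?N (X i))"
      unfolding A using X' by (intro prod.cong refl) (simp add: emeasure_density)
    finally show "emeasure (density (gaussian_rows m) (\<lambda>Z. \<Prod>i\<in>{1..m}. \<rho> (Z i))) (Pi\<^sub>E {1..m} X)
      = (\<Prod>i\<in>{1..m}. emeasure ?N (X i))" .
  qed (use sN in auto)
  finally show ?thesis .
qed

lemma distr_gaussian_rows_orthogonal:
  fixes T :: "real ^ 'd::finite \<Rightarrow> real ^ 'd"
  assumes T: "orthogonal_transformation T"
  shows "distr (gaussian_rows m) (gaussian_rows m) (rowmap m T) = gaussian_rows m"
proof -
  have "distr std_gaussian borel T = density std_gaussian (\<lambda>_. 1)"
    using distr_std_gaussian_orthogonal[OF T] by (simp add: density_1)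
  then show ?thesis
    using T by (subst distr_gaussian_rows_density[where \<rho> = "\<lambda>_. 1"])
      (auto intro: measurable_linear orthogonal_transformation_linear simp: density_1)
qed

lemma max_score_rowmap:
  assumes "\<And>z. x \<bullet> A z = x' \<bullet> z"
  shows "max_score m t x (rowmap m A Z) = max_score m t x' Z"
proof -
  have "(\<lambda>i. x \<bullet> rowmap m A Z i) ` {1..m} = (\<lambda>i. x' \<bullet> Z i) ` {1..m}"
    using assms by (intro image_cong) (auto simp: rowmap_def)
  then show ?thesis by (simp add: max_score_def)
qed

lemma sample_loss_rowmap:
  assumes "\<And>z. u \<bullet> A z = u' \<bullet> z" "\<And>z. xs \<bullet> A z = xs' \<bullet> z"
  shows "sample_loss m t xs h u (rowmap m A Z) = sample_loss m t xs' h u' Z"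
  unfolding sample_loss_def label_def using assms by (simp add: max_score_rowmap)

lemma max_score_measurable [measurable]: "max_score m t x \<in> borel_measurable (gaussian_rows m)"
  unfolding max_score_def by measurable

lemma sample_loss_measurable [measurable]:
  assumes [measurable]: "h \<in> borel_measurable borel"
  shows "sample_loss m t xs h x \<in> borel_measurable (gaussian_rows m)"
  unfolding sample_loss_def[abs_def] label_def sgn_if by measurable

lemma max_score_le_iff:
  assumes "m \<ge> 1"
  shows "max_score m t x Z \<le> v \<longleftrightarrow> (\<forall>i\<in>{1..m}. x \<bullet> Z i \<le> v - t)"
  using assms unfolding max_score_def by (subst le_diff_eq[symmetric], subst Max_le_iff) auto

lemma max_score_cases:
  assumes "m \<ge> 1"
  obtains i where "i \<in> {1..m}" "max_score m t x Z = x \<bullet> Z i + t"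
proof -
  have "(MAX i\<in>{1..m}. x \<bullet> Z i) \<in> (\<lambda>i. x \<bullet> Z i) ` {1..m}"
    using assms by (intro Max_in) auto
  then show ?thesis by (auto simp: max_score_def intro: that)
qed

section \<open>Locally Lipschitz functions with increasing odd part\<close>

lemma difference_quotient_LIMSEQ:
  fixes f :: "real \<Rightarrow> real"
  assumes "(f has_real_derivative D) (at x)"
  shows "(\<lambda>n. (f (x + 1 / real (Suc n)) - f x) / (1 / real (Suc n))) \<longlonglongrightarrow> D"
proof -
  have "filterlim (\<lambda>n. 1 / real (Suc n)) (at 0) sequentially"
    unfolding filterlim_at using LIMSEQ_inverse_real_of_nat by (auto simp: inverse_eq_divide)
  with assms show ?thesis
    unfolding DERIV_def by (rule filterlim_compose)
qed

lemma locally_lipschitz_Icc: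
  assumes "locally_lipschitz h"
  obtains L where "L-lipschitz_on {a..b} h"
proof -
  have "local_lipschitz {0::real} {a..b} (\<lambda>_. h)"
  proof (rule local_lipschitzI)
    fix x assume "x \<in> {a..b}"
    obtain e L where e: "e > 0" "L-lipschitz_on (cball x e) h"
      using assms unfolding locally_lipschitz_def by blast
    then have "L-lipschitz_on (cball x e \<inter> {a..b}) h"
      by (meson Int_lower1 lipschitz_on_subset)
    then show "\<exists>u>0. \<exists>L. \<forall>s\<in>cball t u \<inter> {0::real}. L-lipschitz_on (cball x u \<inter> {a..b}) h" for t
      using e(1) by blast
  qed
  from local_lipschitz_compact_implies_lipschitz[OF this compact_Icc] show ?thesis
    using that by auto
qed

lemma locally_lipschitz_isCont:
  assumes "locally_lipschitz h"
  shows "isCont h x"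
proof -
  obtain e L where e: "e > 0" "L-lipschitz_on (cball x e) h"
    using assms unfolding locally_lipschitz_def by blast
  then have "continuous_on (cball x e) h" by (simp add: lipschitz_on_continuous_on)
  then show ?thesis
    using e(1) by (meson centre_in_ball continuous_on_eq_continuous_at continuous_on_subset open_ball ball_subset_cball)
qed

text \<open>
  A locally Lipschitz function that is differentiable almost everywhere is the integral of its
  derivative: the difference quotients are dominated by the Lipschitz constant, and their integrals
  are difference quotients of an antiderivative of \<open>h\<close>. Since \<^const>\<open>deriv\<close> is arbitrary where \<open>h\<close> is
  not differentiable, a Borel measurable version \<open>D\<close> takes its place.
\<close>

lemma locally_lipschitz_FTC:
  fixes h :: "real \<Rightarrow> real"
  assumes lip: "locally_lipschitz h"
    and diff: "AE s in lborel. h differentiable (at s)"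
  obtains D where "D \<in> borel_measurable borel" "AE s in lborel. D s = deriv h s"
    "\<And>a b. a \<le> b \<Longrightarrow> integrable lborel (\<lambda>s. indicator {a..b} s * D s)"
    "\<And>a b. a \<le> b \<Longrightarrow> (\<integral>s. indicator {a..b} s * D s \<partial>lborel) = h b - h a"
proof -
  let ?e = "\<lambda>n. 1 / real (Suc n)"
  let ?q = "\<lambda>n s. (h (s + ?e n) - h s) / ?e n"
  define D where "D s = lim (\<lambda>n. ?q n s)" for s
  have cont: "continuous_on S h" for S
    using locally_lipschitz_isCont[OF lip] by (simp add: continuous_at_imp_continuous_on)
  have hm [measurable]: "h \<in> borel_measurable borel"
    using cont by (rule borel_measurable_continuous_onI)
  have Dm [measurable]: "D \<in> borel_measurable borel"
    unfolding D_def[abs_def] by measurable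
  have q: "AE s in lborel. (\<lambda>n. ?q n s) \<longlonglongrightarrow> D s \<and> D s = deriv h s"
    using diff
  proof eventually_elim
    case (elim s)
    then have "(\<lambda>n. ?q n s) \<longlonglongrightarrow> deriv h s"
      by (intro difference_quotient_LIMSEQ) (simp add: DERIV_deriv_iff_real_differentiable)
    then show ?case unfolding D_def by (simp add: limI)
  qed
  have main: "integrable lborel (\<lambda>s. indicator {a..b} s * D s) \<and>
      (\<integral>s. indicator {a..b} s * D s \<partial>lborel) = h b - h a" if ab: "a \<le> b" for a b
  proof -
    obtain L where L: "L-lipschitz_on {a..b+1} h" by (rule locally_lipschitz_Icc[OF lip])
    obtain \<Phi> where \<Phi>0: "\<And>x. x \<in> {a-1..b+2} \<Longrightarrow> (\<Phi> has_vector_derivative h x) (at x within {a-1..b+2})"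
      by (rule antiderivative_continuous[OF cont[of "{a-1..b+2}"]]) blast
    have \<Phi>: "(\<Phi> has_real_derivative h x) (at x)" if "x \<in> {a..b+1}" for x
      using \<Phi>0[of x] that at_within_Icc_at[of "a-1" x "b+2"]
      by (simp add: has_real_derivative_iff_has_vector_derivative)
    have bound: "\<bar>?q n s\<bar> \<le> L" if "s \<in> {a..b}" for n s
    proof -
      have "\<bar>h (s + ?e n) - h s\<bar> \<le> L * ?e n"
      proof -
        have "?e n \<le> 1" "0 < ?e n" by auto
        then have "s + ?e n \<in> {a..b+1}" "s \<in> {a..b+1}"
          using that unfolding atLeastAtMost_iff by linarith+
        from lipschitz_onD[OF L this] show ?thesis by (simp add: dist_real_def)
      qed
      moreover have e0: "0 < ?e n" by simp
      ultimately show ?thesis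
        by (subst abs_divide, subst abs_of_pos[OF e0], subst pos_divide_le_eq[OF e0])
    qed
    have int: "(\<integral>s. indicator {a..b} s * ?q n s \<partial>lborel)
       = (\<Phi> (b + ?e n) - \<Phi> b) / ?e n - (\<Phi> (a + ?e n) - \<Phi> a) / ?e n" for n
    proof -
      let ?F = "\<lambda>s. (\<Phi> (s + ?e n) - \<Phi> s) / ?e n"
      have "(\<integral>s. indicator {a..b} s *\<^sub>R ?q n s \<partial>lborel) = ?F b - ?F a"
      proof (rule integral_FTC_atLeastAtMost[OF ab])
        show "continuous_on {a..b} (?q n)"
          by (intro continuous_intros continuous_on_compose2[OF cont[of UNIV]]) auto
        fix s assume s: "a \<le> s" "s \<le> b"
        have 1: "((\<lambda>s. \<Phi> (s + ?e n)) has_real_derivative h (s + ?e n)) (at s)"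
        proof -
          have "?e n \<le> 1" "0 < ?e n" by auto
          then have "s + ?e n \<in> {a..b+1}" using s unfolding atLeastAtMost_iff by linarith
          then show ?thesis using \<Phi> DERIV_shift by blast
        qed
        have "(?F has_real_derivative ?q n s) (at s)"
          using s by (intro DERIV_cdivide DERIV_diff 1 \<Phi>) auto
        then show "(?F has_vector_derivative ?q n s) (at s within {a..b})"
          by (simp add: has_real_derivative_iff_has_vector_derivative has_vector_derivative_at_within)
      qed
      then show ?thesis by simp
    qed
    have w: "integrable lborel (\<lambda>s. L * indicator {a..b} s :: real)" 
      by (intro integrable_mult_right integrable_real_indicator) (use ab in auto)
    have lim: "AE s in lborel. (\<lambda>n. indicator {a..b} s * ?q n s) \<longlonglongrightarrow> indicator {a..b} s * D s"
      using q by eventually_elim (auto intro: tendsto_mult_left)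
    have bd: "AE s in lborel. norm (indicator {a..b} s * ?q n s) \<le> L * indicator {a..b} s" for n
      using bound[of _ n] by (intro AE_I2) (auto simp: indicator_def)
    have conv: "(\<lambda>n. \<integral>s. indicator {a..b} s * ?q n s \<partial>lborel) \<longlonglongrightarrow> (\<integral>s. indicator {a..b} s * D s \<partial>lborel)"
      by (rule integral_dominated_convergence[OF _ _ w lim bd]) measurable
    have "(\<lambda>n. \<integral>s. indicator {a..b} s * ?q n s \<partial>lborel) \<longlonglongrightarrow> h b - h a"
      unfolding int by (intro tendsto_diff difference_quotient_LIMSEQ \<Phi>) (use ab in auto)
    moreover have "integrable lborel (\<lambda>s. indicator {a..b} s * D s)"
      by (rule integrable_dominated_convergence[OF _ _ w lim bd]) measurable
    ultimately show ?thesis using conv LIMSEQ_unique by blast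
  qed
  have "AE s in lborel. D s = deriv h s" using q by eventually_elim auto
  then show ?thesis using main by (intro that[OF Dm]) auto
qed

lemma AE_lborel_uminus:
  fixes P :: "real \<Rightarrow> bool"
  assumes "AE s in lborel. P s"
  shows "AE s in lborel. P (- s)"
proof -
  obtain N where N: "{s. \<not> P s} \<subseteq> N" "N \<in> sets lborel" "emeasure lborel N = 0"
    using assms by (auto elim!: AE_E)
  have "emeasure lborel (uminus -` N) = emeasure (distr lborel borel uminus) N"
    using N by (subst emeasure_distr) auto
  then have "emeasure lborel (uminus -` N) = 0" using N by (simp add: lborel_distr_uminus)
  moreover have "uminus -` N \<in> sets lborel"
    using N measurable_sets_borel[of uminus borel N] by simp
  ultimately show ?thesis
    using N(1) by (intro AE_I[of _ _ "uminus -` N"]) auto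
qed

lemma AE_lborel_symmetric:
  fixes P :: "real \<Rightarrow> bool"
  assumes "AE s in lborel. 0 < s \<longrightarrow> P s \<and> P (- s)"
  shows "AE s in lborel. P s"
proof -
  have "AE s in lborel. s \<noteq> (0::real)" by (rule AE_lborel_singleton)
  with assms AE_lborel_uminus[OF assms] show ?thesis
  proof eventually_elim
    case (elim s)
    then show ?case by (cases "s > 0") auto
  qed
qed

lemma H_plus_locally_lipschitz: "h \<in> H_plus \<Longrightarrow> locally_lipschitz h"
  by (simp add: H_plus_def)

lemma H_plus_AE_differentiable:
  assumes "h \<in> H_plus" shows "AE s in lborel. h differentiable (at s)"
proof (rule AE_lborel_symmetric)
  have "AE s in lborel. 0 < s \<longrightarrow>
        h differentiable (at s) \<and> h differentiable (at (- s)) \<and> deriv h s + deriv h (- s) > 0"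
    using assms by (simp add: H_plus_def)
  then show "AE s in lborel. 0 < s \<longrightarrow> h differentiable (at s) \<and> h differentiable (at (- s))"
    by eventually_elim auto
qed

lemma H_plus_continuous: "h \<in> H_plus \<Longrightarrow> continuous_on S h"
  by (simp add: continuous_at_imp_continuous_on locally_lipschitz_isCont H_plus_def)

lemma H_plus_measurable: "h \<in> H_plus \<Longrightarrow> h \<in> borel_measurable borel"
  by (intro borel_measurable_continuous_onI H_plus_continuous)

lemma integral_lborel_Icc_uminus:
  fixes f :: "real \<Rightarrow> real"
  shows "(\<integral>s. indicator {-b..-a} s * f s \<partial>lborel) = (\<integral>s. indicator {a..b} s * f (- s) \<partial>lborel)"
proof -
  have "(\<integral>s. indicator {-b..-a} s * f s \<partial>lborel) = (\<integral>s. indicator {-b..-a} (-s) * f (- s) \<partial>lborel)"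
    using lborel_integral_real_affine[of "-1" "\<lambda>s. indicator {-b..-a} s * f s" 0] by simp
  also have "(\<lambda>s. indicator {-b..-a} (-s) * f (- s)) = (\<lambda>s. indicator {a..b} s * f (- s))"
    by (auto simp: indicator_def)
  finally show ?thesis .
qed

lemma H_plus_odd_part_strict_mono:
  assumes h: "h \<in> H_plus"
  shows "strict_mono (\<lambda>s. h s - h (- s))"
proof -
  let ?k = "\<lambda>s. h s - h (- s)"
  obtain D where D: "D \<in> borel_measurable borel" "AE s in lborel. D s = deriv h s"
    "\<And>a b. a \<le> b \<Longrightarrow> integrable lborel (\<lambda>s. indicator {a..b} s * D s)"
    "\<And>a b. a \<le> b \<Longrightarrow> (\<integral>s. indicator {a..b} s * D s \<partial>lborel) = h b - h a"
    by (rule locally_lipschitz_FTC[OF H_plus_locally_lipschitz[OF h] H_plus_AE_differentiable[OF h]]) blast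
  note D(1) [measurable]
  have pos: "AE s in lborel. 0 < s \<longrightarrow> D s + D (- s) > 0"
  proof -
    have "AE s in lborel. 0 < s \<longrightarrow> deriv h s + deriv h (- s) > 0"
      using h unfolding H_plus_def by (auto elim!: eventually_mono)
    with D(2) AE_lborel_uminus[OF D(2)] show ?thesis
      by eventually_elim auto
  qed
  have pos_less: "?k a < ?k b" if ab: "0 \<le> a" "a < b" for a b
  proof -
    let ?f = "\<lambda>s. indicator {a..b} s * D s + indicator {a..b} s * D (- s)"
    have i2: "integrable lborel (\<lambda>s. indicator {a..b} s * D (- s))"
    proof -
      have "integrable lborel (\<lambda>s. indicator {-b..-a} (0 + -1 * s) * D (0 + -1 * s))"
        using ab by (intro lborel_integrable_real_affine D(3)) auto
      moreover have "(\<lambda>s. indicator {-b..-a} (0 + -1 * s) * D (0 + -1 * s)) = (\<lambda>s. indicator {a..b} s * D (- s))"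
        by (auto simp: indicator_def)
      ultimately show ?thesis by simp
    qed
    have eq: "?k b - ?k a = (\<integral>s. ?f s \<partial>lborel)"
      using D(4)[of a b] D(4)[of "-b" "-a"] ab i2 D(3)[of a b]
      by (simp add: integral_lborel_Icc_uminus)
    have AEn: "AE s in lborel. s \<noteq> (0::real)" by (rule AE_lborel_singleton)
    have nn: "AE s in lborel. 0 \<le> ?f s"
      using pos AEn by eventually_elim (use ab in \<open>auto simp: indicator_def\<close>)
    have "(\<integral>s. ?f s \<partial>lborel) \<noteq> 0"
    proof
      assume "(\<integral>s. ?f s \<partial>lborel) = 0"
      then have "AE s in lborel. ?f s = 0"
        using integral_nonneg_eq_0_iff_AE[OF _ nn] i2 D(3)[of a b] ab by simp
      with pos AEn have "AE s in lborel. s \<notin> {a..b}"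
        by eventually_elim (use ab in \<open>auto simp: indicator_def\<close>)
      then have "emeasure lborel {a..b} = 0"
        by (subst (asm) AE_iff_measurable[of "{a..b}"]) auto
      then show False using ab by simp
    qed
    moreover have "(\<integral>s. ?f s \<partial>lborel) \<ge> 0" using nn by (rule integral_nonneg_AE)
    ultimately show ?thesis using eq by linarith
  qed
  show ?thesis
  proof (rule strict_monoI)
    fix a b :: real assume "a < b"
    consider "0 \<le> a" | "b \<le> 0" | "a < 0" "0 < b" by linarith
    then show "?k a < ?k b"
    proof cases
      case 1 then show ?thesis using pos_less \<open>a < b\<close> by simp
    next
      case 2 then show ?thesis using pos_less[of "-b" "-a"] \<open>a < b\<close> by simp
    next
      case 3 then show ?thesis using pos_less[of 0 b] pos_less[of 0 "-a"] by simp
    qed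
  qed
qed

text \<open>
  An increasing function of \<open>r\<close> that dominates \<open>\<bar>h\<bar>\<close> on \<open>[- r, r]\<close>. It takes values in
  \<^typ>\<open>ennreal\<close>, so that no integrability has to be known in advance.
\<close>

definition growth :: "(real \<Rightarrow> real) \<Rightarrow> real \<Rightarrow> ennreal" where
  "growth h r = ennreal \<bar>h 0\<bar> + (\<integral>\<^sup>+v. indicator {0..r} v * ennreal (\<bar>deriv h v\<bar> + \<bar>deriv h (- v)\<bar>) \<partial>lborel)"

lemma growth_mono: "r \<le> r' \<Longrightarrow> growth h r \<le> growth h r'"
  unfolding growth_def by (intro add_left_mono nn_integral_mono mult_right_mono) (auto simp: indicator_def)

lemma abs_le_growth:
  assumes h: "h \<in> H_plus"
  shows "ennreal \<bar>h s\<bar> \<le> growth h \<bar>s\<bar>"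
proof -
  let ?G = "\<lambda>r. \<integral>\<^sup>+v. indicator {0..r} v * ennreal (\<bar>deriv h v\<bar> + \<bar>deriv h (- v)\<bar>) \<partial>lborel"
  obtain D where D: "D \<in> borel_measurable borel" "AE s in lborel. D s = deriv h s"
    "\<And>a b. a \<le> b \<Longrightarrow> integrable lborel (\<lambda>s. indicator {a..b} s * D s)"
    "\<And>a b. a \<le> b \<Longrightarrow> (\<integral>s. indicator {a..b} s * D s \<partial>lborel) = h b - h a"
    by (rule locally_lipschitz_FTC[OF H_plus_locally_lipschitz[OF h] H_plus_AE_differentiable[OF h]]) blast
  note D(1) [measurable]
  let ?I = "\<lambda>a b. \<integral>\<^sup>+v. indicator {a..b} v * ennreal \<bar>D v\<bar> \<partial>lborel"
  have *: "ennreal \<bar>h b - h a\<bar> \<le> ?I a b" if "a \<le> b" for a b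
  proof -
    have "ennreal \<bar>h b - h a\<bar> = ennreal (norm (\<integral>s. indicator {a..b} s * D s \<partial>lborel))"
      using D(4)[OF that] by simp
    also have "\<dots> \<le> (\<integral>\<^sup>+s. ennreal (norm (indicator {a..b} s * D s)) \<partial>lborel)"
      by (rule integral_norm_bound_ennreal[OF D(3)[OF that]])
    also have "\<dots> = ?I a b"
      by (intro nn_integral_cong) (auto simp: indicator_def)
    finally show ?thesis .
  qed
  have nn: "?I (- r) 0 = (\<integral>\<^sup>+v. indicator {0..r} v * ennreal \<bar>D (- v)\<bar> \<partial>lborel)" for r
  proof -
    have "?I (- r) 0 = (\<integral>\<^sup>+v. indicator {- r..0} (- v) * ennreal \<bar>D (- v)\<bar> \<partial>lborel)"
      using nn_integral_real_affine[of "\<lambda>v. indicator {- r..0} v * ennreal \<bar>D v\<bar>" "-1" 0] by simp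
    also have "\<dots> = (\<integral>\<^sup>+v. indicator {0..r} v * ennreal \<bar>D (- v)\<bar> \<partial>lborel)"
      by (intro nn_integral_cong) (auto simp: indicator_def)
    finally show ?thesis .
  qed
  have le: "?I 0 r \<le> ?G r"
       "?I (- r) 0 \<le> ?G r" for r
  proof -
    show "?I 0 r \<le> ?G r"
      using D(2) by (intro nn_integral_mono_AE) (auto elim!: eventually_mono intro!: mult_left_mono ennreal_leI)
    show "?I (- r) 0 \<le> ?G r"
      unfolding nn using AE_lborel_uminus[OF D(2)]
      by (intro nn_integral_mono_AE) (auto elim!: eventually_mono intro!: mult_left_mono ennreal_leI)
  qed
  have "ennreal \<bar>h s\<bar> \<le> ennreal \<bar>h 0\<bar> + ennreal \<bar>h s - h 0\<bar>"
    by (simp add: ennreal_plus[symmetric] del: ennreal_plus)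
  also have "ennreal \<bar>h s - h 0\<bar> \<le> ?G \<bar>s\<bar>"
  proof (cases "s \<ge> 0")
    case True
    then show ?thesis using *[of 0 s] le(1)[of s] by (auto intro: order_trans)
  next
    case False
    then show ?thesis using *[of s 0] le(2)[of "-s"] by (auto intro: order_trans simp: abs_minus_commute)
  qed
  finally show ?thesis by (simp add: growth_def)
qed

section \<open>Gaussian integrability of the growth bound\<close>

lemma growth_measurable [measurable]: "growth h \<in> borel_measurable borel"
proof (rule borel_measurableI_greater)
  fix y
  have "is_interval {r. y < growth h r}"
    unfolding is_interval_1 using growth_mono[of _ _ h] by (auto intro: less_le_trans)
  then show "{r \<in> space borel. y < growth h r} \<in> sets borel"
    by (simp add: real_interval_borel_measurable)
qed

lemma H_plus_derivative_integrable:
  fixes h :: "real \<Rightarrow> real"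
  defines "g \<equiv> \<lambda>v. \<bar>deriv h v\<bar> + \<bar>deriv h (- v)\<bar>"
  assumes h: "h \<in> H_plus"
  shows "g \<in> borel_measurable borel"
    and "(\<integral>\<^sup>+v. ennreal (std_normal_density (v - a)) * ennreal (g v) \<partial>lborel) < \<infinity>"
proof -
  have i: "integrable std_normal_distribution (\<lambda>s. g (a + s))" for a
    using h by (simp add: H_plus_def g_def)
  show gm [measurable]: "g \<in> borel_measurable borel"
    using borel_measurable_integrable[OF i[of 0]] by simp
  have "(\<integral>\<^sup>+v. ennreal (std_normal_density (v - a)) * ennreal (g v) \<partial>lborel)
     = (\<integral>\<^sup>+s. ennreal (std_normal_density s) * ennreal (g (a + s)) \<partial>lborel)"
    using nn_integral_real_affine[of "\<lambda>v. ennreal (std_normal_density (v - a)) * ennreal (g v)" 1 a] by simp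
  also have "\<dots> = (\<integral>\<^sup>+s. ennreal (g (a + s)) \<partial>std_normal_distribution)"
    by (simp add: nn_integral_density)
  also have "\<dots> = (\<integral>\<^sup>+s. ennreal (norm (g (a + s))) \<partial>std_normal_distribution)"
    by (simp add: g_def)
  also have "\<dots> < \<infinity>"
    using i[of a] by (simp add: integrable_iff_bounded)
  finally show "(\<integral>\<^sup>+v. ennreal (std_normal_density (v - a)) * ennreal (g v) \<partial>lborel) < \<infinity>" .
qed

text \<open>
  If \<open>v \<le> \<bar>s\<bar> + \<tau>\<close>, the Gaussian factor at \<open>s\<close> is dominated by a Gaussian factor in \<open>v\<close> with centre
  \<open>\<tau> + 2\<close>, and enough is left over for integrability in \<open>s\<close>.
\<close>

lemma gaussian_tail_exponent:
  fixes s v \<tau> :: real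
  assumes "0 \<le> v" "v \<le> \<bar>s\<bar> + \<tau>" "0 \<le> \<tau>"
  shows "- s\<^sup>2 / 2 + \<bar>s\<bar> \<le> (2 + (\<tau> + 2)\<^sup>2 / 2) - (v - (\<tau> + 2))\<^sup>2 / 2 - \<bar>s\<bar>"
proof -
  let ?s = "\<bar>s\<bar>"
  have *: "(v - (\<tau> + 2))\<^sup>2 \<le> (?s - 2)\<^sup>2 + (\<tau> + 2)\<^sup>2"
  proof (cases "v - (\<tau> + 2) \<ge> 0")
    case True
    then have "(v - (\<tau> + 2))\<^sup>2 \<le> (?s - 2)\<^sup>2"
      using assms by (intro power_mono) auto
    then show ?thesis by (simp add: add_increasing2)
  next
    case False
    then have "\<bar>v - (\<tau> + 2)\<bar> \<le> \<bar>\<tau> + 2\<bar>" using assms by linarith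
    then have "(v - (\<tau> + 2))\<^sup>2 \<le> (\<tau> + 2)\<^sup>2" by (simp add: abs_le_square_iff)
    then show ?thesis by (simp add: add_increasing)
  qed
  have "(?s - 2)\<^sup>2 = s\<^sup>2 - 4 * ?s + 4"
    by (simp add: power2_eq_square algebra_simps)
  with * show ?thesis by (simp add: field_simps)
qed

lemma nn_integral_exp_neg_abs: "(\<integral>\<^sup>+s. ennreal (exp (- \<bar>s\<bar>)) \<partial>lborel) < \<infinity>"
proof -
  have "has_bochner_integral lborel (\<lambda>s::real. indicator {0..} s *\<^sub>R exp (- \<bar>s\<bar>)) 1"
  proof -
    have "has_bochner_integral lborel (\<lambda>x::real. x ^ 0 * exp (- x) * indicator {0 ..} x) (fact 0)"
      by (rule has_bochner_integral_I0i_power_exp_m')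
    then have "has_bochner_integral lborel (\<lambda>x::real. exp (- x) * indicator {0 ..} x) 1"
      by simp
    also have "(\<lambda>x::real. exp (- x) * indicator {0 ..} x) = (\<lambda>s::real. indicator {0..} s *\<^sub>R exp (- \<bar>s\<bar>))"
      by (auto simp: indicator_def)
    finally show ?thesis .
  qed
  then have "integrable lborel (\<lambda>s::real. exp (- \<bar>s\<bar>))"
    using has_bochner_integral_even_function[of "\<lambda>s. exp (- \<bar>s\<bar>)" 1] by (auto intro: integrable.intros)
  then show ?thesis by (simp add: integrable_iff_bounded)
qed

lemma growth_integrable:
  assumes h: "h \<in> H_plus" and \<tau>: "0 \<le> \<tau>"
  shows "(\<integral>\<^sup>+s. growth h (\<bar>s\<bar> + \<tau>) * ennreal (1 + s\<^sup>2) \<partial>std_normal_distribution) < \<infinity>"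
proof -
  let ?e = "\<lambda>s. ennreal (exp (- \<bar>s\<bar>))"
  define g where "g = (\<lambda>v. \<bar>deriv h v\<bar> + \<bar>deriv h (- v)\<bar>)"
  have [measurable]: "g \<in> borel_measurable borel"
    unfolding g_def by (rule H_plus_derivative_integrable(1)[OF h])
  have H: "(\<integral>\<^sup>+v. ennreal (std_normal_density (v - a)) * ennreal (g v) \<partial>lborel) < \<infinity>" for a
    unfolding g_def by (rule H_plus_derivative_integrable(2)[OF h])
  have g0: "g v \<ge> 0" for v by (simp add: g_def)
  let ?I = "\<lambda>s v. indicator {0..\<bar>s\<bar> + \<tau>} v :: ennreal"
  let ?a = "\<tau> + 2" and ?C = "2 + (\<tau> + 2)\<^sup>2 / 2"
  let ?n = "\<lambda>v. ennreal (std_normal_density (v - ?a))"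
  let ?J = "\<lambda>s. \<integral>\<^sup>+v. ?I s v * ennreal (g v) \<partial>lborel"
  let ?w = "\<lambda>s. ennreal (std_normal_density s) * ennreal (1 + s\<^sup>2)"
  have [measurable]: "(\<lambda>(s, v). ?I s v) \<in> borel_measurable (borel \<Otimes>\<^sub>M borel)"
  proof -
    have "(\<lambda>(s, v). ?I s v) = (\<lambda>p. if 0 \<le> snd p \<and> snd p \<le> \<bar>fst p\<bar> + \<tau> then 1 else 0)"
      by (auto simp: indicator_def)
    then show ?thesis by simp
  qed
  have pw: "1 + s\<^sup>2 \<le> 2 * exp \<bar>s\<bar>" for s :: real
    using exp_lower_Taylor_quadratic[of "\<bar>s\<bar>"] by simp
  have b: "?I s v * ?w s \<le> ennreal (2 * exp ?C) * (?e s * ?n v)" for s v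
  proof (cases "0 \<le> v \<and> v \<le> \<bar>s\<bar> + \<tau>")
    case True
    have "std_normal_density s * (1 + s\<^sup>2) \<le> std_normal_density s * (2 * exp \<bar>s\<bar>)"
      by (intro mult_left_mono pw) simp
    also have "\<dots> = 2 / sqrt (2 * pi) * exp (- s\<^sup>2 / 2 + \<bar>s\<bar>)"
      by (simp add: std_normal_density_def exp_add[symmetric] add.commute)
    also have "\<dots> \<le> 2 / sqrt (2 * pi) * exp (?C - (v - ?a)\<^sup>2 / 2 - \<bar>s\<bar>)"
      using gaussian_tail_exponent[of v s \<tau>] True \<tau> by (intro mult_left_mono) auto
    also have "\<dots> = 2 * exp ?C * (exp (- \<bar>s\<bar>) * std_normal_density (v - ?a))"
    proof -
      have "exp (?C - (v - ?a)\<^sup>2 / 2 - \<bar>s\<bar>) = exp ?C * (exp (- \<bar>s\<bar>) * exp (- (v - ?a)\<^sup>2 / 2))"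
        unfolding exp_add[symmetric] by (rule arg_cong[where f = exp]) simp
      then show ?thesis by (simp only: std_normal_density_def) simp
    qed
    finally have "std_normal_density s * (1 + s\<^sup>2) \<le> 2 * exp ?C * (exp (- \<bar>s\<bar>) * std_normal_density (v - ?a))" .
    then show ?thesis using True
      by (simp add: ennreal_mult[symmetric] ennreal_leI del: ennreal_plus)
  qed simp
  have "(\<integral>\<^sup>+s. ?J s * ?w s \<partial>lborel)
      = (\<integral>\<^sup>+s. (\<integral>\<^sup>+v. ?I s v * ennreal (g v) * ?w s \<partial>lborel) \<partial>lborel)"
    by (intro nn_integral_cong nn_integral_multc[symmetric]) measurable
  \<comment> \<open>By Tonelli, \<open>g v\<close> is weighted by the mass of \<open>\<bar>s\<bar> \<ge> v - \<tau>\<close>, a Gaussian tail in \<open>v\<close>.\<close>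
  also have "\<dots> = (\<integral>\<^sup>+v. (\<integral>\<^sup>+s. ?I s v * ennreal (g v) * ?w s \<partial>lborel) \<partial>lborel)"
    by (rule lborel_pair.Fubini') measurable
  also have "\<dots> \<le> (\<integral>\<^sup>+v. (\<integral>\<^sup>+s. ennreal (2 * exp ?C) * (?n v * ennreal (g v)) * ?e s \<partial>lborel) \<partial>lborel)"
  proof (intro nn_integral_mono)
    fix v s
    have "?I s v * ennreal (g v) * ?w s = ennreal (g v) * (?I s v * ?w s)" by (simp only: mult_ac)
    also have "\<dots> \<le> ennreal (g v) * (ennreal (2 * exp ?C) * (?e s * ?n v))"
      by (intro mult_left_mono b) simp
    finally show "?I s v * ennreal (g v) * ?w s \<le> ennreal (2 * exp ?C) * (?n v * ennreal (g v)) * ?e s"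
      by (simp only: mult_ac)
  qed
  also have "\<dots> = (\<integral>\<^sup>+v. ennreal (2 * exp ?C) * (?n v * ennreal (g v)) * (\<integral>\<^sup>+s. ?e s \<partial>lborel) \<partial>lborel)"
    by (intro nn_integral_cong nn_integral_cmult) measurable
  also have "\<dots> = ennreal (2 * exp ?C) * (\<integral>\<^sup>+v. ?n v * ennreal (g v) \<partial>lborel) * (\<integral>\<^sup>+s. ?e s \<partial>lborel)"
    by (simp add: nn_integral_multc nn_integral_cmult)
  also have "\<dots> < \<infinity>"
    using H[of ?a] nn_integral_exp_neg_abs by (simp add: ennreal_mult_less_top)
  finally have fin: "(\<integral>\<^sup>+s. ?J s * ?w s \<partial>lborel) < \<infinity>" .
  have mom: "(\<integral>\<^sup>+s. ennreal \<bar>h 0\<bar> * ?w s \<partial>lborel) < \<infinity>"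
  proof -
    have "integrable lborel (\<lambda>s. std_normal_density s * (1 + s\<^sup>2))"
      using integrable_std_normal_moment[of 0] integrable_std_normal_moment[of 2]
      by (simp add: distrib_left)
    then have "(\<integral>\<^sup>+s. ?w s \<partial>lborel) < \<infinity>"
      by (simp add: integrable_iff_bounded ennreal_mult[symmetric] abs_mult del: ennreal_plus)
    then show ?thesis
      by (subst nn_integral_cmult) (auto simp: ennreal_mult_less_top)
  qed
  have mI: "(\<lambda>s. \<integral>\<^sup>+v. ?I s v * ennreal (g v) \<partial>lborel) \<in> borel_measurable borel"
    by measurable
  note mI [measurable]
  have "(\<integral>\<^sup>+s. growth h (\<bar>s\<bar> + \<tau>) * ennreal (1 + s\<^sup>2) \<partial>std_normal_distribution)
    = (\<integral>\<^sup>+s. ennreal (std_normal_density s) * (growth h (\<bar>s\<bar> + \<tau>) * ennreal (1 + s\<^sup>2)) \<partial>lborel)"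
    by (rule nn_integral_density) auto
  also have "\<dots> = (\<integral>\<^sup>+s. ennreal \<bar>h 0\<bar> * ?w s + ?J s * ?w s \<partial>lborel)"
    unfolding growth_def g_def by (intro nn_integral_cong) (simp add: distrib_left distrib_right mult_ac)
  also have "\<dots> = (\<integral>\<^sup>+s. ennreal \<bar>h 0\<bar> * ?w s \<partial>lborel) + (\<integral>\<^sup>+s. ?J s * ?w s \<partial>lborel)"
    by (rule nn_integral_add) measurable
  also have "\<dots> < \<infinity>" using fin mom by simp
  finally show ?thesis .
qed

section \<open>Domination of the loss on the unit ball\<close>

lemma nn_integral_std_gaussian_linear:
  fixes A B :: "real ^ 'd::finite \<Rightarrow> real ^ 'd"
  assumes A: "linear A" "linear B" and AB: "\<And>z. A (B z) = z" and BA: "\<And>z. B (A z) = z"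
  obtains c where "c > 0" "\<And>F. F \<in> borel_measurable borel \<Longrightarrow>
    (\<integral>\<^sup>+z. F (A z) \<partial>std_gaussian) =
    ennreal c * (\<integral>\<^sup>+z. F z * ennreal (exp (((norm z)\<^sup>2 - (norm (B z))\<^sup>2) / 2)) \<partial>std_gaussian)"
proof -
  let ?c = "1 / \<bar>det (matrix A)\<bar>"
  let ?E = "\<lambda>z. exp (((norm z)\<^sup>2 - (norm (B z))\<^sup>2) / 2)"
  have [measurable]: "A \<in> borel \<rightarrow>\<^sub>M borel" "B \<in> borel \<rightarrow>\<^sub>M borel"
    using A by (auto intro: measurable_linear)
  have "inj A" using BA by (metis injI)
  then have "det (matrix A) \<noteq> 0" using det_nz_iff_inj[OF A(1)] by simp
  then have c: "?c > 0" by simp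
  have "(\<integral>\<^sup>+z. F (A z) \<partial>std_gaussian) = ennreal ?c * (\<integral>\<^sup>+z. F z * ennreal (?E z) \<partial>std_gaussian)"
    if F [measurable]: "F \<in> borel_measurable borel" for F
  proof -
    have "(\<integral>\<^sup>+z. F (A z) \<partial>std_gaussian) = (\<integral>\<^sup>+z. F z \<partial>distr std_gaussian borel A)"
      by (rule nn_integral_distr[symmetric]) auto
    also have "\<dots> = (\<integral>\<^sup>+z. ennreal (?c * ?E z) * F z \<partial>std_gaussian)"
      unfolding distr_std_gaussian_linear[OF A AB BA] by (rule nn_integral_density) auto
    also have "\<dots> = (\<integral>\<^sup>+z. ennreal ?c * (F z * ennreal (?E z)) \<partial>std_gaussian)"
      by (intro nn_integral_cong) (subst ennreal_mult, auto simp: mult_ac)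
    also have "\<dots> = ennreal ?c * (\<integral>\<^sup>+z. F z * ennreal (?E z) \<partial>std_gaussian)"
      by (rule nn_integral_cmult) measurable
    finally show ?thesis .
  qed
  with c show ?thesis by (rule that)
qed

lemma growth_inner_integrable:
  fixes e :: "real ^ 'd::finite"
  assumes h: "h \<in> H_plus" and \<tau>: "0 \<le> \<tau>" and e: "norm e = 1"
  shows "(\<integral>\<^sup>+z. growth h (\<bar>e \<bullet> z\<bar> + \<tau>) * ennreal (1 + (e \<bullet> z)\<^sup>2) \<partial>std_gaussian) < \<infinity>"
  using growth_integrable[OF h \<tau>]
    nn_integral_std_gaussian_inner[OF e, of "\<lambda>s. growth h (\<bar>s\<bar> + \<tau>) * ennreal (1 + s\<^sup>2)"]
  by simp

text \<open>
  On the unit sphere there is no room for an exponential weight in the direction \<open>e\<close>. Dilating only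
  the orthogonal complement of \<open>e\<close> leaves \<open>e \<bullet> z\<close> unchanged and still produces an exponential
  weight in the other directions.
\<close>

lemma growth_norm_integrable:
  fixes e :: "real ^ 'd::finite"
  assumes h: "h \<in> H_plus" and \<tau>: "0 \<le> \<tau>" and e: "norm e = 1"
  shows "(\<integral>\<^sup>+z. growth h (\<bar>e \<bullet> z\<bar> + \<tau>) * ennreal (1 + (norm z)\<^sup>2) \<partial>std_gaussian) < \<infinity>"
proof -
  let ?g = "\<lambda>z. growth h (\<bar>e \<bullet> z\<bar> + \<tau>)"
  have ee: "e \<bullet> e = 1" using e by (simp add: norm_eq_1)
  let ?A = "\<lambda>z. 2 *\<^sub>R z - (e \<bullet> z) *\<^sub>R e" and ?B = "\<lambda>z. (1/2) *\<^sub>R z + ((e \<bullet> z) / 2) *\<^sub>R e"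
  have "linear ?A" "linear ?B"
    by (auto intro!: linearI simp: algebra_simps inner_add_right add_divide_distrib)
  moreover have "?A (?B z) = z" "?B (?A z) = z" for z
    by (simp_all add: inner_add_right inner_diff_right ee algebra_simps)
  ultimately obtain c where c: "c > 0" "\<And>F. F \<in> borel_measurable borel \<Longrightarrow>
    (\<integral>\<^sup>+z. F (?A z) \<partial>std_gaussian) =
    ennreal c * (\<integral>\<^sup>+z. F z * ennreal (exp (((norm z)\<^sup>2 - (norm (?B z))\<^sup>2) / 2)) \<partial>std_gaussian)"
    by (rule nn_integral_std_gaussian_linear) blast
  let ?E = "\<lambda>z. exp (((norm z)\<^sup>2 - (norm (?B z))\<^sup>2) / 2)"
  have nB: "(norm z)\<^sup>2 - (norm (?B z))\<^sup>2 = 3/4 * ((norm z)\<^sup>2 - (e \<bullet> z)\<^sup>2)" for z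
    unfolding power2_norm_eq_inner
    by (simp add: inner_add_left inner_add_right ee inner_commute power2_eq_square field_simps)
  let ?F = "\<lambda>z. ?g z * ennreal (1 + (e \<bullet> z)\<^sup>2)"
  have eA: "e \<bullet> ?A z = e \<bullet> z" for z by (simp add: inner_diff_right ee)
  have "ennreal c * (\<integral>\<^sup>+z. ?F z * ennreal (?E z) \<partial>std_gaussian)
     = (\<integral>\<^sup>+z. ?F (?A z) \<partial>std_gaussian)"
    by (rule c(2)[symmetric]) measurable
  also have "\<dots> < \<infinity>" unfolding eA by (rule growth_inner_integrable[OF h \<tau> e])
  finally have fin: "(\<integral>\<^sup>+z. ?F z * ennreal (?E z) \<partial>std_gaussian) < \<infinity>"
    using c(1) by (auto simp: ennreal_mult_less_top)
  have "(\<integral>\<^sup>+z. ?g z * ennreal (1 + (norm z)\<^sup>2) \<partial>std_gaussian)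
     \<le> (\<integral>\<^sup>+z. 3 * (?F z * ennreal (?E z)) \<partial>std_gaussian)"
  proof (rule nn_integral_mono)
    fix z
    define y where "y = (norm z)\<^sup>2 - (e \<bullet> z)\<^sup>2"
    have "\<bar>e \<bullet> z\<bar> \<le> norm z" using Cauchy_Schwarz_ineq2[of e z] e by simp
    then have y0: "y \<ge> 0" unfolding y_def by (simp add: abs_le_square_iff[symmetric])
    have "1 + (norm z)\<^sup>2 = 1 + (e \<bullet> z)\<^sup>2 + y" by (simp add: y_def)
    also have "\<dots> \<le> (1 + (e \<bullet> z)\<^sup>2) * (1 + y)" using y0 by (simp add: algebra_simps)
    also have "\<dots> \<le> (1 + (e \<bullet> z)\<^sup>2) * (3 * exp (3/8 * y))"
    proof (intro mult_left_mono)
      show "1 + y \<le> 3 * exp (3/8 * y)"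
        using exp_ge_add_one_self[of "3/8 * y"] y0 by linarith
    qed simp
    also have "3/8 * y = ((norm z)\<^sup>2 - (norm (?B z))\<^sup>2) / 2" unfolding nB y_def by simp
    finally have le: "1 + (norm z)\<^sup>2 \<le> (1 + (e \<bullet> z)\<^sup>2) * (3 * ?E z)" .
    have "ennreal (1 + (norm z)\<^sup>2) \<le> ennreal (1 + (e \<bullet> z)\<^sup>2) * (3 * ennreal (?E z))"
      using ennreal_leI[OF le] by (simp add: ennreal_mult)
    then have "?g z * ennreal (1 + (norm z)\<^sup>2) \<le>
      ?g z * (ennreal (1 + (e \<bullet> z)\<^sup>2) * (3 * ennreal (?E z)))"
      by (intro mult_left_mono) auto
    then show "?g z * ennreal (1 + (norm z)\<^sup>2) \<le> 3 * (?F z * ennreal (?E z))"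
      by (simp only: mult_ac)
  qed
  also have "\<dots> = 3 * (\<integral>\<^sup>+z. ?F z * ennreal (?E z) \<partial>std_gaussian)"
    by (rule nn_integral_cmult) measurable
  also have "\<dots> < \<infinity>" using fin by (simp add: ennreal_mult_less_top)
  finally show ?thesis .
qed

text \<open>
  Strictly inside the ball, dilating \<open>z\<close> by \<open>1 / r\<close> turns \<open>r e \<bullet> z\<close> into \<open>e \<bullet> z\<close> and produces the weight
  \<open>exp (\<epsilon> (norm z)\<^sup>2)\<close> with \<open>\<epsilon> = (1 - r\<^sup>2) / 2\<close>.
\<close>

lemma std_gaussian_exp_norm_integrable:
  fixes e :: "real ^ 'd::finite"
  assumes h: "h \<in> H_plus" and \<tau>: "0 \<le> \<tau>" and e: "norm e = 1" and r: "0 < r" "r < 1"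
  shows "(\<integral>\<^sup>+z. growth h (\<bar>(r *\<^sub>R e) \<bullet> z\<bar> + \<tau>) * ennreal (exp ((1 - r\<^sup>2) / 2 * (norm z)\<^sup>2)) \<partial>std_gaussian) < \<infinity>"
    and "(\<integral>\<^sup>+z. ennreal (exp ((1 - r\<^sup>2) / 2 * (norm (z :: real ^ 'd))\<^sup>2)) \<partial>std_gaussian) < \<infinity>"
proof -
  interpret G: prob_space "std_gaussian :: (real ^ 'd) measure" by (rule prob_space_std_gaussian)
  let ?A = "\<lambda>z :: real ^ 'd. (1/r) *\<^sub>R z" and ?B = "\<lambda>z :: real ^ 'd. r *\<^sub>R z"
  have "linear ?A" "linear ?B"
    by (auto intro!: linearI simp: algebra_simps)
  moreover have "?A (?B z) = z" "?B (?A z) = z" for z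
    using r by simp_all
  ultimately obtain c where c: "c > 0" "\<And>F. F \<in> borel_measurable borel \<Longrightarrow>
    (\<integral>\<^sup>+z. F (?A z) \<partial>std_gaussian) =
    ennreal c * (\<integral>\<^sup>+z. F z * ennreal (exp (((norm z)\<^sup>2 - (norm (?B z))\<^sup>2) / 2)) \<partial>std_gaussian)"
    by (rule nn_integral_std_gaussian_linear) blast
  have nB: "((norm z)\<^sup>2 - (norm (?B z))\<^sup>2) / 2 = (1 - r\<^sup>2) / 2 * (norm z)\<^sup>2" for z
    by (simp add: power_mult_distrib algebra_simps)
  have fin: "(\<integral>\<^sup>+z. F z * ennreal (exp ((1 - r\<^sup>2) / 2 * (norm z)\<^sup>2)) \<partial>std_gaussian) < \<infinity>"
    if F: "F \<in> borel_measurable borel" and "(\<integral>\<^sup>+z. F (?A z) \<partial>std_gaussian) < \<infinity>" for F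
    using c(2)[OF F] that(2) c(1) unfolding nB by (auto simp: ennreal_mult_less_top)
  show "(\<integral>\<^sup>+z. growth h (\<bar>(r *\<^sub>R e) \<bullet> z\<bar> + \<tau>) * ennreal (exp ((1 - r\<^sup>2) / 2 * (norm z)\<^sup>2)) \<partial>std_gaussian) < \<infinity>"
  proof (rule fin)
    have "(\<integral>\<^sup>+z. growth h (\<bar>(r *\<^sub>R e) \<bullet> ?A z\<bar> + \<tau>) \<partial>std_gaussian)
      \<le> (\<integral>\<^sup>+z. growth h (\<bar>e \<bullet> z\<bar> + \<tau>) * ennreal (1 + (e \<bullet> z)\<^sup>2) \<partial>std_gaussian)"
    proof (rule nn_integral_mono)
      fix z
      have "growth h (\<bar>e \<bullet> z\<bar> + \<tau>) * 1 \<le> growth h (\<bar>e \<bullet> z\<bar> + \<tau>) * ennreal (1 + (e \<bullet> z)\<^sup>2)"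
        by (intro mult_left_mono) (auto simp: ennreal_1[symmetric] simp del: ennreal_1 ennreal_plus intro!: ennreal_leI)
      then show "growth h (\<bar>(r *\<^sub>R e) \<bullet> ?A z\<bar> + \<tau>) \<le> growth h (\<bar>e \<bullet> z\<bar> + \<tau>) * ennreal (1 + (e \<bullet> z)\<^sup>2)"
        using r by simp
    qed
    also have "\<dots> < \<infinity>" by (rule growth_inner_integrable[OF h \<tau> e])
    finally show "(\<integral>\<^sup>+z. growth h (\<bar>(r *\<^sub>R e) \<bullet> ?A z\<bar> + \<tau>) \<partial>std_gaussian) < \<infinity>" .
  qed measurable
  show "(\<integral>\<^sup>+z. ennreal (exp ((1 - r\<^sup>2) / 2 * (norm (z :: real ^ 'd))\<^sup>2)) \<partial>std_gaussian) < \<infinity>"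
    using fin[of "\<lambda>_. 1"] G.emeasure_space_1 by simp
qed

lemma nn_integral_gaussian_rows_weighted:
  fixes \<Phi> \<psi> :: "real ^ 'd::finite \<Rightarrow> ennreal"
  assumes [measurable]: "\<Phi> \<in> borel_measurable borel" "\<psi> \<in> borel_measurable borel"
    and fin: "(\<integral>\<^sup>+z. \<Phi> z * \<psi> z \<partial>std_gaussian) < \<infinity>" "(\<integral>\<^sup>+z. \<psi> z \<partial>std_gaussian) < \<infinity>"
  shows "(\<integral>\<^sup>+Z. (\<Sum>i\<in>{1..m}. \<Phi> (Z i)) * (\<Prod>j\<in>{1..m}. \<psi> (Z j)) \<partial>gaussian_rows m) < \<infinity>"
proof -
  let ?f = "\<lambda>i j z. (if j = i then \<Phi> z else 1) * \<psi> z"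
  have "(\<integral>\<^sup>+Z. (\<Sum>i\<in>{1..m}. \<Phi> (Z i)) * (\<Prod>j\<in>{1..m}. \<psi> (Z j)) \<partial>gaussian_rows m)
     = (\<integral>\<^sup>+Z. (\<Sum>i\<in>{1..m}. \<Prod>j\<in>{1..m}. ?f i j (Z j)) \<partial>gaussian_rows m)"
    by (intro nn_integral_cong) (simp add: sum_distrib_right prod.distrib)
  also have "\<dots> = (\<Sum>i\<in>{1..m}. \<integral>\<^sup>+Z. (\<Prod>j\<in>{1..m}. ?f i j (Z j)) \<partial>gaussian_rows m)"
    by (rule nn_integral_sum) measurable
  also have "\<dots> = (\<Sum>i\<in>{1..m}. \<Prod>j\<in>{1..m}. \<integral>\<^sup>+z. ?f i j z \<partial>std_gaussian)"
    by (intro sum.cong refl nn_integral_gaussian_rows_prod) measurable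
  also have "\<dots> < \<infinity>"
  proof -
    have "(\<integral>\<^sup>+z. ?f i j z \<partial>std_gaussian) < \<infinity>" for i j :: nat
      using fin by (cases "i = j") auto
    then have "(\<integral>\<^sup>+z. ?f i j z \<partial>std_gaussian) \<noteq> top" for i j :: nat
      by (simp add: less_top)
    then have "(\<Prod>j\<in>{1..m}. \<integral>\<^sup>+z. ?f i j z \<partial>std_gaussian) \<noteq> top" for i
      by (subst ennreal_prod_eq_top) auto
    then show ?thesis by (simp add: less_top)
  qed
  finally show ?thesis .
qed

lemma sample_loss_le_growth:
  assumes h: "h \<in> H_plus" and m: "m \<ge> 1"
  shows "ennreal \<bar>sample_loss m t xs h u Z\<bar> \<le> (\<Sum>i\<in>{1..m}. growth h (\<bar>u \<bullet> Z i\<bar> + \<bar>t\<bar>))"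
proof -
  obtain i where i: "i \<in> {1..m}" "max_score m t u Z = u \<bullet> Z i + t"
    by (rule max_score_cases[OF m])
  have "ennreal \<bar>sample_loss m t xs h u Z\<bar> \<le> growth h \<bar>- label m t xs Z * max_score m t u Z\<bar>"
    unfolding sample_loss_def by (rule abs_le_growth[OF h])
  also have "\<dots> \<le> growth h (\<bar>u \<bullet> Z i\<bar> + \<bar>t\<bar>)"
    by (rule growth_mono) (auto simp: label_def sgn_if i(2) abs_mult)
  also have "\<dots> \<le> (\<Sum>i\<in>{1..m}. growth h (\<bar>u \<bullet> Z i\<bar> + \<bar>t\<bar>))"
    using i(1) by (intro member_le_sum) auto
  finally show ?thesis .
qed

lemma cball_subset_loss_domain:
  fixes xs :: "real ^ 'd::finite"
  assumes h: "h \<in> H_plus" and m: "m \<ge> 1"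
  shows "cball 0 1 \<subseteq> loss_domain m t xs h"
proof
  fix u :: "real ^ 'd" assume "u \<in> cball 0 1"
  then have u: "norm u \<le> 1" by simp
  note H_plus_measurable[OF h, measurable]
  fix k :: 'd
  obtain e :: "real ^ 'd" where e: "norm e = 1" "u = norm u *\<^sub>R e"
  proof (cases "u = 0")
    case True then show ?thesis by (intro that[of "axis k 1"]) auto
  next
    case False then show ?thesis by (intro that[of "u /\<^sub>R norm u"]) auto
  qed
  interpret G: prob_space "std_gaussian :: (real ^ 'd) measure" by (rule prob_space_std_gaussian)
  have "(\<integral>\<^sup>+z. growth h (\<bar>u \<bullet> z\<bar> + \<bar>t\<bar>) \<partial>std_gaussian)
      \<le> (\<integral>\<^sup>+z. growth h (\<bar>e \<bullet> z\<bar> + \<bar>t\<bar>) * ennreal (1 + (e \<bullet> z)\<^sup>2) \<partial>std_gaussian)"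
  proof (rule nn_integral_mono)
    fix z
    have "growth h (\<bar>u \<bullet> z\<bar> + \<bar>t\<bar>) \<le> growth h (\<bar>e \<bullet> z\<bar> + \<bar>t\<bar>) * 1"
      using u by (subst e(2)) (auto intro!: growth_mono simp: abs_mult mult_left_le_one_le)
    also have "\<dots> \<le> growth h (\<bar>e \<bullet> z\<bar> + \<bar>t\<bar>) * ennreal (1 + (e \<bullet> z)\<^sup>2)"
      by (intro mult_left_mono) (auto simp: ennreal_1[symmetric] simp del: ennreal_1 ennreal_plus intro!: ennreal_leI)
    finally show "growth h (\<bar>u \<bullet> z\<bar> + \<bar>t\<bar>) \<le> growth h (\<bar>e \<bullet> z\<bar> + \<bar>t\<bar>) * ennreal (1 + (e \<bullet> z)\<^sup>2)" .
  qed
  also have "\<dots> < \<infinity>" by (rule growth_inner_integrable[OF h _ e(1)]) simp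
  finally have "(\<integral>\<^sup>+Z. (\<Sum>i\<in>{1..m}. growth h (\<bar>u \<bullet> Z i\<bar> + \<bar>t\<bar>)) * (\<Prod>j\<in>{1..m}. 1) \<partial>gaussian_rows m) < \<infinity>"
    using G.emeasure_space_1 by (intro nn_integral_gaussian_rows_weighted) auto
  then have "(\<integral>\<^sup>+Z. ennreal \<bar>sample_loss m t xs h u Z\<bar> \<partial>gaussian_rows m) < \<infinity>"
    by (auto intro: le_less_trans[OF nn_integral_mono[OF sample_loss_le_growth[OF h m]]])
  then show "u \<in> loss_domain m t xs h"
    by (simp add: loss_domain_def integrable_iff_bounded)
qed

section \<open>Differentiability inside the unit ball by a change of measure\<close>

lemma exp_taylor1_bound:
  fixes l :: real
  shows "\<bar>exp l - 1 - l\<bar> \<le> l\<^sup>2 * exp \<bar>l\<bar>"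
proof -
  have lo: "exp l - 1 - l \<ge> 0" using exp_ge_add_one_self[of l] by linarith
  have "exp l - 1 - l \<le> l\<^sup>2 * exp \<bar>l\<bar>"
  proof (cases "l \<ge> 0")
    case True
    have "(1 - l) * exp l \<le> exp (- l) * exp l"
      using exp_ge_add_one_self[of "- l"] by (intro mult_right_mono) auto
    then have le: "exp l - 1 \<le> l * exp l" by (simp add: exp_minus algebra_simps)
    then have "l * (exp l - 1) \<le> l * (l * exp l)" using True by (rule mult_left_mono)
    then show ?thesis using True le by (simp add: power2_eq_square algebra_simps)
  next
    case False
    have "exp l * (1 - l) \<le> 1"
    proof -
      have "exp l * (1 - l) \<le> exp l * exp (- l)"
        using exp_ge_add_one_self[of "- l"] by (intro mult_left_mono) auto
      then show ?thesis by (simp add: exp_minus)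
    qed
    then have "exp l - 1 \<le> l * exp l" by (simp add: algebra_simps)
    then have "exp l - 1 - l \<le> l * (exp l - 1)" by (simp add: algebra_simps)
    also have "\<dots> = - l * (1 - exp l)" by (simp add: algebra_simps)
    also have "\<dots> \<le> - l * - l"
    proof (intro mult_left_mono)
      show "1 - exp l \<le> - l" using exp_ge_add_one_self[of l] by linarith
    qed (use False in simp)
    also have "\<dots> = l\<^sup>2 * 1" by (simp add: power2_eq_square)
    also have "\<dots> \<le> l\<^sup>2 * exp \<bar>l\<bar>" by (intro mult_left_mono) auto
    finally show ?thesis .
  qed
  with lo show ?thesis by simp
qed

text \<open>
  The logarithm of the density of the law of \<open>z + (w \<bullet> z) q\<close> with respect to that of \<open>z\<close>, for a
  standard Gaussian vector \<open>z\<close> and \<open>w \<bullet> q > - 1\<close>.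
\<close>

definition log_ratio :: "'a::euclidean_space \<Rightarrow> 'a \<Rightarrow> 'a \<Rightarrow> real" where
  "log_ratio q w z = - ln (1 + w \<bullet> q) + (w \<bullet> z) * (q \<bullet> z) / (1 + w \<bullet> q)
     - (w \<bullet> z)\<^sup>2 * (norm q)\<^sup>2 / (2 * (1 + w \<bullet> q)\<^sup>2)"

lemma log_ratio_linear_bound:
  fixes q w z :: "'a::euclidean_space"
  shows "\<bar>(w \<bullet> z) * (q \<bullet> z) - w \<bullet> q\<bar> \<le> norm w * norm q * (1 + (norm z)\<^sup>2)"
proof -
  have "\<bar>(w \<bullet> z) * (q \<bullet> z)\<bar> \<le> (norm w * norm z) * (norm q * norm z)"
    unfolding abs_mult by (intro mult_mono Cauchy_Schwarz_ineq2) auto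
  moreover have "\<bar>w \<bullet> q\<bar> \<le> norm w * norm q" by (rule Cauchy_Schwarz_ineq2)
  ultimately show ?thesis by (simp add: power2_eq_square algebra_simps)
qed

lemma log_ratio_bound:
  fixes q w z :: "'a::euclidean_space"
  assumes wq: "norm w * norm q \<le> 1/2"
  shows "\<bar>log_ratio q w z - ((w \<bullet> z) * (q \<bullet> z) - w \<bullet> q)\<bar> \<le> 4 * (norm w * norm q)\<^sup>2 * (1 + (norm z)\<^sup>2)"
proof -
  define \<beta> a c where "\<beta> = w \<bullet> q" "a = w \<bullet> z" "c = q \<bullet> z"
  note d = \<beta>_a_c_def
  let ?K = "norm w * norm q" and ?n = "norm z"
  have b: "\<bar>\<beta>\<bar> \<le> ?K" unfolding d by (rule Cauchy_Schwarz_ineq2)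
  then have b2: "\<bar>\<beta>\<bar> \<le> 1/2" using wq by linarith
  then have b1: "1 + \<beta> \<ge> 1/2" by linarith
  have a: "\<bar>a\<bar> \<le> norm w * ?n" unfolding d by (rule Cauchy_Schwarz_ineq2)
  have c: "\<bar>c\<bar> \<le> norm q * ?n" unfolding d by (rule Cauchy_Schwarz_ineq2)
  have "\<bar>a * c\<bar> \<le> (norm w * ?n) * (norm q * ?n)"
    unfolding abs_mult using a c by (intro mult_mono) auto
  then have ac: "\<bar>a * c\<bar> \<le> ?K * ?n\<^sup>2" by (simp add: power2_eq_square mult_ac)
  have t1: "\<bar>- ln (1 + \<beta>) + \<beta>\<bar> \<le> 2 * ?K\<^sup>2"
  proof -
    have "\<bar>ln (1 + \<beta>) - \<beta>\<bar> \<le> 2 * \<beta>\<^sup>2" using b2 by (rule abs_ln_one_plus_x_minus_x_bound)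
    also have "\<beta>\<^sup>2 \<le> ?K\<^sup>2" using b by (simp add: abs_le_square_iff[symmetric])
    finally show ?thesis by simp
  qed
  have t2: "\<bar>a * c / (1 + \<beta>) - a * c\<bar> \<le> 2 * ?K\<^sup>2 * ?n\<^sup>2"
  proof -
    have "a * c / (1 + \<beta>) - a * c = (a * c) * (- \<beta> / (1 + \<beta>))"
      using b1 by (simp add: field_simps)
    then have "\<bar>a * c / (1 + \<beta>) - a * c\<bar> = \<bar>a * c\<bar> * (\<bar>\<beta>\<bar> / (1 + \<beta>))"
      using b1 by (simp add: abs_mult)
    also have "\<dots> \<le> (?K * ?n\<^sup>2) * (?K / (1/2))"
      using b1 b ac by (intro mult_mono frac_le) auto
    finally show ?thesis by (simp add: power2_eq_square mult_ac)
  qed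
  have t3: "\<bar>a\<^sup>2 * (norm q)\<^sup>2 / (2 * (1 + \<beta>)\<^sup>2)\<bar> \<le> 2 * ?K\<^sup>2 * ?n\<^sup>2"
  proof -
    have "a\<^sup>2 \<le> (norm w * ?n)\<^sup>2" using a by (metis abs_ge_zero power2_abs power_mono)
    moreover have "(1/2)\<^sup>2 \<le> (1 + \<beta>)\<^sup>2" using b1 by (intro power_mono) auto
    then have "1/2 \<le> 2 * (1 + \<beta>)\<^sup>2" by (simp add: power2_eq_square)
    ultimately have "a\<^sup>2 * (norm q)\<^sup>2 / (2 * (1 + \<beta>)\<^sup>2) \<le> (norm w * ?n)\<^sup>2 * (norm q)\<^sup>2 / (1/2)"
      by (intro frac_le mult_right_mono) auto
    then show ?thesis by (simp add: power_mult_distrib mult_ac)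
  qed
  have "log_ratio q w z - (a * c - \<beta>) = (- ln (1 + \<beta>) + \<beta>) + (a * c / (1 + \<beta>) - a * c) - a\<^sup>2 * (norm q)\<^sup>2 / (2 * (1 + \<beta>)\<^sup>2)"
    by (simp add: log_ratio_def d)
  then have "\<bar>log_ratio q w z - (a * c - \<beta>)\<bar> \<le> 2 * ?K\<^sup>2 + 2 * ?K\<^sup>2 * ?n\<^sup>2 + 2 * ?K\<^sup>2 * ?n\<^sup>2"
    using t1 t2 t3 by linarith
  also have "\<dots> \<le> 4 * ?K\<^sup>2 * (1 + ?n\<^sup>2)" by (simp add: algebra_simps)
  finally show ?thesis by (simp add: d)
qed

text \<open>
  The Taylor expansion of the likelihood ratio of the rows at \<open>w = 0\<close>. The error is quadratic in
  \<open>w\<close>; its dependence on \<open>Z\<close> is an exponential weight with an arbitrarily small \<open>\<epsilon>\<close>.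
\<close>

lemma exp_log_ratio_sum_bound:
  fixes q w :: "'a::euclidean_space" and Z :: "'i \<Rightarrow> 'a" and I :: "'i set"
  assumes \<epsilon>: "0 < \<epsilon>" and wq: "norm w * norm q \<le> 1/2" "norm w * norm q \<le> \<epsilon> / 6"
  defines "M \<equiv> \<Sum>i\<in>I. 1 + (norm (Z i))\<^sup>2"
  shows "\<bar>exp (\<Sum>i\<in>I. log_ratio q w (Z i)) - 1 - (\<Sum>i\<in>I. (w \<bullet> Z i) * (q \<bullet> Z i) - w \<bullet> q)\<bar>
     \<le> (norm w)\<^sup>2 * ((norm q)\<^sup>2 * (144 / \<epsilon>\<^sup>2 + 4 / \<epsilon>)) * exp (\<epsilon> * M)"
proof -
  let ?l = "\<Sum>i\<in>I. log_ratio q w (Z i)" and ?g = "\<Sum>i\<in>I. (w \<bullet> Z i) * (q \<bullet> Z i) - w \<bullet> q"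
  let ?K = "norm w * norm q"
  have M0: "0 \<le> M" unfolding M_def by (intro sum_nonneg) (simp add: add_nonneg_nonneg)
  have "\<bar>?l - ?g\<bar> \<le> (\<Sum>i\<in>I. \<bar>log_ratio q w (Z i) - ((w \<bullet> Z i) * (q \<bullet> Z i) - w \<bullet> q)\<bar>)"
    unfolding sum_subtractf[symmetric] by (rule sum_abs)
  also have "\<dots> \<le> (\<Sum>i\<in>I. 4 * ?K\<^sup>2 * (1 + (norm (Z i))\<^sup>2))"
    by (intro sum_mono log_ratio_bound wq)
  finally have lg: "\<bar>?l - ?g\<bar> \<le> 4 * ?K\<^sup>2 * M" by (simp add: M_def sum_distrib_left)
  have "\<bar>?g\<bar> \<le> (\<Sum>i\<in>I. \<bar>(w \<bullet> Z i) * (q \<bullet> Z i) - w \<bullet> q\<bar>)" by (rule sum_abs)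
  also have "\<dots> \<le> (\<Sum>i\<in>I. ?K * (1 + (norm (Z i))\<^sup>2))"
    by (intro sum_mono log_ratio_linear_bound)
  finally have g: "\<bar>?g\<bar> \<le> ?K * M" by (simp add: M_def sum_distrib_left)
  have "4 * ?K\<^sup>2 * M = (4 * ?K) * (?K * M)" by (simp add: power2_eq_square)
  also have "\<dots> \<le> 2 * (?K * M)"
  proof (intro mult_right_mono)
    show "4 * ?K \<le> 2" using wq(1) by linarith
  qed (use M0 in simp)
  finally have l: "\<bar>?l\<bar> \<le> 3 * (?K * M)" using lg g by linarith
  also have "3 * (?K * M) \<le> 3 * (\<epsilon> / 6 * M)" using wq(2) M0 by (intro mult_left_mono mult_right_mono) auto
  finally have le: "\<bar>?l\<bar> \<le> \<epsilon> / 2 * M" by (simp add: mult.commute)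
  have M1: "M \<le> 4 / \<epsilon> * exp (\<epsilon> / 4 * M)"
  proof -
    have "\<epsilon> / 4 * M \<le> exp (\<epsilon> / 4 * M)" using exp_ge_add_one_self[of "\<epsilon> / 4 * M"] by linarith
    then show ?thesis using \<epsilon> by (simp add: field_simps)
  qed
  have M1': "M \<le> 1 / \<epsilon> * exp (\<epsilon> * M)"
  proof -
    have "\<epsilon> * M \<le> exp (\<epsilon> * M)" using exp_ge_add_one_self[of "\<epsilon> * M"] by linarith
    then show ?thesis using \<epsilon> by (simp add: field_simps)
  qed
  have "(M)\<^sup>2 \<le> (4 / \<epsilon> * exp (\<epsilon> / 4 * M))\<^sup>2" using M0 M1 by (intro power_mono) auto
  also have "\<dots> = 16 / \<epsilon>\<^sup>2 * exp (\<epsilon> / 2 * M)"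
    by (simp add: power_mult_distrib power_divide exp_double[symmetric])
  finally have M2: "(M)\<^sup>2 \<le> 16 / \<epsilon>\<^sup>2 * exp (\<epsilon> / 2 * M)" .
  have "\<bar>exp ?l - 1 - ?l\<bar> \<le> ?l\<^sup>2 * exp \<bar>?l\<bar>" by (rule exp_taylor1_bound)
  also have "\<dots> \<le> (3 * (?K * M))\<^sup>2 * exp (\<epsilon> / 2 * M)"
  proof (intro mult_mono)
    show "?l\<^sup>2 \<le> (3 * (?K * M))\<^sup>2" using l by (metis abs_ge_zero power2_abs power_mono)
  qed (use le in auto)
  also have "\<dots> = 9 * ?K\<^sup>2 * (M)\<^sup>2 * exp (\<epsilon> / 2 * M)" by (simp add: power_mult_distrib)
  also have "\<dots> \<le> 9 * ?K\<^sup>2 * (16 / \<epsilon>\<^sup>2 * exp (\<epsilon> / 2 * M)) * exp (\<epsilon> / 2 * M)"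
    using M2 by (intro mult_right_mono mult_left_mono) auto
  also have "\<dots> = ?K\<^sup>2 * (144 / \<epsilon>\<^sup>2) * exp (\<epsilon> * M)"
    by (simp add: exp_add[symmetric] mult.assoc)
  finally have A: "\<bar>exp ?l - 1 - ?l\<bar> \<le> ?K\<^sup>2 * (144 / \<epsilon>\<^sup>2) * exp (\<epsilon> * M)" .
  have "4 * ?K\<^sup>2 * M \<le> 4 * ?K\<^sup>2 * (1 / \<epsilon> * exp (\<epsilon> * M))"
    using M1' by (intro mult_left_mono) auto
  then have B: "\<bar>?l - ?g\<bar> \<le> ?K\<^sup>2 * (4 / \<epsilon>) * exp (\<epsilon> * M)" using lg by (simp add: mult_ac)
  have "\<bar>exp ?l - 1 - ?g\<bar> \<le> \<bar>exp ?l - 1 - ?l\<bar> + \<bar>?l - ?g\<bar>" by linarith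
  also have "\<dots> \<le> ?K\<^sup>2 * (144 / \<epsilon>\<^sup>2) * exp (\<epsilon> * M) + ?K\<^sup>2 * (4 / \<epsilon>) * exp (\<epsilon> * M)"
    using A B by linarith
  also have "\<dots> = (norm w)\<^sup>2 * ((norm q)\<^sup>2 * (144 / \<epsilon>\<^sup>2 + 4 / \<epsilon>)) * exp (\<epsilon> * M)"
    by (simp add: power_mult_distrib algebra_simps)
  finally show ?thesis .
qed

lemma distr_std_gaussian_rank_one:
  fixes q w :: "real ^ 'd::finite"
  assumes wq: "norm w * norm q \<le> 1/2"
  shows "distr std_gaussian borel (\<lambda>z. z + (w \<bullet> z) *\<^sub>R q)
    = density std_gaussian (\<lambda>z. ennreal (exp (log_ratio q w z)))"
proof -
  let ?A = "\<lambda>z. z + (w \<bullet> z) *\<^sub>R q"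
  let ?B = "\<lambda>z. z - ((w \<bullet> z) / (1 + w \<bullet> q)) *\<^sub>R q"
  have "\<bar>w \<bullet> q\<bar> \<le> 1/2" using wq Cauchy_Schwarz_ineq2[of w q] by linarith
  then have b: "1 + w \<bullet> q > 0" by linarith
  have lin: "linear ?A" "linear ?B"
    by (auto intro!: linearI simp: algebra_simps inner_add_right add_divide_distrib)
  have AB: "?A (?B z) = z" for z
  proof -
    have "?A (?B z) = z + ((w \<bullet> z) - (w \<bullet> z) / (1 + w \<bullet> q) * (w \<bullet> q) - (w \<bullet> z) / (1 + w \<bullet> q)) *\<^sub>R q"
      by (simp add: inner_diff_right algebra_simps)
    also have "(w \<bullet> z) - (w \<bullet> z) / (1 + w \<bullet> q) * (w \<bullet> q) - (w \<bullet> z) / (1 + w \<bullet> q) = 0"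
      using b by (simp add: field_simps)
    finally show ?thesis by simp
  qed
  have BA: "?B (?A z) = z" for z
  proof -
    have "w \<bullet> ?A z / (1 + w \<bullet> q) = w \<bullet> z"
      using b by (simp add: inner_add_right field_simps)
    then show ?thesis by simp
  qed
  have "1 / \<bar>det (matrix ?A)\<bar> * exp (((norm z)\<^sup>2 - (norm (?B z))\<^sup>2) / 2) = exp (log_ratio q w z)" for z
  proof -
    let ?a = "(w \<bullet> z) / (1 + w \<bullet> q)"
    have "(norm (?B z))\<^sup>2 = (norm z)\<^sup>2 - 2 * ?a * (q \<bullet> z) + ?a\<^sup>2 * (norm q)\<^sup>2"
      unfolding power2_norm_eq_inner
      by (simp add: inner_diff_left inner_diff_right inner_commute power2_eq_square algebra_simps)
    then have "((norm z)\<^sup>2 - (norm (?B z))\<^sup>2) / 2 = ?a * (q \<bullet> z) - ?a\<^sup>2 * (norm q)\<^sup>2 / 2" by simp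
    moreover have "1 / \<bar>det (matrix ?A)\<bar> = exp (- ln (1 + w \<bullet> q))"
      using b by (simp add: det_rank_one exp_minus inverse_eq_divide)
    ultimately have "1 / \<bar>det (matrix ?A)\<bar> * exp (((norm z)\<^sup>2 - (norm (?B z))\<^sup>2) / 2)
       = exp (- ln (1 + w \<bullet> q) + (?a * (q \<bullet> z) - ?a\<^sup>2 * (norm q)\<^sup>2 / 2))"
      by (simp only: exp_add)
    also have "- ln (1 + w \<bullet> q) + (?a * (q \<bullet> z) - ?a\<^sup>2 * (norm q)\<^sup>2 / 2) = log_ratio q w z"
      by (simp add: log_ratio_def power_divide)
    finally show ?thesis .
  qed
  then show ?thesis
    using distr_std_gaussian_linear[OF lin AB BA] by simp
qed

text \<open>
  The conditions on \<open>q\<close> mean that mapping the rows by \<open>z \<mapsto> z + (w \<bullet> z) q\<close> turns the score of \<open>u\<close>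
  into that of \<open>u + w\<close> and leaves the label unchanged.
\<close>

lemma expected_loss_shift:
  fixes q w u xs :: "real ^ 'd::finite"
  assumes h [measurable]: "h \<in> borel_measurable borel" and wq: "norm w * norm q \<le> 1/2"
    and q: "q \<bullet> u = 1" "q \<bullet> xs = 0"
  shows "expected_loss m t xs h (u + w)
    = (\<integral>Z. exp (\<Sum>i\<in>{1..m}. log_ratio q w (Z i)) * sample_loss m t xs h u Z \<partial>gaussian_rows m)"
proof -
  let ?A = "\<lambda>z. z + (w \<bullet> z) *\<^sub>R q"
  have [measurable]: "log_ratio q w \<in> borel_measurable borel"
    unfolding log_ratio_def[abs_def] by measurable
  have dist: "distr (gaussian_rows m) (gaussian_rows m) (rowmap m ?A)
    = density (gaussian_rows m) (\<lambda>Z. \<Prod>i\<in>{1..m}. ennreal (exp (log_ratio q w (Z i))))"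
    by (rule distr_gaussian_rows_density[OF _ _ distr_std_gaussian_rank_one[OF wq]]) measurable
  have "sample_loss m t xs h (u + w) Z = sample_loss m t xs h u (rowmap m ?A Z)" for Z
    by (rule sample_loss_rowmap[symmetric])
       (use q in \<open>auto simp: inner_add_right inner_add_left inner_commute\<close>)
  then have "expected_loss m t xs h (u + w)
     = (\<integral>Z. sample_loss m t xs h u (rowmap m ?A Z) \<partial>gaussian_rows m)"
    by (simp add: expected_loss_def)
  also have "\<dots> = (\<integral>Z. sample_loss m t xs h u Z \<partial>distr (gaussian_rows m) (gaussian_rows m) (rowmap m ?A))"
    by (rule integral_distr[symmetric]) measurable
  also have "\<dots> = (\<integral>Z. sample_loss m t xs h u Z \<partial>density (gaussian_rows m) (\<lambda>Z. ennreal (exp (\<Sum>i\<in>{1..m}. log_ratio q w (Z i)))))"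
    unfolding dist by (simp add: prod_ennreal exp_sum)
  also have "\<dots> = (\<integral>Z. exp (\<Sum>i\<in>{1..m}. log_ratio q w (Z i)) *\<^sub>R sample_loss m t xs h u Z \<partial>gaussian_rows m)"
    by (rule integral_density) auto
  finally show ?thesis by simp
qed

lemma has_derivative_quadratic_bound:
  fixes f :: "'a::real_normed_vector \<Rightarrow> real"
  assumes "bounded_linear f'" "0 < \<delta>"
    and "\<And>w. norm w \<le> \<delta> \<Longrightarrow> \<bar>f (u + w) - f u - f' w\<bar> \<le> K * (norm w)\<^sup>2"
  shows "(f has_derivative f') (at u)"
  unfolding has_derivative_at
proof (intro conjI assms(1))
  show "(\<lambda>w. norm (f (u + w) - f u - f' w) / norm w) \<midarrow>0\<rightarrow> 0"
  proof (rule tendsto_sandwich)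
    show "\<forall>\<^sub>F w in at 0. 0 \<le> norm (f (u + w) - f u - f' w) / norm w" by simp
    show "\<forall>\<^sub>F w in at 0. norm (f (u + w) - f u - f' w) / norm w \<le> K * norm w"
      unfolding eventually_at
    proof (intro exI[of _ \<delta>] conjI ballI impI assms(2))
      fix w :: 'a assume w: "w \<noteq> 0 \<and> dist w 0 < \<delta>"
      then have "norm (f (u + w) - f u - f' w) \<le> K * (norm w)\<^sup>2" using assms(3)[of w] by simp
      then show "norm (f (u + w) - f u - f' w) / norm w \<le> K * norm w"
        using w by (simp add: divide_le_eq power2_eq_square mult.assoc)
    qed
    show "(\<lambda>w. K * norm w) \<midarrow>0\<rightarrow> 0" by (auto intro!: tendsto_eq_intros)
  qed simp
qed

lemma sum_le_card_prod:
  fixes f :: "'i \<Rightarrow> real"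
  assumes "finite I" "\<And>i. i \<in> I \<Longrightarrow> 1 \<le> f i"
  shows "(\<Sum>i\<in>I. f i) \<le> real (card I) * (\<Prod>i\<in>I. f i)"
proof -
  have "f i \<le> (\<Prod>i\<in>I. f i)" if i: "i \<in> I" for i
  proof -
    have "f i * 1 \<le> f i * (\<Prod>i\<in>I - {i}. f i)"
      using assms(2) i by (intro mult_left_mono prod_ge_1) (auto intro: order_trans[OF zero_le_one])
    then show ?thesis using prod.remove[OF assms(1) i, of f] by simp
  qed
  then have "(\<Sum>i\<in>I. f i) \<le> (\<Sum>i\<in>I. \<Prod>i\<in>I. f i)" by (rule sum_mono)
  then show ?thesis by simp
qed

lemma integrable_of_growth_bound:
  fixes L W :: "(nat \<Rightarrow> real ^ 'd::finite) \<Rightarrow> real" and \<Phi> :: "real ^ 'd \<Rightarrow> ennreal" and \<psi> :: "real ^ 'd \<Rightarrow> real"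
  assumes [measurable]: "L \<in> borel_measurable (gaussian_rows m)" "W \<in> borel_measurable (gaussian_rows m)"
      "\<Phi> \<in> borel_measurable borel" "\<psi> \<in> borel_measurable borel"
    and L: "\<And>Z. ennreal \<bar>L Z\<bar> \<le> (\<Sum>i\<in>{1..m}. \<Phi> (Z i))"
    and W: "\<And>Z. \<bar>W Z\<bar> \<le> c * (\<Prod>j\<in>{1..m}. \<psi> (Z j))" and c: "0 \<le> c" and \<psi>: "\<And>z. 0 \<le> \<psi> z"
    and fin: "(\<integral>\<^sup>+z. \<Phi> z * ennreal (\<psi> z) \<partial>std_gaussian) < \<infinity>" "(\<integral>\<^sup>+z. ennreal (\<psi> z) \<partial>std_gaussian) < \<infinity>"
  shows "integrable (gaussian_rows m) (\<lambda>Z. L Z * W Z)"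
    and "(\<integral>Z. \<bar>L Z * W Z\<bar> \<partial>gaussian_rows m)
      \<le> enn2real (ennreal c * (\<integral>\<^sup>+Z. (\<Sum>i\<in>{1..m}. \<Phi> (Z i)) * (\<Prod>j\<in>{1..m}. ennreal (\<psi> (Z j))) \<partial>gaussian_rows m))"
proof -
  let ?P = "\<lambda>Z. (\<Sum>i\<in>{1..m}. \<Phi> (Z i)) * (\<Prod>j\<in>{1..m}. ennreal (\<psi> (Z j)))"
  let ?J = "\<integral>\<^sup>+Z. ?P Z \<partial>gaussian_rows m"
  have J: "?J < \<infinity>" by (rule nn_integral_gaussian_rows_weighted) (use fin in auto)
  have "(\<integral>\<^sup>+Z. ennreal \<bar>L Z * W Z\<bar> \<partial>gaussian_rows m)
     \<le> (\<integral>\<^sup>+Z. ennreal c * (?P Z) \<partial>gaussian_rows m)"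
  proof (rule nn_integral_mono)
    fix Z
    have "ennreal \<bar>L Z * W Z\<bar> = ennreal \<bar>L Z\<bar> * ennreal \<bar>W Z\<bar>" by (simp add: abs_mult ennreal_mult)
    also have "\<dots> \<le> (\<Sum>i\<in>{1..m}. \<Phi> (Z i)) * ennreal (c * (\<Prod>j\<in>{1..m}. \<psi> (Z j)))"
      by (intro mult_mono L ennreal_leI W) auto
    also have "ennreal (c * (\<Prod>j\<in>{1..m}. \<psi> (Z j))) = ennreal c * (\<Prod>j\<in>{1..m}. ennreal (\<psi> (Z j)))"
      using c \<psi> by (simp add: ennreal_mult prod_nonneg prod_ennreal)
    finally show "ennreal \<bar>L Z * W Z\<bar> \<le> ennreal c * (?P Z)"
      by (simp only: mult_ac)
  qed
  also have "\<dots> = ennreal c * ?J" by (rule nn_integral_cmult) measurable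
  finally have le: "(\<integral>\<^sup>+Z. ennreal \<bar>L Z * W Z\<bar> \<partial>gaussian_rows m) \<le> ennreal c * ?J" .
  have cJ: "ennreal c * ?J < top" using J by (simp add: ennreal_mult_less_top)
  show "integrable (gaussian_rows m) (\<lambda>Z. L Z * W Z)"
    using le_less_trans[OF le cJ] by (simp add: integrable_iff_bounded)
  show "(\<integral>Z. \<bar>L Z * W Z\<bar> \<partial>gaussian_rows m) \<le> enn2real (ennreal c * ?J)"
    using enn2real_mono[OF le cJ] by (subst integral_eq_nn_integral) auto
qed

text \<open>
  The derivative of the log-likelihood ratio of the rows with respect to \<open>w\<close> at \<open>w = 0\<close>.
\<close>

definition score :: "nat \<Rightarrow> 'a::euclidean_space \<Rightarrow> (nat \<Rightarrow> 'a) \<Rightarrow> 'a" where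
  "score m q Z = (\<Sum>i\<in>{1..m}. (q \<bullet> Z i) *\<^sub>R Z i - q)"

lemma inner_score: "w \<bullet> score m q Z = (\<Sum>i\<in>{1..m}. (w \<bullet> Z i) * (q \<bullet> Z i) - w \<bullet> q)"
  by (simp add: score_def inner_sum_right inner_diff_right mult.commute)

lemma norm_score_le: "norm (score m q Z) \<le> norm q * (\<Sum>i\<in>{1..m}. 1 + (norm (Z i))\<^sup>2)"
proof -
  have "norm ((q \<bullet> z) *\<^sub>R z - q) \<le> norm q * (1 + (norm z)\<^sup>2)" for z
  proof -
    have "norm ((q \<bullet> z) *\<^sub>R z - q) \<le> \<bar>q \<bullet> z\<bar> * norm z + norm q"
      using norm_triangle_ineq4[of "(q \<bullet> z) *\<^sub>R z" q] by simp
    also have "\<bar>q \<bullet> z\<bar> * norm z \<le> (norm q * norm z) * norm z"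
      by (intro mult_right_mono Cauchy_Schwarz_ineq2) auto
    finally show ?thesis by (simp add: power2_eq_square algebra_simps)
  qed
  then have "norm (score m q Z) \<le> (\<Sum>i\<in>{1..m}. norm q * (1 + (norm (Z i))\<^sup>2))"
    unfolding score_def by (intro order_trans[OF norm_sum] sum_mono) auto
  then show ?thesis by (simp add: sum_distrib_left)
qed

text \<open>
  The constant \<open>K\<close> does not depend on \<open>r\<close>; this is what survives the limit \<open>r \<rightarrow> 1\<close>.
\<close>

proposition expected_loss_differentiable:
  fixes x xs :: "real ^ 'd::finite"
  assumes h: "h \<in> H_plus" and m: "m \<ge> 1" and x: "norm x = 1"
  obtains K where "\<And>r q. 0 < r \<Longrightarrow> r < 1 \<Longrightarrow> q \<bullet> (r *\<^sub>R x) = 1 \<Longrightarrow> q \<bullet> xs = 0 \<Longrightarrow>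
    \<exists>G. GDERIV (expected_loss m t xs h) (r *\<^sub>R x) :> G \<and> norm G \<le> norm q * K"
proof -
  let ?R = "gaussian_rows m :: (nat \<Rightarrow> real ^ 'd) measure"
  note H_plus_measurable[OF h, measurable]
  define M :: "(nat \<Rightarrow> real ^ 'd) \<Rightarrow> real" where "M Z = (\<Sum>i\<in>{1..m}. 1 + (norm (Z i))\<^sup>2)" for Z
  have Mm [measurable]: "M \<in> borel_measurable ?R" unfolding M_def[abs_def] by measurable
  have M0: "0 \<le> M Z" for Z unfolding M_def by (intro sum_nonneg) (simp add: add_nonneg_nonneg)
  have MP: "\<bar>M Z\<bar> \<le> real m * (\<Prod>j\<in>{1..m}. 1 + (norm (Z j))\<^sup>2)" for Z
    using sum_le_card_prod[of "{1..m}" "\<lambda>j. 1 + (norm (Z j))\<^sup>2"] M0[of Z] by (simp add: M_def)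
  let ?\<Phi> = "\<lambda>z. growth h (\<bar>x \<bullet> z\<bar> + \<bar>t\<bar>)"
  define K where "K = enn2real (ennreal (real m) * (\<integral>\<^sup>+Z. (\<Sum>i\<in>{1..m}. ?\<Phi> (Z i)) * (\<Prod>j\<in>{1..m}. ennreal (1 + (norm (Z j))\<^sup>2)) \<partial>?R))"
  have fin1: "(\<integral>\<^sup>+z. ?\<Phi> z * ennreal (1 + (norm z)\<^sup>2) \<partial>std_gaussian) < \<infinity>"
    by (rule growth_norm_integrable[OF h _ x]) simp
  have fin2: "(\<integral>\<^sup>+z. ennreal (1 + (norm (z :: real ^ 'd))\<^sup>2) \<partial>std_gaussian) < \<infinity>"
  proof -
    have "(\<integral>\<^sup>+z. ennreal (1 + (norm (z :: real ^ 'd))\<^sup>2) \<partial>std_gaussian)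
      \<le> (\<integral>\<^sup>+z. ennreal (exp ((1 - (1/2)\<^sup>2) / 2 * (norm (z :: real ^ 'd))\<^sup>2)) * 3 \<partial>std_gaussian)"
    proof (rule nn_integral_mono)
      fix z :: "real ^ 'd"
      have "1 + (norm z)\<^sup>2 \<le> exp ((1 - (1/2)\<^sup>2) / 2 * (norm z)\<^sup>2) * 3"
      proof -
        have e: "(1 - (1/2)\<^sup>2) / 2 = (3/8 :: real)" by (simp add: power2_eq_square)
        show ?thesis
          unfolding e using exp_ge_add_one_self[of "3/8 * (norm z)\<^sup>2"] zero_le_power2[of "norm z"] by linarith
      qed
      from ennreal_leI[OF this] show "ennreal (1 + (norm z)\<^sup>2) \<le> ennreal (exp ((1 - (1/2)\<^sup>2) / 2 * (norm z)\<^sup>2)) * 3"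
        by (simp add: ennreal_mult del: ennreal_plus)
    qed
    also have "\<dots> < \<infinity>"
      using std_gaussian_exp_norm_integrable(2)[OF h _ x, of 0 "1/2"]
      by (subst nn_integral_multc) (auto simp: ennreal_mult_less_top)
    finally show ?thesis .
  qed
  have "\<exists>G. GDERIV (expected_loss m t xs h) (r *\<^sub>R x) :> G \<and> norm G \<le> norm q * K"
    if r: "0 < r" "r < 1" and q: "q \<bullet> (r *\<^sub>R x) = 1" "q \<bullet> xs = 0" for r and q :: "real ^ 'd"
  proof -
    let ?u = "r *\<^sub>R x" and ?f = "expected_loss m t xs h"
    define L where "L = sample_loss m t xs h ?u"
    have Lm [measurable]: "L \<in> borel_measurable ?R" unfolding L_def by measurable
    have sm [measurable]: "score m q \<in> borel_measurable ?R"
      unfolding score_def[abs_def] by measurable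
    have lm [measurable]: "log_ratio q w \<in> borel_measurable borel" for w
      unfolding log_ratio_def[abs_def] by measurable
    have Lg: "ennreal \<bar>L Z\<bar> \<le> (\<Sum>i\<in>{1..m}. growth h (\<bar>?u \<bullet> Z i\<bar> + \<bar>t\<bar>))" for Z
      unfolding L_def by (rule sample_loss_le_growth[OF h m])
    have L\<Phi>: "ennreal \<bar>L Z\<bar> \<le> (\<Sum>i\<in>{1..m}. ?\<Phi> (Z i))" for Z
      by (rule order_trans[OF Lg]) (use r in \<open>auto intro!: sum_mono growth_mono simp: abs_mult mult_left_le_one_le\<close>)
    have LM: "integrable ?R (\<lambda>Z. L Z * M Z)"
      "(\<integral>Z. \<bar>L Z * M Z\<bar> \<partial>?R) \<le> K"
      unfolding K_def
      by (rule integrable_of_growth_bound[OF Lm Mm _ _ L\<Phi> MP _ _ fin1 fin2]; measurable; simp)+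
    have Li: "integrable ?R L"
      using cball_subset_loss_domain[OF h m, of t xs] r x by (auto simp: L_def loss_domain_def subset_eq)
    define \<epsilon> where "\<epsilon> = (1 - r\<^sup>2) / 2"
    have "r\<^sup>2 < 1" using r by (simp add: power_less_one_iff abs_square_less_1)
    then have \<epsilon>: "\<epsilon> > 0" by (simp add: \<epsilon>_def)
    \<comment> \<open>The weight that controls the Taylor remainder; its size depends on \<open>r\<close>, but only differentiability uses it.\<close>
    have LE: "integrable ?R (\<lambda>Z. L Z * exp (\<epsilon> * M Z))"
    proof (rule integrable_of_growth_bound(1)[where c = 1 and \<psi> = "\<lambda>z. exp (\<epsilon> * (1 + (norm z)\<^sup>2))" and \<Phi> = "\<lambda>z. growth h (\<bar>?u \<bullet> z\<bar> + \<bar>t\<bar>)"])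
      have ex: "ennreal (exp (\<epsilon> * (1 + (norm z)\<^sup>2))) = ennreal (exp (\<epsilon> * (norm z)\<^sup>2)) * ennreal (exp \<epsilon>)" for z :: "real ^ 'd"
        by (simp add: ennreal_mult[symmetric] exp_add[symmetric] algebra_simps)
      note fin = std_gaussian_exp_norm_integrable[OF h _ x r, of "\<bar>t\<bar>", folded \<epsilon>_def]
      show "(\<integral>\<^sup>+z. growth h (\<bar>?u \<bullet> z\<bar> + \<bar>t\<bar>) * ennreal (exp (\<epsilon> * (1 + (norm z)\<^sup>2))) \<partial>std_gaussian) < \<infinity>"
        unfolding ex mult.assoc[symmetric] using fin(1) by (subst nn_integral_multc) (auto simp: ennreal_mult_less_top)
      show "(\<integral>\<^sup>+z. ennreal (exp (\<epsilon> * (1 + (norm (z :: real ^ 'd))\<^sup>2))) \<partial>std_gaussian) < \<infinity>"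
        unfolding ex using fin(2) by (subst nn_integral_multc) (auto simp: ennreal_mult_less_top)
      show "\<bar>exp (\<epsilon> * M Z)\<bar> \<le> 1 * (\<Prod>j\<in>{1..m}. exp (\<epsilon> * (1 + (norm (Z j))\<^sup>2)))" for Z
        by (simp add: M_def exp_sum[symmetric] sum_distrib_left)
    qed (use Lg in auto)
    have LS: "integrable ?R (\<lambda>Z. L Z *\<^sub>R score m q Z)"
    proof (rule Bochner_Integration.integrable_bound)
      show "integrable ?R (\<lambda>Z. norm q * (L Z * M Z))" using LM(1) by simp
      show "AE Z in ?R. norm (L Z *\<^sub>R score m q Z) \<le> norm (norm q * (L Z * M Z))"
      proof (rule AE_I2)
        fix Z
        have "\<bar>L Z\<bar> * norm (score m q Z) \<le> \<bar>L Z\<bar> * (norm q * M Z)"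
          unfolding M_def by (intro mult_left_mono norm_score_le) simp
        then show "norm (L Z *\<^sub>R score m q Z) \<le> norm (norm q * (L Z * M Z))"
          using M0[of Z] by (simp add: abs_mult mult_ac)
      qed
    qed measurable
    define G where "G = (\<integral>Z. L Z *\<^sub>R score m q Z \<partial>?R)"
    have "norm G \<le> (\<integral>Z. norm (L Z *\<^sub>R score m q Z) \<partial>?R)"
      unfolding G_def by (rule integral_norm_bound)
    also have "\<dots> \<le> (\<integral>Z. norm q * \<bar>L Z * M Z\<bar> \<partial>?R)"
    proof (rule integral_mono)
      show "integrable ?R (\<lambda>Z. norm (L Z *\<^sub>R score m q Z))" using LS by (rule integrable_norm)
      show "integrable ?R (\<lambda>Z. norm q * \<bar>L Z * M Z\<bar>)"
        using LM(1) by (intro integrable_mult_right integrable_abs)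
      fix Z
      have "\<bar>L Z\<bar> * norm (score m q Z) \<le> \<bar>L Z\<bar> * (norm q * M Z)"
        unfolding M_def by (intro mult_left_mono norm_score_le) simp
      then show "norm (L Z *\<^sub>R score m q Z) \<le> norm q * \<bar>L Z * M Z\<bar>"
        using M0[of Z] by (simp add: abs_mult mult_ac)
    qed
    also have "\<dots> = norm q * (\<integral>Z. \<bar>L Z * M Z\<bar> \<partial>?R)" by simp
    also have "\<dots> \<le> norm q * K" using LM(2) by (intro mult_left_mono) auto
    finally have nG: "norm G \<le> norm q * K" .
    have q0: "norm q > 0" using q(1) by auto
    define \<delta> where "\<delta> = min (1/2) (\<epsilon> / 6) / norm q"
    have \<delta>: "\<delta> > 0" using q0 \<epsilon> by (simp add: \<delta>_def)
    define C where "C = (norm q)\<^sup>2 * (144 / \<epsilon>\<^sup>2 + 4 / \<epsilon>)"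
    have err: "\<bar>?f (?u + w) - ?f ?u - w \<bullet> G\<bar> \<le> (C * (\<integral>Z. \<bar>L Z * exp (\<epsilon> * M Z)\<bar> \<partial>?R)) * (norm w)\<^sup>2"
      if w: "norm w \<le> \<delta>" for w
    proof -
      have "norm w * norm q \<le> \<delta> * norm q" using w by (intro mult_right_mono) auto
      also have "\<delta> * norm q = min (1/2) (\<epsilon> / 6)" using q0 by (simp add: \<delta>_def)
      finally have wq: "norm w * norm q \<le> 1/2" "norm w * norm q \<le> \<epsilon> / 6" by auto
      let ?\<rho> = "\<lambda>Z. exp (\<Sum>i\<in>{1..m}. log_ratio q w (Z i))"
      let ?E = "\<lambda>Z. L Z * (?\<rho> Z - 1 - w \<bullet> score m q Z)"
      have Eb: "\<bar>?E Z\<bar> \<le> C * (norm w)\<^sup>2 * \<bar>L Z * exp (\<epsilon> * M Z)\<bar>" for Z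
      proof -
        have "\<bar>?\<rho> Z - 1 - w \<bullet> score m q Z\<bar> \<le> (norm w)\<^sup>2 * C * exp (\<epsilon> * M Z)"
          unfolding inner_score C_def M_def by (rule exp_log_ratio_sum_bound[OF \<epsilon> wq])
        then have "\<bar>L Z\<bar> * \<bar>?\<rho> Z - 1 - w \<bullet> score m q Z\<bar> \<le> \<bar>L Z\<bar> * ((norm w)\<^sup>2 * C * exp (\<epsilon> * M Z))"
          by (intro mult_left_mono) auto
        then show ?thesis by (simp add: abs_mult mult_ac)
      qed
      have Ebi: "integrable ?R (\<lambda>Z. C * (norm w)\<^sup>2 * \<bar>L Z * exp (\<epsilon> * M Z)\<bar>)"
        using LE by (intro integrable_mult_right integrable_abs)
      have Ei: "integrable ?R ?E"
      proof (rule Bochner_Integration.integrable_bound[OF Ebi])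
        show "AE Z in ?R. norm (?E Z) \<le> norm (C * (norm w)\<^sup>2 * \<bar>L Z * exp (\<epsilon> * M Z)\<bar>)"
          unfolding real_norm_def by (intro AE_I2 order_trans[OF Eb abs_ge_self])
      qed measurable
      have Ls: "integrable ?R (\<lambda>Z. L Z * (w \<bullet> score m q Z))"
      proof -
        have "integrable ?R (\<lambda>Z. w \<bullet> (L Z *\<^sub>R score m q Z))"
          using LS by (rule integrable_inner_right)
        then show ?thesis by simp
      qed
      have wG: "w \<bullet> G = (\<integral>Z. L Z * (w \<bullet> score m q Z) \<partial>?R)"
        unfolding G_def using LS by (subst integral_inner_right[symmetric]) auto
      have "?f (?u + w) = (\<integral>Z. ?\<rho> Z * L Z \<partial>?R)"
        unfolding L_def by (rule expected_loss_shift[OF _ wq(1) q]) measurable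
      also have "\<dots> = (\<integral>Z. (?E Z + L Z) + L Z * (w \<bullet> score m q Z) \<partial>?R)"
        by (simp add: algebra_simps)
      also have "\<dots> = (\<integral>Z. ?E Z \<partial>?R) + (\<integral>Z. L Z \<partial>?R) + w \<bullet> G"
        using Ei Li Ls by (simp add: wG)
      finally have "?f (?u + w) - ?f ?u - w \<bullet> G = (\<integral>Z. ?E Z \<partial>?R)"
        by (simp add: L_def expected_loss_def)
      also have "\<bar>\<dots>\<bar> \<le> (\<integral>Z. \<bar>?E Z\<bar> \<partial>?R)" by (rule integral_abs_bound)
      also have "\<dots> \<le> (\<integral>Z. C * (norm w)\<^sup>2 * \<bar>L Z * exp (\<epsilon> * M Z)\<bar> \<partial>?R)"
        by (rule integral_mono[OF integrable_abs[OF Ei] Ebi Eb])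
      also have "\<dots> = (C * (\<integral>Z. \<bar>L Z * exp (\<epsilon> * M Z)\<bar> \<partial>?R)) * (norm w)\<^sup>2"
        by simp
      finally show ?thesis .
    qed
    have "GDERIV ?f ?u :> G"
      unfolding gderiv_def
      by (rule has_derivative_quadratic_bound[OF bounded_linear_inner_left \<delta> err])
    with nG show ?thesis by blast
  qed
  then show ?thesis by (rule that)
qed

section \<open>Gaussian mass of wedges\<close>

lemma Collect_in_borel: "Measurable.pred borel P \<Longrightarrow> Collect P \<in> sets borel"
  by (simp add: pred_def)

lemma std_normal_density_antimono: "\<bar>s\<bar> \<le> K \<Longrightarrow> std_normal_density K \<le> std_normal_density s"
  unfolding std_normal_density_def
  by (intro mult_left_mono) (auto simp: abs_le_square_iff[symmetric])

lemma std_normal_measure_ge: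
  assumes "l \<le> r" "- K \<le> l" "r \<le> K"
  shows "(r - l) * std_normal_density K \<le> measure std_normal_distribution {l<..r}"
    and "(r - l) * std_normal_density K \<le> measure std_normal_distribution {l..r}"
proof -
  interpret N: prob_space std_normal_distribution by (rule prob_space_std_normal)
  have "ennreal ((r - l) * std_normal_density K) = (\<integral>\<^sup>+s. ennreal (std_normal_density K) * indicator {l<..r} s \<partial>lborel)"
    using assms(1) by (simp add: nn_integral_cmult_indicator ennreal_mult mult.commute)
  also have "\<dots> \<le> (\<integral>\<^sup>+s. ennreal (std_normal_density s) * indicator {l<..r} s \<partial>lborel)"
    using assms by (intro nn_integral_mono) (auto simp: indicator_def intro!: ennreal_leI std_normal_density_antimono)
  also have "\<dots> = emeasure std_normal_distribution {l<..r}"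
    by (simp add: emeasure_density)
  finally show 1: "(r - l) * std_normal_density K \<le> measure std_normal_distribution {l<..r}"
    by (simp add: N.emeasure_eq_measure)
  also have "\<dots> \<le> measure std_normal_distribution {l..r}"
    by (intro N.finite_measure_mono) auto
  finally show "(r - l) * std_normal_density K \<le> measure std_normal_distribution {l..r}" .
qed

lemma measure_std_gaussian_rectangle:
  fixes w n :: "real ^ 'd::finite"
  assumes "norm w = 1" "norm n = 1" "w \<bullet> n = 0" "I \<in> sets borel" "J \<in> sets borel"
  shows "measure std_gaussian {z. w \<bullet> z \<in> I \<and> n \<bullet> z \<in> J}
    = measure std_normal_distribution I * measure std_normal_distribution J"
proof -
  interpret G: prob_space "std_gaussian :: (real ^ 'd) measure" by (rule prob_space_std_gaussian)
  interpret N: prob_space std_normal_distribution by (rule prob_space_std_normal)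
  note assms(4,5)[measurable]
  have [measurable]: "{z. w \<bullet> z \<in> I \<and> n \<bullet> z \<in> J} \<in> sets borel"
    by (rule Collect_in_borel) measurable
  have "emeasure std_gaussian {z. w \<bullet> z \<in> I \<and> n \<bullet> z \<in> J}
      = (\<integral>\<^sup>+z. indicator {z. w \<bullet> z \<in> I \<and> n \<bullet> z \<in> J} z \<partial>std_gaussian)" by simp
  also have "\<dots> = (\<integral>\<^sup>+z. indicator I (w \<bullet> z) * indicator J (n \<bullet> z) \<partial>std_gaussian)"
    by (intro nn_integral_cong) (auto simp: indicator_def)
  also have "\<dots> = emeasure std_normal_distribution I * emeasure std_normal_distribution J"
    using assms by (subst nn_integral_std_gaussian_inner2) auto
  finally show ?thesis
    by (simp add: G.emeasure_eq_measure N.emeasure_eq_measure ennreal_mult[symmetric])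
qed

lemma measure_std_gaussian_orthogonal:
  fixes T :: "real ^ 'd::finite \<Rightarrow> real ^ 'd"
  assumes T: "orthogonal_transformation T" and S: "S \<in> sets borel"
  shows "measure std_gaussian (T -` S) = measure std_gaussian S"
proof -
  have [measurable]: "T \<in> borel \<rightarrow>\<^sub>M borel"
    using T by (auto intro: measurable_linear orthogonal_transformation_linear)
  have "measure (distr std_gaussian borel T) S = measure std_gaussian (T -` S)"
    using S by (subst measure_distr) auto
  then show ?thesis using distr_std_gaussian_orthogonal[OF T] by simp
qed

text \<open>
  Coordinates in the plane of \<open>u\<close> and the target \<open>v\<close>: \<open>w\<close> bisects \<open>u\<close> and \<open>u'\<close>, the unit vector \<open>n\<close> is
  orthogonal to \<open>w\<close>, and \<open>T\<close> is the reflection along \<open>n\<close>, which exchanges \<open>u\<close> with \<open>u'\<close> and \<open>v\<close> with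
  \<open>v'\<close>. Since \<open>cn > 0\<close>, the vector \<open>u\<close> is closer to \<open>v\<close> than \<open>u'\<close> is; since \<open>cw \<ge> 0\<close>, the angle between
  \<open>w\<close> and \<open>v\<close> is at most a right angle. The distance of \<open>u\<close> and \<open>u'\<close> is \<open>2 \<eta>\<close>.
\<close>

locale wedge =
  fixes w n :: "real ^ 'd::finite" and \<omega> \<eta> cw cn :: real
  assumes unit: "norm w = 1" "norm n = 1" and perp: "w \<bullet> n = 0"
    and \<omega>: "0 < \<omega>" and \<eta>: "0 < \<eta>" and cw: "0 \<le> cw" and cn: "0 < cn" and c1: "cw\<^sup>2 + cn\<^sup>2 = 1"
begin

definition "u = \<omega> *\<^sub>R w + \<eta> *\<^sub>R n"
definition "u' = \<omega> *\<^sub>R w - \<eta> *\<^sub>R n"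
definition "v = cw *\<^sub>R w + cn *\<^sub>R n"
definition "v' = cw *\<^sub>R w - cn *\<^sub>R n"

lemma inner_simps:
  "u \<bullet> z = \<omega> * (w \<bullet> z) + \<eta> * (n \<bullet> z)" "u' \<bullet> z = \<omega> * (w \<bullet> z) - \<eta> * (n \<bullet> z)"
  "v \<bullet> z = cw * (w \<bullet> z) + cn * (n \<bullet> z)" "v' \<bullet> z = cw * (w \<bullet> z) - cn * (n \<bullet> z)"
  by (simp_all add: u_def u'_def v_def v'_def inner_add_left inner_diff_left)

lemma cw_le: "cw \<le> 1" and cn_le: "cn \<le> 1"
proof -
  have "cw\<^sup>2 \<le> 1\<^sup>2" "cn\<^sup>2 \<le> 1\<^sup>2"
    using c1 zero_le_power2[of cw] zero_le_power2[of cn] unfolding one_power2 by linarith+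
  then show "cw \<le> 1" "cn \<le> 1" using power2_le_imp_le[of cw 1] power2_le_imp_le[of cn 1] by simp_all
qed

definition "T z = z - (2 * (n \<bullet> z)) *\<^sub>R n"

lemma orth_T: "orthogonal_transformation T"
proof -
  have "n \<bullet> n = 1" using unit by (simp add: norm_eq_1)
  then show ?thesis
    unfolding orthogonal_transformation_def
    by (auto intro!: linearI simp: T_def algebra_simps inner_diff_left inner_diff_right inner_commute)
qed

lemma inner_T: "w \<bullet> T z = w \<bullet> z" "n \<bullet> T z = - (n \<bullet> z)"
  using unit perp by (simp_all add: T_def inner_diff_right norm_eq_1)

lemma inner_T': "u \<bullet> T z = u' \<bullet> z" "u' \<bullet> T z = u \<bullet> z" "v \<bullet> T z = v' \<bullet> z" "v' \<bullet> T z = v \<bullet> z"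
  by (simp_all add: inner_simps inner_T)

text \<open>
  Probabilities for a single row: the score of \<open>u\<close> is at most \<open>b\<close>, and the score of the target,
  respectively of the reflected target, is at most \<open>a\<close>.
\<close>

definition "p a b = measure std_gaussian {z. v \<bullet> z \<le> a \<and> u \<bullet> z \<le> b}"
definition "p' a b = measure std_gaussian {z. v' \<bullet> z \<le> a \<and> u \<bullet> z \<le> b}"

lemma p_eq: "p a b = p' a b + measure std_gaussian {z. v' \<bullet> z \<le> a \<and> a < v \<bullet> z \<and> u' \<bullet> z \<le> b \<and> b < u \<bullet> z}"
proof -
  let ?V = "{z. v' \<bullet> z \<le> a \<and> a < v \<bullet> z \<and> u' \<bullet> z \<le> b \<and> b < u \<bullet> z}"
  let ?W = "{z. v' \<bullet> z \<le> a \<and> a < v \<bullet> z \<and> u' \<bullet> z \<le> b}"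
  let ?X = "{z. v' \<bullet> z \<le> a \<and> a < v \<bullet> z \<and> u \<bullet> z \<le> b}"
  let ?Y = "{z. v \<bullet> z \<le> a \<and> v' \<bullet> z \<le> a \<and> u \<bullet> z \<le> b}"
  let ?Y' = "{z. v \<bullet> z \<le> a \<and> a < v' \<bullet> z \<and> u \<bullet> z \<le> b}"
  interpret G: prob_space "std_gaussian :: (real ^ 'd) measure" by (rule prob_space_std_gaussian)
  let ?m = "measure (std_gaussian :: (real ^ 'd) measure)"
  have meas: "Collect P \<in> sets std_gaussian" if "Measurable.pred borel P" for P :: "real^'d \<Rightarrow> bool"
    using Collect_in_borel[OF that] by simp
  have split: "?m {z. P z} = ?m {z. P z \<and> Q z} + ?m {z. P z \<and> \<not> Q z}"
    if [measurable]: "Measurable.pred borel P" "Measurable.pred borel Q" for P Q :: "real^'d \<Rightarrow> bool"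
  proof -
    have "{z. P z} = {z. P z \<and> Q z} \<union> {z. P z \<and> \<not> Q z}" by blast
    moreover have "?m ({z. P z \<and> Q z} \<union> {z. P z \<and> \<not> Q z}) = ?m {z. P z \<and> Q z} + ?m {z. P z \<and> \<not> Q z}"
      by (rule G.finite_measure_Union; (rule meas, measurable)?) blast
    ultimately show ?thesis by simp
  qed
  have "p a b = ?m ?Y + ?m ?Y'"
  proof -
    have "{z. (v \<bullet> z \<le> a \<and> u \<bullet> z \<le> b) \<and> v' \<bullet> z \<le> a} = ?Y"
      "{z. (v \<bullet> z \<le> a \<and> u \<bullet> z \<le> b) \<and> \<not> v' \<bullet> z \<le> a} = ?Y'"
      by (auto simp: not_le)
    then show ?thesis
      unfolding p_def using split[of "\<lambda>z. v \<bullet> z \<le> a \<and> u \<bullet> z \<le> b" "\<lambda>z. v' \<bullet> z \<le> a"] by simp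
  qed
  moreover have "p' a b = ?m ?Y + ?m ?X"
  proof -
    have "{z. (v' \<bullet> z \<le> a \<and> u \<bullet> z \<le> b) \<and> v \<bullet> z \<le> a} = ?Y"
      "{z. (v' \<bullet> z \<le> a \<and> u \<bullet> z \<le> b) \<and> \<not> v \<bullet> z \<le> a} = ?X"
      by (auto simp: not_le)
    then show ?thesis
      unfolding p'_def using split[of "\<lambda>z. v' \<bullet> z \<le> a \<and> u \<bullet> z \<le> b" "\<lambda>z. v \<bullet> z \<le> a"] by simp
  qed
  moreover have "?m ?Y' = ?m ?W"
  proof -
    have "T -` ?W = ?Y'"
      by (auto simp: inner_T')
    moreover have "?W \<in> sets borel"
      by (rule Collect_in_borel) measurable
    note measure_std_gaussian_orthogonal[OF orth_T this]
    ultimately show ?thesis by (simp only:)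
  qed
  moreover have "?m ?W
     = ?m ?X + ?m ?V"
  proof -
    \<comment> \<open>Where the target scores higher than its reflection, \<open>n \<bullet> z\<close> is positive, so \<open>u\<close> scores higher than \<open>u'\<close>.\<close>
    have *: "u' \<bullet> z \<le> u \<bullet> z" if "v' \<bullet> z \<le> a" "a < v \<bullet> z" for z
    proof -
      have "0 < 2 * (cn * (n \<bullet> z))" using that unfolding inner_simps by linarith
      then have "0 < n \<bullet> z" using cn by (simp add: zero_less_mult_iff)
      then show ?thesis using \<eta> by (simp add: inner_simps)
    qed
    have "{z. (v' \<bullet> z \<le> a \<and> a < v \<bullet> z \<and> u' \<bullet> z \<le> b) \<and> u \<bullet> z \<le> b} = ?X"
      using * by (auto intro: order_trans)
    moreover have "{z. (v' \<bullet> z \<le> a \<and> a < v \<bullet> z \<and> u' \<bullet> z \<le> b) \<and> \<not> u \<bullet> z \<le> b} = ?V"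
      by (auto simp: not_le)
    ultimately show ?thesis
      using split[of "\<lambda>z. v' \<bullet> z \<le> a \<and> a < v \<bullet> z \<and> u' \<bullet> z \<le> b" "\<lambda>z. u \<bullet> z \<le> b"] by simp
  qed
  ultimately show ?thesis by simp
qed

lemma p'_le_p: "p' a b \<le> p a b"
  unfolding p_eq by simp

text \<open>
  Both bounds come from a rectangle in the coordinates \<open>w \<bullet> z\<close> and \<open>n \<bullet> z\<close>. For the first one
  \<open>n \<bullet> z\<close> lies in \<open>[B, B + 1]\<close> and \<open>w \<bullet> z\<close> in an interval of length \<open>\<eta> B / \<omega>\<close> next to \<open>b / \<omega>\<close>; the
  condition on \<open>B\<close> makes \<open>cn (n \<bullet> z)\<close> dominate in the scores of \<open>v\<close> and \<open>v'\<close>. For the second one both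
  coordinates lie in \<open>[- B - 1, - B]\<close>, where \<open>cw \<ge> 0\<close> is needed.
\<close>

lemma p_gap:
  assumes B: "1 \<le> B" and \<omega>2: "\<omega> \<le> 2" and big: "\<bar>a\<bar> + \<bar>b\<bar> / \<omega> + \<eta> * B / \<omega> < cn * B"
  shows "p' a b + (std_normal_density (B + 1))\<^sup>2 / 2 * \<eta> \<le> p a b"
    and "(std_normal_density (B + 1))\<^sup>2 \<le> p a b"
proof -
  let ?V = "{z. v' \<bullet> z \<le> a \<and> a < v \<bullet> z \<and> u' \<bullet> z \<le> b \<and> b < u \<bullet> z}"
  interpret G: prob_space "std_gaussian :: (real ^ 'd) measure" by (rule prob_space_std_gaussian)
  let ?\<phi> = "std_normal_density (B + 1)"
  have meas: "Collect P \<in> sets std_gaussian" if "Measurable.pred borel P" for P :: "real^'d \<Rightarrow> bool"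
    using Collect_in_borel[OF that] by simp
  have pos: "0 \<le> \<bar>b\<bar> / \<omega>" "0 < \<eta> * B / \<omega>" using \<omega> \<eta> B by auto
  have cB: "cn * B \<le> B" using cn_le B by simp
  let ?I = "{b / \<omega><..b / \<omega> + \<eta> * B / \<omega>}" and ?J = "{B..B + 1}"
  have bo: "\<bar>b / \<omega>\<bar> = \<bar>b\<bar> / \<omega>" using \<omega> by simp
  have I: "\<bar>\<alpha>\<bar> + \<bar>a\<bar> < cn * B" if "\<alpha> \<in> ?I" for \<alpha>
    using that big pos bo unfolding greaterThanAtMost_iff by linarith
  have "{z. w \<bullet> z \<in> ?I \<and> n \<bullet> z \<in> ?J} \<subseteq> ?V"
  proof safe
    fix z assume z: "w \<bullet> z \<in> ?I" "n \<bullet> z \<in> ?J"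
    have "\<bar>cw * (w \<bullet> z)\<bar> \<le> \<bar>w \<bullet> z\<bar>"
      using cw cw_le by (simp add: abs_mult mult_left_le_one_le)
    moreover have "cn * B \<le> cn * (n \<bullet> z)" using z cn by simp
    ultimately show "v' \<bullet> z \<le> a" "a < v \<bullet> z"
      using I[OF z(1)] unfolding inner_simps by linarith+
    have "b < \<omega> * (w \<bullet> z)" "\<omega> * (w \<bullet> z) \<le> b + \<eta> * B"
      using z(1) \<omega> by (auto simp: field_simps)
    moreover have "\<eta> * B \<le> \<eta> * (n \<bullet> z)" "0 < \<eta> * B" using z(2) \<eta> B by auto
    ultimately show "u' \<bullet> z \<le> b" "b < u \<bullet> z" unfolding inner_simps by linarith+
  qed
  then have "measure std_gaussian {z. w \<bullet> z \<in> ?I \<and> n \<bullet> z \<in> ?J}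
      \<le> measure std_gaussian ?V"
    by (rule G.finite_measure_mono) (rule meas, measurable)
  also have "\<dots> = p a b - p' a b" by (simp add: p_eq)
  also have "measure std_gaussian {z. w \<bullet> z \<in> ?I \<and> n \<bullet> z \<in> ?J}
      = measure std_normal_distribution ?I * measure std_normal_distribution ?J"
    by (rule measure_std_gaussian_rectangle[OF unit perp]) auto
  finally have le: "measure std_normal_distribution ?I * measure std_normal_distribution ?J \<le> p a b - p' a b" .
  have "\<eta> / 2 * ?\<phi> * ?\<phi> \<le> measure std_normal_distribution ?I * measure std_normal_distribution ?J"
  proof (intro mult_mono)
    have "\<eta> / 2 \<le> \<eta> * B / \<omega>" using \<eta> B \<omega> \<omega>2 by (intro frac_le) auto
    then have "\<eta> / 2 * ?\<phi> \<le> (b / \<omega> + \<eta> * B / \<omega> - b / \<omega>) * ?\<phi>" by (intro mult_right_mono) auto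
    also have "\<dots> \<le> measure std_normal_distribution ?I"
      by (rule std_normal_measure_ge(1)) (use big pos cB bo abs_ge_zero[of a] in linarith)+
    finally show "\<eta> / 2 * ?\<phi> \<le> measure std_normal_distribution ?I" .
    show "?\<phi> \<le> measure std_normal_distribution ?J"
      using std_normal_measure_ge(2)[of B "B + 1" "B + 1"] B by simp
  qed (use \<eta> in auto)
  then show "p' a b + ?\<phi>\<^sup>2 / 2 * \<eta> \<le> p a b" using le by (simp add: power2_eq_square mult_ac)
  let ?K = "{- B - 1..- B}"
  have "{z. w \<bullet> z \<in> ?K \<and> n \<bullet> z \<in> ?K} \<subseteq> {z. v \<bullet> z \<le> a \<and> u \<bullet> z \<le> b}"
  proof safe
    fix z assume z: "w \<bullet> z \<in> ?K" "n \<bullet> z \<in> ?K"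
    have "cw * (w \<bullet> z) \<le> 0" using z(1) cw B by (intro mult_nonneg_nonpos) auto
    moreover have "cn * (n \<bullet> z) \<le> cn * (- B)" using z(2) cn by (intro mult_left_mono) auto
    ultimately show "v \<bullet> z \<le> a" using big pos unfolding inner_simps by simp
    have "\<bar>b\<bar> / \<omega> < B" using big pos cB abs_ge_zero[of a] by linarith
    then have "\<bar>b\<bar> < \<omega> * B" using \<omega> by (simp add: field_simps)
    moreover have "\<omega> * (w \<bullet> z) \<le> \<omega> * (- B)" using z(1) \<omega> by (intro mult_left_mono) auto
    moreover have "\<eta> * (n \<bullet> z) \<le> 0" using z(2) \<eta> B by (intro mult_nonneg_nonpos) auto
    ultimately show "u \<bullet> z \<le> b" unfolding inner_simps by simp
  qed
  then have "measure std_gaussian {z. w \<bullet> z \<in> ?K \<and> n \<bullet> z \<in> ?K} \<le> p a b"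
    unfolding p_def by (rule G.finite_measure_mono) (rule meas, measurable)
  also have "measure std_gaussian {z. w \<bullet> z \<in> ?K \<and> n \<bullet> z \<in> ?K}
      = measure std_normal_distribution ?K * measure std_normal_distribution ?K"
    by (rule measure_std_gaussian_rectangle[OF unit perp]) auto
  finally have le: "measure std_normal_distribution ?K * measure std_normal_distribution ?K \<le> p a b" .
  have k: "?\<phi> \<le> measure std_normal_distribution ?K"
    using std_normal_measure_ge(2)[of "- B - 1" "- B" "B + 1"] B by simp
  have "?\<phi> * ?\<phi> \<le> measure std_normal_distribution ?K * measure std_normal_distribution ?K"
    by (intro mult_mono k) auto
  then show "?\<phi>\<^sup>2 \<le> p a b" using le by (simp add: power2_eq_square)
qed

end

section \<open>Increase of the loss under rotation away from the target\<close>

text \<open>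
  If \<open>S\<close> is stochastically larger on \<open>A'\<close> than on \<open>A\<close>, with a gap \<open>\<delta>\<close> at all thresholds in
  \<open>[0, 1]\<close>, then the expectation of an increasing function of \<open>S\<close> is larger on \<open>A'\<close>. The truncation at
  \<open>n\<close> makes the two expectations finite separately.
\<close>

lemma (in prob_space) layer_cake_gain:
  fixes k :: "real \<Rightarrow> real" and S :: "'a \<Rightarrow> real"
  assumes k: "strict_mono k" "continuous_on UNIV k"
    and S [measurable]: "S \<in> borel_measurable M" and A [measurable]: "A \<in> events" "A' \<in> events"
    and AA': "prob A = prob A'"
    and le: "\<And>v. prob (A' \<inter> {Z \<in> space M. S Z \<le> v}) \<le> prob (A \<inter> {Z \<in> space M. S Z \<le> v})"
    and gap: "\<And>v. 0 \<le> v \<Longrightarrow> v \<le> 1 \<Longrightarrow>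
        prob (A' \<inter> {Z \<in> space M. S Z \<le> v}) + \<delta> \<le> prob (A \<inter> {Z \<in> space M. S Z \<le> v})"
    and \<delta>: "0 \<le> \<delta>" and n: "1 \<le> n"
  shows "\<delta> * (k 1 - k 0) \<le> (\<integral>Z. (indicator A' Z - indicator A Z) * k (max (- n) (min n (S Z))) \<partial>M)"
proof -
  let ?L = "\<lambda>v. {Z \<in> space M. S Z \<le> v}"
  define \<kappa> where "\<kappa> s = k (max (- n) (min n s))" for s
  have km [measurable]: "k \<in> borel_measurable borel" using k(2) by (rule borel_measurable_continuous_onI)
  have \<kappa>m [measurable]: "\<kappa> \<in> borel_measurable borel" unfolding \<kappa>_def[abs_def] by measurable
  have mono: "a \<le> b \<Longrightarrow> k a \<le> k b" for a b using k(1) by (simp add: strict_mono_less_eq)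
  have \<kappa>_bounds: "k (- n) \<le> \<kappa> s" "\<kappa> s \<le> k n" for s
    unfolding \<kappa>_def using n by (auto intro!: mono)
  let ?U = "\<lambda>y. {Z \<in> space M. y < \<kappa> (S Z)}"
  have level: "prob (A \<inter> ?U y) + \<delta> * indicator {k 0..<k 1} y
      \<le> prob (A' \<inter> ?U y)" if y: "k (- n) \<le> y" for y
  proof (cases "y < k n")
    case True
    obtain v where v: "- n \<le> v" "v \<le> n" "k v = y"
      using IVT'[of k "- n" y n] y True n k(2) continuous_on_subset by (metis less_eq_real_def neg_le_iff_le order_trans subset_UNIV le_minus_one_simps(1) minus_le_iff zero_le_one)
    have "v < n" using True v by (metis less_eq_real_def order_less_irrefl)
    have \<kappa>_iff: "y < \<kappa> s \<longleftrightarrow> v < s" for s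
      unfolding \<kappa>_def v(3)[symmetric] using k(1) v \<open>v < n\<close> by (auto simp: strict_mono_less)
    have compl: "prob (X \<inter> {Z \<in> space M. v < S Z}) = prob X - prob (X \<inter> ?L v)"
      if [measurable]: "X \<in> events" for X
    proof -
      have "X = (X \<inter> {Z \<in> space M. v < S Z}) \<union> (X \<inter> ?L v)"
        using sets.sets_into_space[OF that] by auto
      then have "prob X = prob ((X \<inter> {Z \<in> space M. v < S Z}) \<union> (X \<inter> ?L v))" by simp
      also have "\<dots> = prob (X \<inter> {Z \<in> space M. v < S Z}) + prob (X \<inter> ?L v)"
        by (rule finite_measure_Union) auto
      finally show ?thesis by simp
    qed
    show ?thesis
    proof (cases "y \<in> {k 0..<k 1}")
      case True
      then have "0 \<le> v" "v \<le> 1"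
        using v(3) k(1) by (auto simp: strict_mono_less_eq strict_mono_less less_imp_le)
      then show ?thesis unfolding \<kappa>_iff compl[OF A(1)] compl[OF A(2)] using gap[of v] AA' True by simp
    next
      case False
      then show ?thesis unfolding \<kappa>_iff compl[OF A(1)] compl[OF A(2)] using le[of v] AA' by simp
    qed
  next
    case False
    then have "\<not> y < \<kappa> s" for s using \<kappa>_bounds(2)[of s] by linarith
    moreover have "y \<notin> {k 0..<k 1}" using False mono[OF n] by auto
    ultimately show ?thesis by simp
  qed
  \<comment> \<open>The layer cake: \<open>\<kappa> (S Z) - k (- n)\<close> is the length of \<open>[k (- n), \<kappa> (S Z))\<close>.\<close>
  define N where "N X = (\<integral>\<^sup>+Z. indicator X Z * ennreal (\<kappa> (S Z) - k (- n)) \<partial>M)" for X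
  have N: "N X = (\<integral>\<^sup>+y. indicator {k (- n)..} y * ennreal (prob (X \<inter> ?U y)) \<partial>lborel)"
    if X [measurable]: "X \<in> events" for X
  proof -
    interpret P: pair_sigma_finite M lborel
      by (simp add: pair_sigma_finite_def sigma_finite_measure_axioms sigma_finite_lborel)
    let ?I = "\<lambda>Z y. (if k (- n) \<le> y \<and> y < \<kappa> (S Z) then indicator X Z else 0 :: ennreal)"
    have "N X = (\<integral>\<^sup>+Z. (\<integral>\<^sup>+y. ?I Z y \<partial>lborel) \<partial>M)"
      unfolding N_def
    proof (rule nn_integral_cong)
      fix Z
      have "(\<integral>\<^sup>+y. ?I Z y \<partial>lborel) = (\<integral>\<^sup>+y. indicator X Z * indicator {k (- n)..<\<kappa> (S Z)} y \<partial>lborel)"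
        by (intro nn_integral_cong) (auto simp: indicator_def)
      then show "indicator X Z * ennreal (\<kappa> (S Z) - k (- n)) = (\<integral>\<^sup>+y. ?I Z y \<partial>lborel)"
        using \<kappa>_bounds(1)[of "S Z"] by (simp add: nn_integral_cmult_indicator)
    qed
    also have "\<dots> = (\<integral>\<^sup>+y. (\<integral>\<^sup>+Z. ?I Z y \<partial>M) \<partial>lborel)"
      by (rule P.Fubini'[symmetric]) measurable
    also have "\<dots> = (\<integral>\<^sup>+y. indicator {k (- n)..} y * ennreal (prob (X \<inter> ?U y)) \<partial>lborel)"
    proof (rule nn_integral_cong)
      fix y
      have "(\<integral>\<^sup>+Z. ?I Z y \<partial>M) = (\<integral>\<^sup>+Z. indicator {k (- n)..} y * indicator (X \<inter> ?U y) Z \<partial>M)"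
        by (intro nn_integral_cong) (auto simp: indicator_def)
      also have "\<dots> = indicator {k (- n)..} y * emeasure M (X \<inter> ?U y)"
        by (rule nn_integral_cmult_indicator) measurable
      finally show "(\<integral>\<^sup>+Z. ?I Z y \<partial>M) = indicator {k (- n)..} y * ennreal (prob (X \<inter> ?U y))"
        by (simp add: emeasure_eq_measure)
    qed
    finally show ?thesis .
  qed
  have meas: "(\<lambda>y. indicator {k (- n)..} y * ennreal (prob (X \<inter> ?U y))) \<in> borel_measurable lborel"
    if [measurable]: "X \<in> events" for X
  proof -
    have "(\<lambda>y. emeasure M {Z \<in> space M. Z \<in> X \<and> y < \<kappa> (S Z)}) \<in> borel_measurable lborel"
      by measurable
    moreover have "{Z \<in> space M. Z \<in> X \<and> y < \<kappa> (S Z)} = X \<inter> ?U y" for y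
      by auto
    ultimately have [measurable]: "(\<lambda>y. ennreal (prob (X \<inter> ?U y))) \<in> borel_measurable lborel"
      by (simp add: emeasure_eq_measure)
    show ?thesis by measurable
  qed
  have k01: "k 0 \<le> k 1" "k (- n) \<le> k 0" using n by (auto intro!: mono)
  have "N A + ennreal (\<delta> * (k 1 - k 0)) = N A + (\<integral>\<^sup>+y. ennreal \<delta> * indicator {k 0..<k 1} y \<partial>lborel)"
    using k01 \<delta> by (simp add: nn_integral_cmult_indicator ennreal_mult)
  also have "\<dots> = (\<integral>\<^sup>+y. indicator {k (- n)..} y * ennreal (prob (A \<inter> ?U y)) + ennreal \<delta> * indicator {k 0..<k 1} y \<partial>lborel)"
    unfolding N[OF A(1)] by (rule nn_integral_add[symmetric]) (use meas in auto)
  also have "\<dots> \<le> (\<integral>\<^sup>+y. indicator {k (- n)..} y * ennreal (prob (A' \<inter> ?U y)) \<partial>lborel)"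
  proof (rule nn_integral_mono)
    fix y
    show "indicator {k (- n)..} y * ennreal (prob (A \<inter> ?U y)) + ennreal \<delta> * indicator {k 0..<k 1} y
      \<le> indicator {k (- n)..} y * ennreal (prob (A' \<inter> ?U y))"
    proof (cases "k (- n) \<le> y")
      case True
      then show ?thesis
        using ennreal_leI[OF level[OF True]] \<delta> by (simp add: ennreal_mult ennreal_indicator)
    next
      case False
      then show ?thesis using k01 by (auto simp: indicator_def)
    qed
  qed
  also have "\<dots> = N A'" by (rule N[OF A(2), symmetric])
  finally have NN: "N A + ennreal (\<delta> * (k 1 - k 0)) \<le> N A'" .
  have bnd: "\<bar>\<kappa> s\<bar> \<le> \<bar>k n\<bar> + \<bar>k (- n)\<bar>" for s using \<kappa>_bounds[of s] by linarith
  have int: "integrable M (\<lambda>Z. indicator X Z * \<kappa> (S Z))" if [measurable]: "X \<in> events" for X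
    by (rule integrable_const_bound[where B = "\<bar>k n\<bar> + \<bar>k (- n)\<bar>"]) (use bnd in \<open>auto simp: indicator_def\<close>)
  have NX: "N X = ennreal ((\<integral>Z. indicator X Z * \<kappa> (S Z) \<partial>M) - k (- n) * prob X)"
    and NX0: "0 \<le> (\<integral>Z. indicator X Z * \<kappa> (S Z) \<partial>M) - k (- n) * prob X" if X [measurable]: "X \<in> events" for X
  proof -
    have i: "integrable M (\<lambda>Z. indicator X Z * k (- n))" using X by (simp add: less_top[symmetric])
    have eq: "(\<integral>Z. indicator X Z * (\<kappa> (S Z) - k (- n)) \<partial>M) = (\<integral>Z. indicator X Z * \<kappa> (S Z) \<partial>M) - k (- n) * prob X"
      unfolding right_diff_distrib using int[OF X] i X by (simp add: mult.commute)
    have ii: "integrable M (\<lambda>Z. indicator X Z * (\<kappa> (S Z) - k (- n)))"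
      unfolding right_diff_distrib using int[OF X] i by (rule Bochner_Integration.integrable_diff)
    have nn: "0 \<le> indicator X Z * (\<kappa> (S Z) - k (- n))" for Z using \<kappa>_bounds(1)[of "S Z"] by simp
    have "N X = (\<integral>\<^sup>+Z. ennreal (indicator X Z * (\<kappa> (S Z) - k (- n))) \<partial>M)"
      unfolding N_def by (intro nn_integral_cong) (auto simp: indicator_def)
    also have "\<dots> = ennreal (\<integral>Z. indicator X Z * (\<kappa> (S Z) - k (- n)) \<partial>M)"
      by (rule nn_integral_eq_integral[OF ii]) (use nn in auto)
    finally show "N X = ennreal ((\<integral>Z. indicator X Z * \<kappa> (S Z) \<partial>M) - k (- n) * prob X)" unfolding eq .
    show "0 \<le> (\<integral>Z. indicator X Z * \<kappa> (S Z) \<partial>M) - k (- n) * prob X"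
      unfolding eq[symmetric] by (rule Bochner_Integration.integral_nonneg) (rule nn)
  qed
  have "(\<integral>Z. indicator A Z * \<kappa> (S Z) \<partial>M) - k (- n) * prob A + \<delta> * (k 1 - k 0)
     \<le> (\<integral>Z. indicator A' Z * \<kappa> (S Z) \<partial>M) - k (- n) * prob A'"
    using NN NX0[OF A(1)] NX0[OF A(2)] \<delta> k01
    by (simp add: NX[OF A(1)] NX[OF A(2)] ennreal_plus[symmetric] del: ennreal_plus)
  then have "\<delta> * (k 1 - k 0) \<le> (\<integral>Z. indicator A' Z * \<kappa> (S Z) \<partial>M) - (\<integral>Z. indicator A Z * \<kappa> (S Z) \<partial>M)"
    using AA' by simp
  also have "\<dots> = (\<integral>Z. (indicator A' Z - indicator A Z) * \<kappa> (S Z) \<partial>M)"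
    using int[OF A(1)] int[OF A(2)] by (simp add: left_diff_distrib)
  finally show ?thesis by (simp add: \<kappa>_def)
qed

lemma AE_max_score_nonzero:
  fixes v :: "real ^ 'd::finite"
  assumes v: "norm v = 1" and m: "m \<ge> 1"
  shows "AE Z in gaussian_rows m. max_score m t v Z \<noteq> 0"
proof -
  have "AE s in lborel. s \<noteq> - t" by (rule AE_lborel_singleton)
  then have 0: "AE s in std_normal_distribution. s \<noteq> - t"
    by (subst AE_density) auto
  have 1: "AE z in (std_gaussian :: (real ^ 'd) measure). v \<bullet> z \<noteq> - t"
  proof -
    have "AE s in distr std_gaussian borel (\<lambda>z. v \<bullet> z). s \<noteq> - t"
      unfolding distr_std_gaussian_inner[OF v] by (rule 0)
    then show ?thesis by (subst (asm) AE_distr_iff) auto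
  qed
  have "AE Z in gaussian_rows m. v \<bullet> Z i \<noteq> - t" if i: "i \<in> {1..m}" for i
  proof -
    have [measurable]: "(\<lambda>Z. Z i) \<in> gaussian_rows m \<rightarrow>\<^sub>M (borel :: (real ^ 'd) measure)"
      using i by measurable
    have "AE z in distr (gaussian_rows m) borel (\<lambda>Z. Z i). v \<bullet> z \<noteq> - t"
      unfolding distr_gaussian_rows_row[OF i] by (rule 1)
    then show ?thesis by (subst (asm) AE_distr_iff) auto
  qed
  then have "AE Z in gaussian_rows m. \<forall>i\<in>{1..m}. v \<bullet> Z i \<noteq> - t"
    by (intro AE_finite_allI) auto
  then show ?thesis
  proof eventually_elim
    case (elim Z)
    obtain i where i: "i \<in> {1..m}" "max_score m t v Z = v \<bullet> Z i + t" by (rule max_score_cases[OF m])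
    have "v \<bullet> Z i \<noteq> - t" using elim i(1) by blast
    then show ?case unfolding i(2) by linarith
  qed
qed

context wedge
begin

lemma norm_v: "norm v = 1" "norm v' = 1"
proof -
  have "w \<bullet> w = 1" "n \<bullet> n = 1" using unit by (simp_all add: norm_eq_1)
  then show "norm v = 1" "norm v' = 1"
    using perp c1 unfolding norm_eq_1 v_def v'_def
    by (simp_all add: inner_add_left inner_add_right inner_diff_left inner_diff_right inner_commute power2_eq_square)
qed

text \<open>
  Rotating away from the target increases the loss at least linearly in \<open>\<eta>\<close>, and the rate depends on
  \<open>u\<close> and \<open>u'\<close> only through \<open>B\<close>.
\<close>

proposition expected_loss_gain:
  assumes h: "h \<in> H_plus" and m: "m \<ge> 1" and B: "1 \<le> B" and \<omega>2: "\<omega> \<le> 2"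
    and big: "\<bar>t\<bar> + (\<bar>t\<bar> + 1) / \<omega> + \<eta> * B / \<omega> < cn * B"
    and dom: "u \<in> loss_domain m t v h" "u' \<in> loss_domain m t v h"
  shows "expected_loss m t v h u + ((std_normal_density (B + 1))\<^sup>2) ^ m / 2 * \<eta> * (h 1 - h (- 1))
    \<le> expected_loss m t v h u'"
proof -
  let ?R = "gaussian_rows m :: (nat \<Rightarrow> real ^ 'd) measure"
  let ?f = "expected_loss m t v h"
  let ?\<phi> = "std_normal_density (B + 1)"
  interpret R: prob_space ?R by (rule prob_space_gaussian_rows)
  note H_plus_measurable[OF h, measurable]
  have Tm [measurable]: "T \<in> borel \<rightarrow>\<^sub>M borel"
    using orth_T by (auto intro: measurable_linear orthogonal_transformation_linear)
  define S where "S = max_score m t u"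
  have [measurable]: "S \<in> borel_measurable ?R" unfolding S_def by measurable
  let ?L = "\<lambda>s. {Z \<in> space ?R. S Z \<le> s}"
  define k where "k s = h s - h (- s)" for s
  have k: "strict_mono k" unfolding k_def[abs_def] by (rule H_plus_odd_part_strict_mono[OF h])
  have kc: "continuous_on UNIV k"
    unfolding k_def[abs_def]
    by (intro continuous_intros continuous_on_compose2[OF H_plus_continuous[OF h, of UNIV]]) auto
  have k0: "k 0 = 0" by (simp add: k_def)
  define A where "A = {Z \<in> space ?R. max_score m t v Z \<le> 0}"
  define A' where "A' = {Z \<in> space ?R. max_score m t v' Z \<le> 0}"
  have Am [measurable]: "A \<in> sets ?R" "A' \<in> sets ?R" unfolding A_def A'_def by measurable
  have prA: "R.prob (A \<inter> ?L s) = p (- t) (s - t) ^ m" for s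
  proof -
    have "A \<inter> ?L s = {Z \<in> space ?R. \<forall>i\<in>{1..m}. Z i \<in> {z. v \<bullet> z \<le> - t \<and> u \<bullet> z \<le> s - t}}"
      unfolding A_def S_def by (auto simp: max_score_le_iff[OF m])
    then show ?thesis unfolding p_def by (simp only:) (rule measure_gaussian_rows_all, rule Collect_in_borel, measurable)
  qed
  have prA': "R.prob (A' \<inter> ?L s) = p' (- t) (s - t) ^ m" for s
  proof -
    have "A' \<inter> ?L s = {Z \<in> space ?R. \<forall>i\<in>{1..m}. Z i \<in> {z. v' \<bullet> z \<le> - t \<and> u \<bullet> z \<le> s - t}}"
      unfolding A'_def S_def by (auto simp: max_score_le_iff[OF m])
    then show ?thesis unfolding p'_def by (simp only:) (rule measure_gaussian_rows_all, rule Collect_in_borel, measurable)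
  qed
  have AA': "R.prob A = R.prob A'"
  proof -
    have "A = {Z \<in> space ?R. \<forall>i\<in>{1..m}. Z i \<in> {z. v \<bullet> z \<le> - t}}"
      "A' = {Z \<in> space ?R. \<forall>i\<in>{1..m}. Z i \<in> {z. v' \<bullet> z \<le> - t}}"
      unfolding A_def A'_def by (auto simp: max_score_le_iff[OF m])
    moreover have b: "{z. v \<bullet> z \<le> - t} \<in> sets borel" "{z. v' \<bullet> z \<le> - t} \<in> sets borel"
      by (rule Collect_in_borel, measurable)+
    moreover have "measure std_gaussian {z. v \<bullet> z \<le> - t} = measure std_gaussian {z. v' \<bullet> z \<le> - t}"
    proof -
      have "T -` {z. v' \<bullet> z \<le> - t} = {z. v \<bullet> z \<le> - t}" by (auto simp: inner_T')
      then show ?thesis using measure_std_gaussian_orthogonal[OF orth_T b(2)] by simp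
    qed
    ultimately show ?thesis using measure_gaussian_rows_all[OF b(1), of m] measure_gaussian_rows_all[OF b(2), of m] by simp
  qed
  have p0: "0 \<le> p a b" "0 \<le> p' a b" for a b by (simp_all add: p_def p'_def)
  define \<delta> where "\<delta> = (?\<phi>\<^sup>2) ^ m / 2 * \<eta>"
  have \<delta>0: "0 \<le> \<delta>" using \<eta> by (simp add: \<delta>_def)
  have le: "R.prob (A' \<inter> ?L s) \<le> R.prob (A \<inter> ?L s)" for s
    unfolding prA prA' by (intro power_mono p'_le_p p0)
  have gap: "R.prob (A' \<inter> ?L s) + \<delta> \<le> R.prob (A \<inter> ?L s)"
    if s: "0 \<le> s" "s \<le> 1" for s
  proof -
    have "\<bar>s - t\<bar> / \<omega> \<le> (\<bar>t\<bar> + 1) / \<omega>" using s \<omega> by (intro divide_right_mono) auto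
    then have big': "\<bar>- t\<bar> + \<bar>s - t\<bar> / \<omega> + \<eta> * B / \<omega> < cn * B" using big by simp
    note g = p_gap[OF B \<omega>2 big']
    let ?p = "p (- t) (s - t)" and ?p' = "p' (- t) (s - t)"
    obtain l where l: "m = Suc l" using m by (cases m) auto
    have "?p' ^ m \<le> ?p' * ?p ^ l"
      unfolding l power_Suc by (intro mult_left_mono power_mono p'_le_p p0)
    \<comment> \<open>\<open>p ^ m - p' ^ m\<close> is at least \<open>p ^ (m - 1) * (p - p')\<close>, and \<open>p\<close> is bounded below.\<close>
    moreover have "(?\<phi>\<^sup>2) ^ l * (?\<phi>\<^sup>2 / 2 * \<eta>) \<le> ?p ^ l * (?p - ?p')"
      using g \<eta> p0 by (intro mult_mono power_mono) auto
    then have "\<delta> \<le> ?p ^ l * (?p - ?p')" by (simp add: \<delta>_def l mult_ac)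
    moreover have "?p ^ m = ?p' * ?p ^ l + ?p ^ l * (?p - ?p')" by (simp add: l algebra_simps)
    ultimately show ?thesis unfolding prA prA' by linarith
  qed
  define D where "D Z = indicator A' Z - (indicator A Z :: real)" for Z
  have Dm [measurable]: "D \<in> borel_measurable ?R" unfolding D_def[abs_def] by measurable
  let ?X = "sample_loss m t v h u" and ?X' = "sample_loss m t v' h u"
  have X: "integrable ?R ?X" using dom(1) by (simp add: loss_domain_def)
  have sl: "sample_loss m t v h u' (rowmap m T Z) = ?X' Z" for Z
    by (rule sample_loss_rowmap) (simp_all add: inner_T')
  have "integrable (distr ?R ?R (rowmap m T)) (sample_loss m t v h u')"
    unfolding distr_gaussian_rows_orthogonal[OF orth_T] using dom(2) by (simp add: loss_domain_def)
  then have X': "integrable ?R ?X'"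
    by (subst (asm) integrable_distr_eq) (auto simp: sl)
  have "?f u' = (\<integral>Z. sample_loss m t v h u' Z \<partial>distr ?R ?R (rowmap m T))"
    unfolding distr_gaussian_rows_orthogonal[OF orth_T] by (simp add: expected_loss_def)
  also have "\<dots> = (\<integral>Z. ?X' Z \<partial>?R)" by (subst integral_distr) (auto simp: sl)
  finally have fu': "?f u' = (\<integral>Z. ?X' Z \<partial>?R)" .
  \<comment> \<open>Only this difference is known to be integrable; the terms \<open>h (S Z)\<close> and \<open>h (- S Z)\<close> need not be.\<close>
  have diff: "AE Z in ?R. ?X' Z - ?X Z = D Z * k (S Z)"
    using AE_max_score_nonzero[OF norm_v(1) m, of t] AE_max_score_nonzero[OF norm_v(2) m, of t] AE_space
  proof eventually_elim
    case (elim Z)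
    then show ?case
      by (cases "max_score m t v Z < 0"; cases "max_score m t v' Z < 0")
        (auto simp: sample_loss_def label_def S_def D_def A_def A'_def k_def indicator_def)
  qed
  have km [measurable]: "k \<in> borel_measurable borel" using kc by (rule borel_measurable_continuous_onI)
  have Dk: "integrable ?R (\<lambda>Z. D Z * k (S Z))"
    by (rule integrable_cong_AE_imp[OF Bochner_Integration.integrable_diff[OF X' X] _ diff]) measurable
  have "?f u' - ?f u = (\<integral>Z. ?X' Z - ?X Z \<partial>?R)"
    unfolding fu' using X X' by (simp add: expected_loss_def)
  also have "\<dots> = (\<integral>Z. D Z * k (S Z) \<partial>?R)"
    by (rule integral_cong_AE) (use diff in auto)
  finally have fd: "?f u' - ?f u = (\<integral>Z. D Z * k (S Z) \<partial>?R)" .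
  let ?c = "\<lambda>i s. max (- real (Suc i)) (min (real (Suc i)) s)"
  have kmono: "a \<le> b \<Longrightarrow> k a \<le> k b" for a b using k by (simp add: strict_mono_less_eq)
  have kb: "\<bar>k (?c i s)\<bar> \<le> \<bar>k s\<bar>" for i s
  proof (cases "0 \<le> s")
    case True
    then have "k 0 \<le> k (?c i s)" "k (?c i s) \<le> k s" by (auto intro!: kmono)
    then show ?thesis unfolding k0 by simp
  next
    case False
    then have "k (?c i s) \<le> k 0" "k s \<le> k (?c i s)" by (auto intro!: kmono)
    then show ?thesis unfolding k0 by simp
  qed
  have lim: "(\<lambda>i. \<integral>Z. D Z * k (?c i (S Z)) \<partial>?R) \<longlonglongrightarrow> (\<integral>Z. D Z * k (S Z) \<partial>?R)"
  proof (rule integral_dominated_convergence[where w = "\<lambda>Z. \<bar>D Z * k (S Z)\<bar>"])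
    show "integrable ?R (\<lambda>Z. \<bar>D Z * k (S Z)\<bar>)" using Dk by (rule integrable_abs)
    show "AE Z in ?R. (\<lambda>i. D Z * k (?c i (S Z))) \<longlonglongrightarrow> D Z * k (S Z)"
    proof (rule AE_I2, rule tendsto_eventually)
      fix Z
      obtain N where N: "\<bar>S Z\<bar> \<le> real N" using real_arch_simple by blast
      have "?c i (S Z) = S Z" if "N \<le> i" for i
        using that N by (auto simp: max_def min_def)
      then show "\<forall>\<^sub>F i in sequentially. D Z * k (?c i (S Z)) = D Z * k (S Z)"
        unfolding eventually_sequentially by metis
    qed
    show "AE Z in ?R. norm (D Z * k (?c i (S Z))) \<le> \<bar>D Z * k (S Z)\<bar>" for i
      using kb by (intro AE_I2) (auto simp: abs_mult intro!: mult_left_mono)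
  qed measurable
  have "\<delta> * (k 1 - k 0) \<le> (\<integral>Z. D Z * k (?c i (S Z)) \<partial>?R)" for i
    unfolding D_def by (rule R.layer_cake_gain[OF k kc _ Am AA' le gap \<delta>0]) auto
  then have "\<delta> * (k 1 - k 0) \<le> (\<integral>Z. D Z * k (S Z) \<partial>?R)"
    by (intro LIMSEQ_le_const[OF lim]) auto
  then show ?thesis unfolding fd[symmetric] \<delta>_def k0 by (simp add: k_def)
qed

end

section \<open>Direction and size of the gradient\<close>

lemma expected_loss_orthogonal:
  fixes T :: "real ^ 'd::finite \<Rightarrow> real ^ 'd"
  assumes T: "orthogonal_transformation T" and [measurable]: "h \<in> borel_measurable borel"
  shows "expected_loss m t (T xs) h (T u) = expected_loss m t xs h u"
proof -
  have [measurable]: "T \<in> borel \<rightarrow>\<^sub>M borel"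
    using T by (auto intro: measurable_linear orthogonal_transformation_linear)
  have "expected_loss m t (T xs) h (T u)
     = (\<integral>Z. sample_loss m t (T xs) h (T u) Z \<partial>distr (gaussian_rows m) (gaussian_rows m) (rowmap m T))"
    unfolding distr_gaussian_rows_orthogonal[OF T] by (simp add: expected_loss_def)
  also have "\<dots> = (\<integral>Z. sample_loss m t (T xs) h (T u) (rowmap m T Z) \<partial>gaussian_rows m)"
    by (rule integral_distr) measurable
  also have "\<dots> = expected_loss m t xs h u"
    unfolding expected_loss_def using T
    by (intro Bochner_Integration.integral_cong refl sample_loss_rowmap) (simp_all add: orthogonal_transformation_def)
  finally show ?thesis .
qed

lemma GDERIV_along_curve:
  fixes f :: "'a::euclidean_space \<Rightarrow> real" and \<gamma> :: "real \<Rightarrow> 'a"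
  assumes "GDERIV f (\<gamma> 0) :> g" "(\<gamma> has_vector_derivative d) (at 0)"
  shows "((\<lambda>s. f (\<gamma> s)) has_real_derivative d \<bullet> g) (at 0)"
proof -
  have "((\<lambda>s. f (\<gamma> s)) has_derivative (\<lambda>s. (s *\<^sub>R d) \<bullet> g)) (at 0)"
    using has_derivative_compose[of \<gamma> "\<lambda>s. s *\<^sub>R d" 0 UNIV f "\<lambda>h. h \<bullet> g"] assms
    by (simp add: gderiv_def has_vector_derivative_def)
  moreover have "(\<lambda>s. (s *\<^sub>R d) \<bullet> g) = (*) (d \<bullet> g)"
    by (rule ext) simp
  ultimately show ?thesis by (simp add: has_field_derivative_def)
qed

lemma GDERIV_even_direction:
  fixes f :: "'a::euclidean_space \<Rightarrow> real"
  assumes g: "GDERIV f u :> g" and even: "\<And>s. f (u + s *\<^sub>R n) = f (u - s *\<^sub>R n)"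
  shows "n \<bullet> g = 0"
proof -
  have 1: "((\<lambda>s. f (u + s *\<^sub>R n)) has_real_derivative n \<bullet> g) (at 0)"
    by (rule GDERIV_along_curve) (use g in \<open>auto intro!: derivative_eq_intros\<close>)
  have "((\<lambda>s. f (u - s *\<^sub>R n)) has_real_derivative (- n) \<bullet> g) (at 0)"
    by (rule GDERIV_along_curve) (use g in \<open>auto intro!: derivative_eq_intros\<close>)
  then have "((\<lambda>s. f (u + s *\<^sub>R n)) has_real_derivative (- n) \<bullet> g) (at 0)"
    unfolding even .
  with 1 have "n \<bullet> g = (- n) \<bullet> g" by (rule DERIV_unique)
  then show ?thesis by simp
qed

text \<open>
  The component of \<open>v\<close> orthogonal to \<open>u\<close>. For a unit vector \<open>u\<close> it is the projection of \<open>v\<close> to the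
  tangent space of the sphere at \<open>u\<close>.
\<close>

definition rej :: "'a::euclidean_space \<Rightarrow> 'a \<Rightarrow> 'a" where
  "rej u v = v - ((u \<bullet> v) / (u \<bullet> u)) *\<^sub>R u"

lemma inner_rej [simp]: "u \<bullet> rej u v = 0"
  by (cases "u = 0") (simp_all add: rej_def inner_diff_right)

text \<open>
  Along a direction \<open>n\<close> orthogonal to \<open>u\<close> and \<open>xs\<close> the loss is even, because a reflection that fixes
  \<open>xs\<close> exchanges \<open>u + s n\<close> and \<open>u - s n\<close>. So the gradient has no such component.
\<close>

lemma expected_loss_gradient_span:
  fixes u xs g :: "real ^ 'd::finite"
  assumes h: "h \<in> borel_measurable borel" and g: "GDERIV (expected_loss m t xs h) u :> g"
    and u: "u \<noteq> 0"
  defines "p \<equiv> rej u xs"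
  shows "rej u g = ((g \<bullet> p) / (p \<bullet> p)) *\<^sub>R p"
proof -
  define n where "n = rej u g - ((g \<bullet> p) / (p \<bullet> p)) *\<^sub>R p"
  have up: "u \<bullet> p = 0" by (simp add: p_def)
  have nu: "n \<bullet> u = 0"
    unfolding inner_commute[of n u] by (simp add: n_def inner_diff_right up)
  have np: "n \<bullet> p = 0"
    using up by (cases "p = 0") (simp_all add: n_def rej_def inner_diff_left)
  have "n \<bullet> xs = n \<bullet> p + (u \<bullet> xs) / (u \<bullet> u) * (n \<bullet> u)"
    by (simp add: p_def rej_def inner_diff_right)
  then have nxs: "n \<bullet> xs = 0" using nu np by simp
  have "expected_loss m t xs h (u + s *\<^sub>R n) = expected_loss m t xs h (u - s *\<^sub>R n)" for s
  proof -
    have "norm (u + s *\<^sub>R n) = norm (u - s *\<^sub>R n)"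
      using nu by (simp add: norm_eq inner_add_left inner_add_right inner_diff_left inner_diff_right inner_commute)
    then obtain T where T: "orthogonal_transformation T" "T (u + s *\<^sub>R n) = u - s *\<^sub>R n"
      "\<And>c. c \<bullet> (u + s *\<^sub>R n) = c \<bullet> (u - s *\<^sub>R n) \<Longrightarrow> T c = c"
      by (rule orthogonal_swap_exists) blast
    have "T xs = xs"
      by (rule T(3)) (use nxs in \<open>simp add: inner_add_right inner_diff_right inner_commute\<close>)
    then show ?thesis using expected_loss_orthogonal[OF T(1) h, of m t xs "u + s *\<^sub>R n"] T(2) by simp
  qed
  then have "n \<bullet> g = 0" by (rule GDERIV_even_direction[OF g])
  moreover have "g = n + ((u \<bullet> g) / (u \<bullet> u)) *\<^sub>R u + ((g \<bullet> p) / (p \<bullet> p)) *\<^sub>R p"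
    by (simp add: n_def rej_def)
  then have "n \<bullet> g = n \<bullet> n + (u \<bullet> g) / (u \<bullet> u) * (n \<bullet> u) + (g \<bullet> p) / (p \<bullet> p) * (n \<bullet> p)"
    by (metis inner_add_right inner_scaleR_right)
  ultimately have "n \<bullet> n = 0" using nu np by simp
  then show ?thesis by (simp add: n_def)
qed

text \<open>
  The constant is uniform over all differentiability points whose norm and angle to \<open>xs\<close> are
  controlled, including those outside the unit ball.
\<close>

lemma expected_loss_gradient_bound:
  fixes xs :: "real ^ 'd::finite"
  assumes h: "h \<in> H_plus" and m: "m \<ge> 1" and xs: "norm xs = 1" and s0: "0 < s0"
  obtains C where "C > 0" "\<And>u g. u \<in> interior (loss_domain m t xs h) \<Longrightarrow>
    GDERIV (expected_loss m t xs h) u :> g \<Longrightarrow> 1/2 \<le> norm u \<Longrightarrow> norm u \<le> 2 \<Longrightarrow>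
    0 < u \<bullet> xs \<Longrightarrow> s0 \<le> norm (rej u xs) \<Longrightarrow> g \<bullet> rej u xs \<le> - C * norm (rej u xs)"
proof -
  define b where "b = \<bar>t\<bar> + 4 * (\<bar>t\<bar> + 1)"
  define B where "B = 1 + 4 * b / s0"
  have b0: "0 \<le> b" by (simp add: b_def)
  then have B: "1 \<le> B" using s0 by (simp add: B_def)
  have Bb: "b < s0 / 4 * B" using s0 by (simp add: B_def field_simps)
  define K where "K = ((std_normal_density (B + 1))\<^sup>2) ^ m / 2 * (h 1 - h (- 1))"
  have "h 1 - h (- 1) > 0"
    using strict_monoD[OF H_plus_odd_part_strict_mono[OF h], of 0 1] by simp
  moreover have "0 < std_normal_density (B + 1)" by (rule normal_density_pos) simp
  ultimately have K: "K > 0" by (simp add: K_def)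
  have "g \<bullet> rej u xs \<le> - (K / 2) * norm (rej u xs)"
    if u: "u \<in> interior (loss_domain m t xs h)" and g: "GDERIV (expected_loss m t xs h) u :> g"
      and nu: "1/2 \<le> norm u" "norm u \<le> 2" and c0: "0 < u \<bullet> xs" and s: "s0 \<le> norm (rej u xs)" for u g
  proof -
    let ?f = "expected_loss m t xs h" and ?D = "loss_domain m t xs h"
    define r where "r = norm u"
    have r: "1/2 \<le> r" "r \<le> 2" using nu by (simp_all add: r_def)
    have u0: "u \<noteq> 0" using nu by auto
    define e where "e = u /\<^sub>R r"
    have e: "norm e = 1" "u = r *\<^sub>R e" using u0 by (simp_all add: e_def r_def)
    define c where "c = e \<bullet> xs"
    have c: "0 < c" using c0 r by (simp add: c_def e_def)
    define p where "p = rej u xs"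
    have p_eq: "p = xs - c *\<^sub>R e"
    proof -
      have "u \<bullet> u = r * r" by (simp add: r_def power2_norm_eq_inner[symmetric] power2_eq_square)
      then show ?thesis by (simp add: p_def rej_def c_def e_def divide_inverse)
    qed
    define \<sigma> where "\<sigma> = norm p"
    have \<sigma>: "s0 \<le> \<sigma>" using s by (simp add: \<sigma>_def p_def)
    then have \<sigma>0: "0 < \<sigma>" using s0 by linarith
    define f where "f = p /\<^sub>R \<sigma>"
    have f: "norm f = 1" "p = \<sigma> *\<^sub>R f" using \<sigma>0 by (simp_all add: f_def \<sigma>_def)
    have ee: "e \<bullet> e = 1" "f \<bullet> f = 1" using e f by (simp_all add: norm_eq_1)
    have ep: "e \<bullet> p = 0" by (simp add: p_eq inner_diff_right ee c_def)
    have ef: "e \<bullet> f = 0" "f \<bullet> e = 0" using ep by (simp_all add: f_def inner_commute)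
    have xs_eq: "xs = c *\<^sub>R e + \<sigma> *\<^sub>R f" using p_eq f(2) by (simp add: algebra_simps)
    have cs: "c\<^sup>2 + \<sigma>\<^sup>2 = 1"
    proof -
      have "1 = xs \<bullet> xs" using xs by (simp add: norm_eq_1)
      also have "\<dots> = c * c + \<sigma> * \<sigma>"
        by (subst (1 2) xs_eq) (simp add: inner_add_left inner_add_right ee ef)
      finally show ?thesis by (simp add: power2_eq_square)
    qed
    \<comment> \<open>The circle through \<open>u\<close> in the plane of \<open>u\<close> and \<open>xs\<close>, traversed away from \<open>xs\<close> at angular speed 2.\<close>
    define \<gamma> where "\<gamma> \<delta> = r *\<^sub>R (cos (2 * \<delta>) *\<^sub>R e - sin (2 * \<delta>) *\<^sub>R f)" for \<delta>
    have \<gamma>0: "\<gamma> 0 = u" by (simp add: \<gamma>_def e(2)[symmetric])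
    have d\<gamma>: "(\<gamma> has_vector_derivative (- 2 * r) *\<^sub>R f) (at 0)"
      unfolding \<gamma>_def[abs_def] by (auto intro!: derivative_eq_intros)
    have d1: "((\<lambda>\<delta>. ?f (\<gamma> \<delta>)) has_real_derivative ((- 2 * r) *\<^sub>R f) \<bullet> g) (at 0)"
      by (rule GDERIV_along_curve) (use g \<gamma>0 d\<gamma> in auto)
    have "((\<lambda>\<delta>. K * (r * sin \<delta>)) has_real_derivative K * r) (at 0)"
      by (auto intro!: derivative_eq_intros)
    with d1 have dF: "((\<lambda>\<delta>. ?f (\<gamma> \<delta>) - K * (r * sin \<delta>)) has_real_derivative ((- 2 * r) *\<^sub>R f) \<bullet> g - K * r) (at 0)"
      by (rule DERIV_diff)
    have gain: "?f u + K * (r * sin \<delta>) \<le> ?f (\<gamma> \<delta>)"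
      if \<delta>: "0 < \<delta>" "\<delta> < pi / 2" and cw: "0 \<le> c * cos \<delta> - \<sigma> * sin \<delta>"
        and cos: "1/2 \<le> cos \<delta>" and tan: "sin \<delta> / cos \<delta> \<le> s0 / 4" and dom: "\<gamma> \<delta> \<in> ?D" for \<delta>
    proof -
      have sn: "0 < sin \<delta>" using \<delta> by (intro sin_gt_zero) auto
      have cn: "\<sigma> * cos \<delta> \<le> c * sin \<delta> + \<sigma> * cos \<delta>" using c sn by simp
      have sc: "\<sigma> * cos \<delta> > 0" using \<sigma>0 cos by simp
      \<comment> \<open>The bisector of \<open>u\<close> and \<open>\<gamma> \<delta>\<close> is \<open>e\<close> rotated by \<open>\<delta>\<close>.\<close>
      interpret W: wedge "cos \<delta> *\<^sub>R e - sin \<delta> *\<^sub>R f" "sin \<delta> *\<^sub>R e + cos \<delta> *\<^sub>R f"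
        "r * cos \<delta>" "r * sin \<delta>" "c * cos \<delta> - \<sigma> * sin \<delta>" "c * sin \<delta> + \<sigma> * cos \<delta>"
      proof
        show "norm (cos \<delta> *\<^sub>R e - sin \<delta> *\<^sub>R f) = 1" "norm (sin \<delta> *\<^sub>R e + cos \<delta> *\<^sub>R f) = 1"
          using sin_cos_squared_add[of \<delta>]
          by (simp_all add: norm_eq_1 inner_add_left inner_add_right inner_diff_left inner_diff_right ee ef power2_eq_square add.commute)
        show "(cos \<delta> *\<^sub>R e - sin \<delta> *\<^sub>R f) \<bullet> (sin \<delta> *\<^sub>R e + cos \<delta> *\<^sub>R f) = 0"
          by (simp add: inner_add_right inner_diff_left ee ef)
        show "0 < r * cos \<delta>" "0 < r * sin \<delta>" using r cos sn by simp_all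
        show "0 \<le> c * cos \<delta> - \<sigma> * sin \<delta>" by (rule cw)
        show "0 < c * sin \<delta> + \<sigma> * cos \<delta>" using cn sc by linarith
        have "(c * C - \<sigma> * D)\<^sup>2 + (c * D + \<sigma> * C)\<^sup>2 = (c\<^sup>2 + \<sigma>\<^sup>2) * (D\<^sup>2 + C\<^sup>2)" for C D :: real
          by (simp add: power2_eq_square algebra_simps)
        then show "(c * cos \<delta> - \<sigma> * sin \<delta>)\<^sup>2 + (c * sin \<delta> + \<sigma> * cos \<delta>)\<^sup>2 = 1"
          by (simp add: cs)
      qed
      have S1: "cos \<delta> * cos \<delta> + sin \<delta> * sin \<delta> = 1"
        using sin_cos_squared_add3[of \<delta>] by simp
      have rot: "(r * C) *\<^sub>R (C *\<^sub>R e - D *\<^sub>R f) + (r * D) *\<^sub>R (D *\<^sub>R e + C *\<^sub>R f) = (r * (C * C + D * D)) *\<^sub>R e"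
        "(r * C) *\<^sub>R (C *\<^sub>R e - D *\<^sub>R f) - (r * D) *\<^sub>R (D *\<^sub>R e + C *\<^sub>R f) = r *\<^sub>R ((C\<^sup>2 - D\<^sup>2) *\<^sub>R e - (D * C + D * C) *\<^sub>R f)"
        "(c * C - \<sigma> * D) *\<^sub>R (C *\<^sub>R e - D *\<^sub>R f) + (c * D + \<sigma> * C) *\<^sub>R (D *\<^sub>R e + C *\<^sub>R f)
          = (C * C + D * D) *\<^sub>R (c *\<^sub>R e + \<sigma> *\<^sub>R f)" for C D
        unfolding vec_eq_iff by (simp_all add: algebra_simps power2_eq_square)
      have Wu: "W.u = u" unfolding W.u_def rot(1) S1 e(2) by simp
      have "sin (2 * \<delta>) = sin \<delta> * cos \<delta> + sin \<delta> * cos \<delta>" by (simp add: sin_double)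
      then have Wu': "W.u' = \<gamma> \<delta>" unfolding W.u'_def rot(2) \<gamma>_def cos_double by simp
      have Wv: "W.v = xs" unfolding W.v_def rot(3) S1 xs_eq by simp
      have "r * cos \<delta> \<le> 2"
        using r cos cos_le_one[of \<delta>] mult_mono[of r 2 "cos \<delta>" 1] by simp
      moreover have "\<bar>t\<bar> + (\<bar>t\<bar> + 1) / (r * cos \<delta>) + r * sin \<delta> * B / (r * cos \<delta>) < (c * sin \<delta> + \<sigma> * cos \<delta>) * B"
      proof -
        have "1/2 * (1/2) \<le> r * cos \<delta>" using r cos by (intro mult_mono) auto
        then have "(\<bar>t\<bar> + 1) / (r * cos \<delta>) \<le> (\<bar>t\<bar> + 1) / (1/4)" by (intro divide_left_mono) auto
        then have q1: "(\<bar>t\<bar> + 1) / (r * cos \<delta>) \<le> 4 * (\<bar>t\<bar> + 1)" by simp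
        have "r * sin \<delta> * B / (r * cos \<delta>) = sin \<delta> / cos \<delta> * B" using r by simp
        also have "\<dots> \<le> s0 / 4 * B" using tan B by (intro mult_right_mono) auto
        finally have q2: "r * sin \<delta> * B / (r * cos \<delta>) \<le> s0 / 4 * B" .
        have "s0 * (1/2) \<le> \<sigma> * cos \<delta>" using \<sigma> cos s0 by (intro mult_mono) auto
        then have q3: "s0 / 2 * B \<le> (c * sin \<delta> + \<sigma> * cos \<delta>) * B" using cn B by (intro mult_right_mono) auto
        have "\<bar>t\<bar> + (\<bar>t\<bar> + 1) / (r * cos \<delta>) + r * sin \<delta> * B / (r * cos \<delta>) \<le> b + s0 / 4 * B"
          unfolding b_def by (intro add_mono order_refl q1 q2)
        also have "\<dots> < s0 / 4 * B + s0 / 4 * B" using Bb by (rule add_strict_right_mono)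
        also have "\<dots> = s0 / 2 * B" by simp
        also note q3
        finally show ?thesis .
      qed
      moreover have "W.u \<in> loss_domain m t W.v h" "W.u' \<in> loss_domain m t W.v h"
        unfolding Wu Wu' Wv using u interior_subset dom by auto
      ultimately have "expected_loss m t W.v h W.u + ((std_normal_density (B + 1))\<^sup>2) ^ m / 2 * (r * sin \<delta>) * (h 1 - h (- 1))
          \<le> expected_loss m t W.v h W.u'"
        by (intro W.expected_loss_gain[OF h m B])
      then show ?thesis unfolding Wu Wu' Wv K_def by (simp add: mult_ac)
    qed
    have ev: "\<forall>\<^sub>F \<delta> in at_right 0. ?f u + K * (r * sin \<delta>) \<le> ?f (\<gamma> \<delta>)"
    proof -
      have "\<forall>\<^sub>F \<delta> in at_right (0::real). 0 < \<delta>" by (simp add: eventually_at_right_less)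
      moreover have "\<forall>\<^sub>F \<delta> in at_right (0::real). \<delta> < pi / 2"
        by (rule order_tendstoD(2)[of _ 0]) (auto intro!: tendsto_eq_intros)
      moreover have "\<forall>\<^sub>F \<delta> in at_right (0::real). 0 < c * cos \<delta> - \<sigma> * sin \<delta>"
        by (rule order_tendstoD(1)[of _ c]) (use c in \<open>auto intro!: tendsto_eq_intros\<close>)
      moreover have "\<forall>\<^sub>F \<delta> in at_right (0::real). 1/2 < cos \<delta>"
        by (rule order_tendstoD(1)[of _ 1]) (auto intro!: tendsto_eq_intros)
      moreover have "\<forall>\<^sub>F \<delta> in at_right (0::real). sin \<delta> / cos \<delta> < s0 / 4"
        by (rule order_tendstoD(2)[of _ 0]) (use s0 in \<open>auto intro!: tendsto_eq_intros\<close>)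
      moreover have "\<forall>\<^sub>F \<delta> in at_right (0::real). \<gamma> \<delta> \<in> interior ?D"
      proof (rule topological_tendstoD)
        have "isCont \<gamma> 0" using d\<gamma> by (rule has_vector_derivative_continuous)
        then show "(\<gamma> \<longlongrightarrow> u) (at_right 0)"
          unfolding isCont_def \<gamma>0 by (rule tendsto_within_subset) simp
      qed (use u in auto)
      ultimately show ?thesis
      proof eventually_elim
        case (elim \<delta>)
        then show ?case using interior_subset[of ?D] by (intro gain) auto
      qed
    qed
    have "0 \<le> ((- 2 * r) *\<^sub>R f) \<bullet> g - K * r"
    proof (rule ccontr)
      assume "\<not> ?thesis"
      then have neg: "((- 2 * r) *\<^sub>R f) \<bullet> g - K * r < 0" by simp
      obtain d where d: "0 < d" "\<And>\<delta>. 0 < \<delta> \<Longrightarrow> \<delta> < d \<Longrightarrow>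
          ?f (\<gamma> (0 + \<delta>)) - K * (r * sin (0 + \<delta>)) < ?f (\<gamma> 0) - K * (r * sin 0)"
        using has_real_derivative_neg_dec_right[OF dF neg] by auto
      have "\<forall>\<^sub>F \<delta> in at_right (0::real). 0 < \<delta> \<and> \<delta> < d"
        using d(1) by (auto simp: eventually_at_right_field)
      with ev have "\<forall>\<^sub>F \<delta> in at_right (0::real). False"
      proof eventually_elim
        case (elim \<delta>)
        then show ?case using d(2)[of \<delta>] by (simp add: \<gamma>0)
      qed
      then show False by simp
    qed
    then have "r * (2 * (g \<bullet> f) + K) \<le> 0" by (simp add: inner_commute algebra_simps)
    then have "g \<bullet> f \<le> - (K / 2)" using r by (simp add: mult_le_0_iff)
    then have "\<sigma> * (g \<bullet> f) \<le> \<sigma> * - (K / 2)" using \<sigma>0 by (intro mult_left_mono) auto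
    then have "g \<bullet> p \<le> - (K / 2) * \<sigma>" by (simp add: f(2) mult.commute)
    then show ?thesis by (simp add: p_def \<sigma>_def)
  qed
  then show ?thesis using K by (intro that[of "K / 2"]) auto
qed

section \<open>Limits of gradients at the unit sphere\<close>

text \<open>
  Limits of gradients inherit the direction and the bound, and both conditions are convex in \<open>\<xi>\<close>.
\<close>

lemma expected_loss_riemannian_gradient:
  fixes x xs :: "real ^ 'd::finite"
  assumes h: "h \<in> H_plus" and m: "m \<ge> 1" and x: "norm x = 1" and xs: "norm xs = 1"
    and c: "0 < x \<bullet> xs" "x \<bullet> xs < 1"
  obtains K where "K > 0" "\<And>\<xi>. \<xi> \<in> clarke_subdiff (loss_domain m t xs h) (expected_loss m t xs h) x \<Longrightarrow>
    rej x \<xi> = ((\<xi> \<bullet> rej x xs) / (rej x xs \<bullet> rej x xs)) *\<^sub>R rej x xs \<and> \<xi> \<bullet> rej x xs \<le> - K"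
proof -
  let ?f = "expected_loss m t xs h" and ?S = "loss_domain m t xs h"
  define p where "p u = rej u xs" for u
  have xx: "x \<bullet> x = 1" "xs \<bullet> xs = 1" using x xs by (simp_all add: norm_eq_1)
  have pp: "p x \<bullet> p x = 1 - (x \<bullet> xs)\<^sup>2"
    by (simp add: p_def rej_def xx inner_diff_left inner_diff_right inner_commute power2_eq_square)
  also have "\<dots> > 0" using c by (simp add: abs_square_less_1)
  finally have p0: "p x \<noteq> 0" by auto
  define s0 where "s0 = norm (p x) / 2"
  have s0: "0 < s0" using p0 by (simp add: s0_def)
  obtain C where C: "C > 0" "\<And>u g. u \<in> interior ?S \<Longrightarrow> GDERIV ?f u :> g \<Longrightarrow> 1/2 \<le> norm u \<Longrightarrow> norm u \<le> 2 \<Longrightarrow>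
    0 < u \<bullet> xs \<Longrightarrow> s0 \<le> norm (rej u xs) \<Longrightarrow> g \<bullet> rej u xs \<le> - C * norm (rej u xs)"
    by (rule expected_loss_gradient_bound[OF h m xs s0, of t]) blast
  define K where "K = C * norm (p x)"
  have K: "K > 0" using C p0 by (simp add: K_def)
  define V where "V = {\<xi>. rej x \<xi> = ((\<xi> \<bullet> p x) / (p x \<bullet> p x)) *\<^sub>R p x \<and> \<xi> \<bullet> p x \<le> - K}"
  have "convex V"
  proof (rule convexI)
    fix \<xi> \<zeta> and a b :: real
    assume V: "\<xi> \<in> V" "\<zeta> \<in> V" and ab: "0 \<le> a" "0 \<le> b" "a + b = 1"
    have "rej x (a *\<^sub>R \<xi> + b *\<^sub>R \<zeta>) = a *\<^sub>R rej x \<xi> + b *\<^sub>R rej x \<zeta>"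
      by (simp add: rej_def xx inner_add_right algebra_simps)
    also have "\<dots> = (((a *\<^sub>R \<xi> + b *\<^sub>R \<zeta>) \<bullet> p x) / (p x \<bullet> p x)) *\<^sub>R p x"
      using V unfolding V_def by (simp add: inner_add_left add_divide_distrib scaleR_add_left)
    finally have 1: "rej x (a *\<^sub>R \<xi> + b *\<^sub>R \<zeta>) = (((a *\<^sub>R \<xi> + b *\<^sub>R \<zeta>) \<bullet> p x) / (p x \<bullet> p x)) *\<^sub>R p x" .
    have "a * (\<xi> \<bullet> p x) + b * (\<zeta> \<bullet> p x) \<le> a * (- K) + b * (- K)"
      using V ab unfolding V_def by (intro add_mono mult_left_mono) auto
    also have "\<dots> = - K" using ab(3) by (metis distrib_right mult_1)
    finally show "a *\<^sub>R \<xi> + b *\<^sub>R \<zeta> \<in> V" using 1 by (simp add: V_def inner_add_left)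
  qed
  moreover have "{\<xi>. \<exists>u g. (\<forall>k::nat. u k \<in> interior ?S \<and> GDERIV ?f (u k) :> g k) \<and> u \<longlonglongrightarrow> x \<and> g \<longlonglongrightarrow> \<xi>} \<subseteq> V"
  proof safe
    fix \<xi> and u g :: "nat \<Rightarrow> real ^ 'd"
    assume ug: "\<forall>k. u k \<in> interior ?S \<and> GDERIV ?f (u k) :> g k" and u: "u \<longlonglongrightarrow> x" and g: "g \<longlonglongrightarrow> \<xi>"
    have rej_lim: "(\<lambda>k. rej (u k) (v k)) \<longlonglongrightarrow> rej x v0" if "v \<longlonglongrightarrow> v0" for v v0
      unfolding rej_def using xx by (intro tendsto_intros u that) simp
    have p: "(\<lambda>k. p (u k)) \<longlonglongrightarrow> p x" unfolding p_def by (rule rej_lim) simp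
    have "\<forall>\<^sub>F k in sequentially. 1/2 < norm (u k)"
      by (rule order_tendstoD(1)[OF tendsto_norm[OF u]]) (simp add: x)
    moreover have "\<forall>\<^sub>F k in sequentially. norm (u k) < 2"
      by (rule order_tendstoD(2)[OF tendsto_norm[OF u]]) (simp add: x)
    moreover have "\<forall>\<^sub>F k in sequentially. 0 < u k \<bullet> xs"
      by (rule order_tendstoD(1)[OF tendsto_inner[OF u tendsto_const] c(1)])
    moreover have "\<forall>\<^sub>F k in sequentially. s0 < norm (p (u k))"
      by (rule order_tendstoD(1)[OF tendsto_norm[OF p]]) (use p0 in \<open>simp add: s0_def\<close>)
    ultimately have ev: "\<forall>\<^sub>F k in sequentially. g k \<bullet> p (u k) \<le> - C * norm (p (u k)) \<and>
        rej (u k) (g k) = ((g k \<bullet> p (u k)) / (p (u k) \<bullet> p (u k))) *\<^sub>R p (u k)"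
    proof eventually_elim
      case (elim k)
      have "u k \<noteq> 0" using elim(1) by auto
      then show ?case
        using elim ug C(2)[of "u k" "g k"]
          expected_loss_gradient_span[OF H_plus_measurable[OF h], of m t xs "u k" "g k"]
        by (simp add: p_def)
    qed
    have "\<xi> \<bullet> p x \<le> - C * norm (p x)"
      by (rule tendsto_le[OF _ tendsto_mult_left[OF tendsto_norm[OF p]] tendsto_inner[OF g p]])
         (use ev in \<open>auto elim: eventually_mono\<close>)
    moreover have "rej x \<xi> = ((\<xi> \<bullet> p x) / (p x \<bullet> p x)) *\<^sub>R p x"
    proof (rule tendsto_unique[OF _ rej_lim[OF g]])
      have "(\<lambda>k. ((g k \<bullet> p (u k)) / (p (u k) \<bullet> p (u k))) *\<^sub>R p (u k)) \<longlonglongrightarrow> ((\<xi> \<bullet> p x) / (p x \<bullet> p x)) *\<^sub>R p x"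
        using p0 by (intro tendsto_intros g p) simp
      then show "(\<lambda>k. rej (u k) (g k)) \<longlonglongrightarrow> ((\<xi> \<bullet> p x) / (p x \<bullet> p x)) *\<^sub>R p x"
        by (rule Lim_transform_eventually) (use ev in \<open>auto elim!: eventually_mono\<close>)
    qed simp
    ultimately show "\<xi> \<in> V" by (simp add: V_def K_def)
  qed
  ultimately have "clarke_subdiff ?S ?f x \<subseteq> V"
    unfolding clarke_subdiff_def by (intro hull_minimal)
  then show ?thesis using K by (intro that[of K]) (auto simp: V_def p_def)
qed

text \<open>
  The points \<open>r x\<close> approach \<open>x\<close> from inside the ball, where the gradients exist and stay bounded.
\<close>

lemma clarke_subdiff_nonempty:
  fixes x xs :: "real ^ 'd::finite"
  assumes h: "h \<in> H_plus" and m: "m \<ge> 1" and x: "norm x = 1" and xs: "norm xs = 1"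
    and c: "\<bar>x \<bullet> xs\<bar> < 1"
  shows "clarke_subdiff (loss_domain m t xs h) (expected_loss m t xs h) x \<noteq> {}"
proof -
  let ?f = "expected_loss m t xs h" and ?S = "loss_domain m t xs h"
  obtain K where K: "\<And>r q. 0 < r \<Longrightarrow> r < 1 \<Longrightarrow> q \<bullet> (r *\<^sub>R x) = 1 \<Longrightarrow> q \<bullet> xs = 0 \<Longrightarrow>
    \<exists>G. GDERIV ?f (r *\<^sub>R x) :> G \<and> norm G \<le> norm q * K"
    by (rule expected_loss_differentiable[OF h m x, of xs t]) blast
  \<comment> \<open>Up to a factor this is the vector \<open>q\<close> in the change of measure: it is orthogonal to \<open>xs\<close> but not to \<open>x\<close>.\<close>
  define q where "q = x - (x \<bullet> xs) *\<^sub>R xs"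
  have xx: "x \<bullet> x = 1" "xs \<bullet> xs = 1" using x xs by (simp_all add: norm_eq_1)
  have qx: "q \<bullet> x = 1 - (x \<bullet> xs)\<^sup>2" and qxs: "q \<bullet> xs = 0"
    by (simp_all add: q_def inner_diff_left xx inner_commute[of xs x] power2_eq_square)
  have q0: "q \<bullet> x > 0" unfolding qx using c by (simp add: abs_square_less_1)
  define r where "r k = 1 - 1 / real (k + 2)" for k
  have r: "1/2 \<le> r k" "r k < 1" for k
    by (simp_all add: r_def field_simps)
  have r': "0 < r k" for k using r(1)[of k] by linarith
  have "\<exists>G. GDERIV ?f (r k *\<^sub>R x) :> G \<and> norm G \<le> 2 * (norm q / (q \<bullet> x)) * \<bar>K\<bar>" for k
  proof -
    let ?q = "(1 / (r k * (q \<bullet> x))) *\<^sub>R q"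
    have "?q \<bullet> (r k *\<^sub>R x) = 1" "?q \<bullet> xs = 0" using r'[of k] q0 qxs by simp_all
    from K[OF r' r(2) this] obtain G where G: "GDERIV ?f (r k *\<^sub>R x) :> G" "norm G \<le> norm ?q * K" by blast
    have "norm ?q * K \<le> norm ?q * \<bar>K\<bar>" by (intro mult_left_mono) auto
    also have "norm ?q * \<bar>K\<bar> = 1 / r k * (norm q / (q \<bullet> x)) * \<bar>K\<bar>" using r'[of k] q0 by simp
    also have "1 / r k * (norm q / (q \<bullet> x)) * \<bar>K\<bar> \<le> 2 * (norm q / (q \<bullet> x)) * \<bar>K\<bar>"
      using r[of k] r'[of k] q0 by (intro mult_right_mono) (auto simp: field_simps)
    finally have "norm ?q * K \<le> 2 * (norm q / (q \<bullet> x)) * \<bar>K\<bar>" .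
    from order_trans[OF G(2) this] G(1) show ?thesis by blast
  qed
  then obtain G where G: "\<And>k. GDERIV ?f (r k *\<^sub>R x) :> G k"
      "\<And>k. norm (G k) \<le> 2 * (norm q / (q \<bullet> x)) * \<bar>K\<bar>"
    by metis
  have "seq_compact (cball (0 :: real ^ 'd) (2 * (norm q / (q \<bullet> x)) * \<bar>K\<bar>))"
    by (rule compact_imp_seq_compact) simp
  then obtain \<xi> \<phi> where \<phi>: "strict_mono \<phi>" "(G \<circ> \<phi>) \<longlonglongrightarrow> \<xi>"
    using G(2) unfolding seq_compact_def by (metis mem_cball_0)
  have "r \<longlonglongrightarrow> 1"
  proof -
    have "(\<lambda>k. 1 - 1 / real (k + 2)) \<longlonglongrightarrow> 1 - 0"
      by (intro tendsto_intros LIMSEQ_ignore_initial_segment[of "\<lambda>k. 1 / real k" 0 2] lim_1_over_n)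
    then show ?thesis by (simp add: r_def[abs_def])
  qed
  then have "(\<lambda>k. r k *\<^sub>R x) \<longlonglongrightarrow> 1 *\<^sub>R x" by (intro tendsto_intros)
  from LIMSEQ_subseq_LIMSEQ[OF this \<phi>(1)] have u: "((\<lambda>k. r k *\<^sub>R x) \<circ> \<phi>) \<longlonglongrightarrow> x" by simp
  have "ball 0 1 \<subseteq> interior ?S"
    by (intro interior_maximal subset_trans[OF ball_subset_cball cball_subset_loss_domain[OF h m]]) simp
  then have int: "r k *\<^sub>R x \<in> interior ?S" for k using r[of k] r'[of k] x by (auto simp: subset_eq)
  have "\<xi> \<in> {\<xi>. \<exists>u g. (\<forall>k::nat. u k \<in> interior ?S \<and> GDERIV ?f (u k) :> g k) \<and> u \<longlonglongrightarrow> x \<and> g \<longlonglongrightarrow> \<xi>}"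
    using u \<phi>(2) int G(1) by (intro CollectI exI[of _ "(\<lambda>k. r k *\<^sub>R x) \<circ> \<phi>"] exI[of _ "G \<circ> \<phi>"]) simp
  then have "\<xi> \<in> clarke_subdiff ?S ?f x"
    unfolding clarke_subdiff_def by (rule hull_inc)
  then show ?thesis by blast
qed

theorem theorem5p7:
  fixes m :: nat and t :: real and h :: "real \<Rightarrow> real" and x xs :: "real ^ 'd"
  assumes "m \<ge> 1"
    and "xs \<in> sphere 0 1"
    and "h \<in> H_plus"
    and "x \<in> sphere 0 1"
    and "angle_between x xs \<in> {0<..<pi/2}"
  shows "is_RGA 1 (loss_domain m t xs h) (expected_loss m t xs h) x xs"
proof -
  let ?f = "expected_loss m t xs h" and ?S = "loss_domain m t xs h"
  note h = assms(3) and m = assms(1)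
  have x: "norm x = 1" and xs: "norm xs = 1" using assms by auto
  have xx: "x \<bullet> x = 1" "xs \<bullet> xs = 1" using x xs by (simp_all add: norm_eq_1)
  let ?c = "x \<bullet> xs" and ?\<theta> = "angle_between x xs"
  have c1: "\<bar>?c\<bar> \<le> 1" using Cauchy_Schwarz_ineq2[of x xs] x xs by simp
  then have cos: "cos ?\<theta> = ?c" by (simp add: angle_between_def abs_le_iff cos_arccos)
  have th: "0 < ?\<theta>" "?\<theta> < pi / 2" using assms(5) by auto
  have c: "0 < ?c" unfolding cos[symmetric] using th by (intro cos_gt_zero_pi) auto
  have "cos ?\<theta> < cos 0" using th by (intro cos_monotone_0_pi) auto
  then have c2: "?c < 1" unfolding cos by simp
  define p where "p = rej x xs"
  have p_xs: "p \<bullet> xs = 1 - ?c\<^sup>2" and pp: "p \<bullet> p = 1 - ?c\<^sup>2"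
    by (simp_all add: p_def rej_def xx inner_diff_left inner_diff_right inner_commute power2_eq_square)
  have sin: "sin ?\<theta> = norm p"
  proof -
    have "sin ?\<theta> = sqrt (1 - ?c\<^sup>2)" using c1 by (simp add: angle_between_def abs_le_iff sin_arccos)
    then show ?thesis by (simp add: norm_eq_sqrt_inner pp)
  qed
  have p0: "p \<noteq> 0" using th sin sin_gt_zero[of ?\<theta>] by auto
  obtain K where K: "K > 0" "\<And>\<xi>. \<xi> \<in> clarke_subdiff ?S ?f x \<Longrightarrow>
    rej x \<xi> = ((\<xi> \<bullet> rej x xs) / (rej x xs \<bullet> rej x xs)) *\<^sub>R rej x xs \<and> \<xi> \<bullet> rej x xs \<le> - K"
    by (rule expected_loss_riemannian_gradient[OF h m x xs c c2, of t]) blast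
  have rej: "\<xi> - (x \<bullet> \<xi>) *\<^sub>R x = rej x \<xi>" for \<xi> by (simp add: rej_def xx)
  show ?thesis
    unfolding is_RGA_def
  proof (intro conjI ballI)
    show "x \<in> ?S" using cball_subset_loss_domain[OF h m, of t xs] x by auto
    show "riemannian_clarke_subdiff ?S ?f x \<noteq> {}"
      unfolding riemannian_clarke_subdiff_def
      using clarke_subdiff_nonempty[OF h m x xs, of t] c c2 by auto
    fix g assume "g \<in> riemannian_clarke_subdiff ?S ?f x"
    then obtain \<xi> where \<xi>: "\<xi> \<in> clarke_subdiff ?S ?f x" "g = rej x \<xi>"
      unfolding riemannian_clarke_subdiff_def rej by auto
    define a where "a = (\<xi> \<bullet> p) / (p \<bullet> p)"
    have g: "g = a *\<^sub>R p" and "\<xi> \<bullet> p < 0"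
      using K(2)[OF \<xi>(1)] K(1) unfolding \<xi>(2) a_def p_def by auto
    moreover have "p \<bullet> p > 0" using p0 by simp
    ultimately have a: "a < 0" by (simp add: a_def divide_neg_pos)
    show "x \<noteq> xs \<longrightarrow> g \<noteq> 0" using a p0 g by simp
    have "g \<bullet> xs = a * (norm p)\<^sup>2" by (simp add: g p_xs pp[symmetric] power2_norm_eq_inner)
    also have "\<dots> = - 1 * sin ?\<theta> * norm g"
      using a by (simp add: g sin power2_eq_square)
    finally show "g \<bullet> xs \<le> - 1 * sin ?\<theta> * norm g" by simp
  qed
qed

end
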